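(* Let $P\subseteq\mathbb{R}^3$ be a lattice $3$-polytope of width larger than one. Then exactly one of the following happens: (1) $P$ is quasi-minimal; (2) $P$ is merged; (3) $P$ has size $6$ and is unimodularly equivalent to the convex hull of the six points $(0,0,0)$, $(1,0,0)$, $(0,1,0)$, $(-1,-1,0)$, $(1,2,3)$, $(-1,-2,-3)$.
   Context: A lattice polytope in $\mathbb{R}^d$ is the convex hull of finitely many points of $\mathbb{Z}^d$; its size is $|P\cap\mathbb{Z}^d|$. Two lattice polytopes $P,Q$ are unimodularly equivalent if there is an affine map $t:\mathbb{R}^d\to\mathbb{R}^d$ with $t(\mathbb{Z}^d)=\mathbb{Z}^d$ and $t(P)=Q$. An affine functional $f$ is integer if $f(\mathbb{Z}^d)\subseteq\mathbb{Z}$. The width of a polytope $S$ is the minimum, over all non-constant integer affine functionals $f$, of $\max_{S} f-\min_S f$ (so a polytope that is not full-dimensional has width $0$). For a lattice polytope $P$ and a vertex $v$ of $P$, $P^v:=\mathrm{conv}((P\cap\mathbb{Z}^d)\setminus\{v\})$, and $P^{vw}:=(P^v)^w$. For a lattice $d$-polytope $P$ of width larger than one, a vertex $v$ of $P$ is essential if $P^v$ has width at most one (i.e. has width one or is lower-dimensional). $P$ is quasi-minimal if at most one of its vertices is not essential. $P$ is merged if it has two vertices $v,w$ such that $P^v$ and $P^w$ have width larger than one and $P^{vw}$ is $d$-dimensional. *)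

theory Defs
  imports "HOL-Analysis.Analysis"
begin

definition int_lattice :: "(real ^ 'n) set" where
  "int_lattice = {x. \<forall>i. x $ i \<in> \<int>}"

definition affine_map :: "('a::real_vector \<Rightarrow> 'b::real_vector) \<Rightarrow> bool" where
  "affine_map f \<longleftrightarrow> (\<exists>L c. linear L \<and> (\<forall>x. f x = L x + c))"

definition lattice_polytope :: "(real ^ 'n) set \<Rightarrow> bool" where
  "lattice_polytope P \<longleftrightarrow> (\<exists>V. finite V \<and> V \<subseteq> int_lattice \<and> P = convex hull V)"

definition lattice_size :: "(real ^ 'n) set \<Rightarrow> nat" where
  "lattice_size P = card (P \<inter> int_lattice)"

definition unimodularly_equivalent :: "(real ^ 'n) set \<Rightarrow> (real ^ 'n) set \<Rightarrow> bool" where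
  "unimodularly_equivalent P Q \<longleftrightarrow>
     (\<exists>t :: real ^ 'n \<Rightarrow> real ^ 'n. affine_map t \<and> t ` int_lattice = int_lattice \<and> t ` P = Q)"

definition integer_functional :: "(real ^ 'n \<Rightarrow> real) \<Rightarrow> bool" where
  "integer_functional f \<longleftrightarrow> affine_map f \<and> f ` int_lattice \<subseteq> \<int>"

(* On a nonempty polytope S the inner Sup and Inf are the maximum and the minimum of f on S.
   If S is moreover a lattice polytope, the differences are nonnegative integers,
   so the outer Inf is a minimum.  The value at the empty set is meaningless. *)
definition width :: "(real ^ 'n) set \<Rightarrow> real" where
  "width S = Inf {Sup (f ` S) - Inf (f ` S) | f.
                    integer_functional f \<and> \<not> f constant_on UNIV}"

(* P^v; the iterated P^{vw} is delete_vertex (delete_vertex P v) w. *)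
definition delete_vertex :: "(real ^ 'n) set \<Rightarrow> real ^ 'n \<Rightarrow> (real ^ 'n) set" where
  "delete_vertex P v = convex hull (P \<inter> int_lattice - {v})"

(* The next three notions are meant for full-dimensional lattice polytopes of width larger
   than one; vertices are the extreme points. *)
definition essential_vertex :: "(real ^ 'n) set \<Rightarrow> real ^ 'n \<Rightarrow> bool" where
  "essential_vertex P v \<longleftrightarrow> v extreme_point_of P \<and> width (delete_vertex P v) \<le> 1"

definition quasi_minimal :: "(real ^ 'n) set \<Rightarrow> bool" where
  "quasi_minimal P \<longleftrightarrow>
     (\<forall>v w. v extreme_point_of P \<and> \<not> essential_vertex P v \<and>
            w extreme_point_of P \<and> \<not> essential_vertex P w \<longrightarrow> v = w)"

(* The vertices must be required to be distinct, since delete_vertex (delete_vertex P v) v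
   is just delete_vertex P v. *)
definition merged :: "(real ^ 'n) set \<Rightarrow> bool" where
  "merged P \<longleftrightarrow>
     (\<exists>v w. v \<noteq> w \<and> v extreme_point_of P \<and> w extreme_point_of P \<and>
            width (delete_vertex P v) > 1 \<and> width (delete_vertex P w) > 1 \<and>
            aff_dim (delete_vertex (delete_vertex P v) w) = int CARD('n))"

definition exceptional_polytope :: "(real ^ 3) set" where
  "exceptional_polytope = convex hull
     {vector [0, 0, 0], vector [1, 0, 0], vector [0, 1, 0],
      vector [-1, -1, 0], vector [1, 2, 3], vector [-1, -2, -3]}"

end

theory Submission
  imports Defs
begin

text \<open>Let v and w be non-essential vertices of P with all other lattice points in a plane, say at height
  zero; otherwise P is merged. Then deleting v leaves a pyramid of width larger than one over a plane
  lattice set S whose only lattice point outside the plane is the apex w, at height k with |k| at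
  least 2, and likewise with v and w exchanged. Over every unimodular triangle in S the pyramid is an
  empty tetrahedron, so White's theorem restricts the class of the apex modulo k. In particular S
  contains no unimodular parallelogram, and a collinear triple in S forces the class of the apex to
  lie at height one on the side of every neighbouring point. Hence either k is 2 up to sign and S contains
  a collinear triple, or k is 3 up to sign and S is the unimodular triangle with its barycentre.

  In the first case the apexes lie on opposite sides of the plane and their midpoint m is in S. If a
  vertex in the plane were essential, all further points of S would lie on one line at distance one
  from m; this for two such vertices makes the pyramids thin. So P is merged. In the second case P
  is exceptional if the apexes are antipodal about the barycentre, and otherwise at least one
  vertex of the triangle is a non-essential vertex of P, so again P is merged.\<close>

section \<open>Floor sequences and White's congruence\<close>

text \<open>The width of the pyramids is exploited by one device: an integer functional with values
  in {c, c + 1} on a pyramid is a contradiction. This is how congruences become geometry. If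
  \<open>k dvd b - 1\<close>, then b - q k = 1 for some q, so y - q z is 1 at the apex and is 0 or 1
  on the plane strip 0 \<le> y \<le> 1; hence S has a point off that strip. For a single unimodular
  triangle each alternative of White's theorem is such a congruence, so S has a fourth point. Next
  to a collinear triple, a point off the strip exhibits neighbours on both sides of a line, so 1 and
  -1 agree modulo k, and k is 2. The obstacle is White's theorem itself: emptiness gives no
  direction in which the tetrahedron is thin, only inequalities between residues of multiples of the
  apex. These turn out to be rigid: the residues of j p, j q and j (1 - p - q) sum to j + k whenever
  0 < j < k, and dividing by k turns this into the identity between three floor sequences.\<close>

lemma div_step:
  fixes a k j :: int
  assumes "0 < k" "0 \<le> a" "a \<le> k"
  shows "j * a div k \<le> (j+1) * a div k" "(j+1) * a div k \<le> j * a div k + 1"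
proof -
  show "j * a div k \<le> (j+1) * a div k"
    using assms by (intro zdiv_mono1) (auto simp: algebra_simps)
  have "(j+1) * a div k \<le> (j*a + k) div k"
    using assms by (intro zdiv_mono1) (auto simp: algebra_simps)
  then show "(j+1) * a div k \<le> j * a div k + 1" using assms by simp
qed

lemma div_growth:
  fixes a k i j :: int
  assumes "0 < k" "0 \<le> a" "a \<le> k" "i \<le> j"
  shows "j * a div k \<le> i * a div k + (j - i)"
  using assms(4)
proof (induction j rule: int_ge_induct)
  case (step j)
  then show ?case using div_step(2)[OF assms(1-3), of j] by linarith
qed simp

lemma div_eqI:
  fixes x k n :: int
  assumes "n * k \<le> x" "x < (n + 1) * k"
  shows "x div k = n"
proof -
  have k: "0 < k" using assms by (simp add: algebra_simps)
  have "x - n * k \<ge> 0" "x - n * k < k" using assms by (auto simp: algebra_simps)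
  then have "(x - n * k) div k = 0" by simp
  then have "((x - n * k) + n * k) div k = n" using k by (subst div_mult_self1) auto
  then show ?thesis by simp
qed

lemma div_bounds:
  fixes x k :: int
  assumes "0 < k"
  shows "(x div k) * k \<le> x" "x < (x div k + 1) * k"
proof -
  have "x = x div k * k + x mod k" by simp
  moreover have "0 \<le> x mod k" "x mod k < k" using assms by auto
  moreover have "(x div k + 1) * k = x div k * k + k" by (simp add: algebra_simps)
  ultimately show "(x div k) * k \<le> x" "x < (x div k + 1) * k" by linarith+
qed

text \<open>Coprimality keeps the intermediate multiples of \<open>a\<close> and \<open>k\<close>
  apart, which makes the floor estimates at the jump indices strict.\<close>

lemma not_multiple:
  fixes k a n m :: int
  assumes "coprime a k" "0 < n" "n < a"
  shows "m * a \<noteq> n * k"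
proof
  assume "m * a = n * k"
  then have "a dvd n * k" by (metis dvd_triv_right)
  with assms(1) have "a dvd n" by (simp add: coprime_dvd_mult_left_iff)
  with assms(2,3) show False using zdvd_imp_le by force
qed

text \<open>Each index from 1 to k - 2 is a jump of exactly one of the three floor sequences. A jump of the
  c-sequence lies strictly between two consecutive jumps of the b-sequence, which are at most s + 1
  apart. The a-sequence pauses at all three indices, but its pauses are at least s apart, and s is
  at least 2.\<close>

lemma three_floor_sequences:
  fixes a b c k :: int
  assumes ab: "b \<le> a" and bc: "c \<le> b" and c: "2 \<le> c"
    and sum: "a + b + c = k + 1"
    and cop: "coprime a k" "coprime b k" "coprime c k"
    and fl: "\<And>j. 0 < j \<Longrightarrow> j < k \<Longrightarrow> j * a div k + j * b div k + j * c div k = j - 1"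
  shows False
proof -
  have k0: "0 < k" and k5: "5 \<le> k" and ak: "a \<le> k" "b \<le> k" "c \<le> k" using assms by linarith+
  \<comment> \<open>Otherwise the sequences of both \<open>a\<close> and \<open>b\<close> have
    reached 1 at index 2, where the three floors sum to only 1.\<close>
  have b2: "2 * b < k"
  proof (rule ccontr)
    assume "\<not> 2 * b < k"
    then have "k \<le> 2 * b" "k \<le> 2 * a" using ab by auto
    then have "1 \<le> 2 * b div k" "1 \<le> 2 * a div k"
      using k0 zdiv_mono1[of k "2*b" k] zdiv_mono1[of k "2*a" k] by auto
    moreover have "0 \<le> 2 * c div k" using k0 c by (simp add: pos_imp_zdiv_nonneg_iff)
    ultimately show False using fl[of 2] k5 by linarith
  qed
  have jump: "j * a div k + j * b div k + j * c div k + 1 = (j+1) * a div k + (j+1) * b div k + (j+1) * c div k"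
    if "0 < j" "j + 1 < k" for j
    using fl[of j] fl[of "j+1"] that by linarith
  \<comment> \<open>\<open>s\<close> and \<open>t\<close> are the last indices at which the
    sequences of \<open>b\<close> and \<open>c\<close> are still 0. The first jump of the
    \<open>c\<close>-sequence, from \<open>t\<close> to \<open>t + 1\<close>, is the one that leads
    to the contradiction.\<close>
  define s where "s = k div b"
  define t where "t = k div c"
  have s1: "s * b < k" "k < (s+1) * b"
    using div_bounds[of b k] not_multiple[OF cop(2), of 1 s] c bc b2 unfolding s_def
    by (auto simp: less_le)
  have t1: "t * c < k" "k < (t+1) * c"
    using div_bounds[of c k] not_multiple[OF cop(3), of 1 t] c bc b2 unfolding t_def
    by (auto simp: less_le)
  have s2: "2 \<le> s"
  proof (rule ccontr)
    assume "\<not> 2 \<le> s"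
    then have "(s+1) * b \<le> 2 * b" using c bc by (intro mult_right_mono) auto
    then show False using s1 b2 by linarith
  qed
  have t2: "2 * t < k"
  proof -
    have "0 \<le> t" unfolding t_def using k0 c by (simp add: pos_imp_zdiv_nonneg_iff)
    then have "t * 2 \<le> t * c" using c by (intro mult_left_mono) auto
    then show ?thesis using t1 by linarith
  qed
  have st: "s \<le> t"
  proof (rule ccontr)
    assume "\<not> s \<le> t"
    then have "(t+1) * c \<le> s * c" using c by (intro mult_right_mono) auto
    also have "\<dots> \<le> s * b" using bc s2 by (intro mult_left_mono) auto
    finally show False using s1 t1 by linarith
  qed
  have sb: "s * b div k = 0" "(s+1) * b div k = 1"
    by (rule div_eqI; use s1 s2 bc c b2 in \<open>simp add: algebra_simps\<close>)+
  have tc: "t * c div k = 0" "(t+1) * c div k = 1"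
    by (rule div_eqI; use t1 t2 st s2 bc c b2 in \<open>simp add: algebra_simps\<close>)+
  have step_a: "\<And>j. j * a div k \<le> (j+1) * a div k" "\<And>j. (j+1) * a div k \<le> j * a div k + 1" 
    and step_b: "\<And>j. j * b div k \<le> (j+1) * b div k" "\<And>j. (j+1) * b div k \<le> j * b div k + 1" 
    and step_c: "\<And>j. j * c div k \<le> (j+1) * c div k" "\<And>j. (j+1) * c div k \<le> j * c div k + 1" 
    using div_step[OF k0] ak ab bc c by auto
  have no_a: "(j+1) * a div k = j * a div k"
    if "0 < j" "j + 1 < k" "(j+1) * b div k \<ge> j * b div k + 1 \<or> (j+1) * c div k \<ge> j * c div k + 1" for j
    using jump[OF that(1,2)] that(3) step_a(1)[of j] step_b(1)[of j] step_c(1)[of j] by linarith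
  have s_lt: "s + 1 < k" using st t2 s2 by linarith
  have t_lt: "t + 1 < k" using st t2 s2 by linarith
  \<comment> \<open>Up to index \<open>s\<close> only \<open>a\<close> contributes. The resulting
    bound \<open>s * (k - a) \<le> k\<close> is what spaces out the pauses in
    \<open>gap\<close>.\<close>
  have as: "s * a div k = s - 1"
  proof -
    have "s * c \<le> s * b" using bc s2 by (intro mult_left_mono) auto
    then have "s * c < k" using s1 by linarith
    moreover have "0 \<le> s * c" using s2 c by simp
    ultimately have "s * c div k = 0" by simp
    then show ?thesis using fl[of s] sb s2 s_lt by linarith
  qed
  have no_at: "(t+1) * a div k = t * a div k" using no_a[of t] tc t_lt st s2 by linarith
  have no_bt: "(t+1) * b div k = t * b div k"
    using jump[of t] tc t_lt st s2 step_a(1)[of t] step_b(1)[of t] by linarith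
  have "s < t" using st no_bt sb by (cases "s = t") auto
  define n where "n = t * b div k"
  have n1: "1 \<le> n" 
  proof -
    have "(s+1) * b \<le> t * b" using \<open>s < t\<close> bc c by (intro mult_right_mono) auto
    then show ?thesis using sb zdiv_mono1[of "(s+1)*b" "t*b" k] k0 unfolding n_def by linarith
  qed
  have sk: "(s + 1) * b < 2 * k" using s1 b2 by (simp add: algebra_simps)
  \<comment> \<open>The \<open>b\<close>-sequence must jump once more after \<open>t\<close>, early
    enough that the floor identity, available only below \<open>k\<close>, still applies
    there.\<close>
  have n2: "n + 1 < b"
  proof -
    have "t + 1 \<le> k - 1 - s" using t2 \<open>s < t\<close> by linarith
    then have "(t+1) * b \<le> (k - 1 - s) * b" using bc c by (intro mult_right_mono) auto
    then have "(t+1) * b < (b - 1) * k" using s1 by (simp add: algebra_simps)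
    then have "n * k < (b - 1) * k"
      using div_bounds(1)[OF k0, of "(t+1)*b"] no_bt unfolding n_def by simp
    then show ?thesis using k0 by simp
  qed
  \<comment> \<open>The indices of the \<open>b\<close>-jumps around \<open>t\<close>: the floor
    rises from \<open>n - 1\<close> to \<open>n\<close> at \<open>x\<close> and from
    \<open>n\<close> to \<open>n + 1\<close> at \<open>y\<close>.\<close>
  define x where "x = n * k div b"
  define y where "y = (n+1) * k div b"
  have b0: "0 < b" using bc c by linarith
  have x1: "x * b < n * k" "n * k < (x+1) * b"
    using div_bounds[OF b0, of "n*k"] not_multiple[OF cop(2), of n x] n1 n2 unfolding x_def
    by (auto simp: less_le)
  have y1: "y * b < (n+1) * k" "(n+1) * k < (y+1) * b"
    using div_bounds[OF b0, of "(n+1)*k"] not_multiple[OF cop(2), of "n+1" y] n1 n2 unfolding y_def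
    by (auto simp: less_le)
  have tn: "n * k \<le> t * b" "(t+1) * b < (n+1) * k"
    using div_bounds[OF k0, of "t*b"] div_bounds[OF k0, of "(t+1)*b"] no_bt unfolding n_def by simp_all
  have xt: "x < t" using x1(1) tn(1) b0 by (smt (verit) mult_right_mono)
  have ty: "t < y" using y1(2) tn(2) b0 by (smt (verit) mult_right_mono)
  have xs: "s \<le> x" 
  proof -
    have "s * b < (x+1) * b" using s1(1) x1(2) n1 k0 mult_right_mono[of 1 n k] by linarith
    then show ?thesis using b0 by simp
  qed
  have yk: "y + 1 < k"
  proof -
    have "(n+1) * k \<le> (b-1) * k" using n2 k0 by (intro mult_right_mono) auto
    then have "y * b < (k - 2) * b" using y1(1) b2 by (simp add: algebra_simps)
    then show ?thesis using b0 by simp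
  qed
  have xb: "x * b div k = n - 1" "(x+1) * b div k = n"
    by (rule div_eqI; use x1 b2 b0 in \<open>simp add: algebra_simps\<close>)+
  have yb: "y * b div k = n" "(y+1) * b div k = n + 1"
  proof -
    have "(t+1) * b \<le> y * b" using ty b0 by (intro mult_right_mono) auto
    moreover have "t * b \<le> (t+1) * b" using b0 by (simp add: algebra_simps)
    ultimately have "n * k \<le> y * b" using tn by linarith
    then show "y * b div k = n" using y1(1) by (rule div_eqI)
    have "(y + 1) * b = y * b + b" "(n + 1 + 1) * k = (n + 1) * k + k" by (simp_all add: algebra_simps)
    then show "(y+1) * b div k = n + 1" using y1 b2 b0 by (intro div_eqI) linarith+
  qed
  have no_ax: "(x+1) * a div k = x * a div k" using no_a[of x] xb xs s2 xt t_lt by linarith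
  have no_ay: "(y+1) * a div k = y * a div k" using no_a[of y] yb yk ty xt xs s2 by linarith
  \<comment> \<open>Pauses at \<open>i\<close> and \<open>j\<close> leave at most
    \<open>j - i - 1\<close> jumps between \<open>i\<close> and \<open>j + 1\<close>, so the
    accumulated deficit \<open>(j - i + 1) * (k - a)\<close> exceeds \<open>k\<close>, while
    \<open>s * (k - a)\<close> does not.\<close>
  have gap: "s \<le> j - i" if "i < j" "(i+1) * a div k = i * a div k" "(j+1) * a div k = j * a div k" for i j
  proof -
    have "(j+1) * a div k \<le> i * a div k + (j - i - 1)"
      using div_growth[OF k0, of a "i+1" j] that ak ab bc c by simp
    then have "(j+1) * a < (i * a div k + (j - i)) * k"
      using div_bounds(2)[OF k0, of "(j+1)*a"] k0
      by (smt (verit) mult_right_mono)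
    also have "\<dots> \<le> i * a + (j - i) * k"
      using div_bounds(1)[OF k0, of "i*a"] by (simp add: algebra_simps)
    finally have g: "k < (j - i + 1) * (k - a)" by (simp add: algebra_simps)
    have "(s - 1) * k \<le> s * a" using div_bounds(1)[OF k0, of "s*a"] as by simp
    then have "s * (k - a) \<le> k" by (simp add: algebra_simps)
    with g have "s * (k - a) < (j - i + 1) * (k - a)" by linarith
    moreover have "0 < k - a" using sum bc c by linarith
    ultimately have "s < j - i + 1" by simp
    then show ?thesis by simp
  qed
  have "s \<le> t - x" "s \<le> y - t" using gap[OF xt no_ax no_at] gap[OF ty no_at no_ay] .
  moreover have "y - x \<le> s + 1"
  proof -
    have "(y - x - 1) * b < (s + 1) * b" using x1 y1 s1 by (simp add: algebra_simps)
    then show ?thesis using b0 by simp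
  qed
  ultimately show False using s2 by linarith
qed


section \<open>White's congruence for empty tetrahedra\<close>

lemma uminus_mod_nonzero: 
  fixes x k :: int
  assumes "0 < k" "x mod k \<noteq> 0"
  shows "(- x) mod k = k - x mod k"
  using assms by (simp add: zmod_zminus1_eq_if)

text \<open>A common divisor g > 1 of \<open>p\<close> and \<open>k\<close> would give the
  multiplier k / g, at which the residue vanishes.\<close>

lemma coprime_if_mod_nonzero:
  fixes p k :: int
  assumes k: "0 < k" and nz: "\<And>j. 0 < j \<Longrightarrow> j < k \<Longrightarrow> (j * p) mod k \<noteq> 0"
  shows "coprime p k"
proof (rule ccontr)
  define g where "g = gcd p k"
  assume "\<not> coprime p k"
  then have "g \<noteq> 1" by (simp add: g_def coprime_iff_gcd_eq_1)
  moreover have "0 < g" using k by (simp add: g_def)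
  ultimately have g: "1 < g" by linarith
  obtain j where j: "k = g * j" by (metis g_def gcd_dvd2 dvdE)
  obtain p' where p': "p = g * p'" by (metis g_def gcd_dvd1 dvdE)
  have "0 < j" using j k g by (simp add: zero_less_mult_iff)
  moreover have "j < k" using j g calculation by simp
  moreover have "(j * p) mod k = 0" using j p' by simp
  ultimately show False using nz[of j] by linarith
qed

text \<open>The assumption says that the tetrahedron with base (0,0,0), (1,0,0), (0,1,0) and apex (p,q,k)
  contains no lattice point at a height j strictly between 0 and k.\<close>

proposition white_arithmetic:
  fixes p q k :: int
  assumes k: "2 \<le> k"
    and E: "\<And>j. 0 < j \<Longrightarrow> j < k \<Longrightarrow> k < (- (j * p)) mod k + (- (j * q)) mod k + j"
  shows "coprime p k" "coprime q k" "coprime (1 - p - q) k"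
    and "k dvd p - 1 \<or> k dvd q - 1 \<or> k dvd p + q"
proof -
  have k0: "0 < k" using k by simp
  have fac: "p' mod k = 0 \<Longrightarrow> (- p') mod k = 0" for p' :: int
    by (simp add: zmod_zminus1_eq_if)
  have bnd: "0 \<le> x mod k" "x mod k < k" for x :: int using k0 by auto
  \<comment> \<open>Replacing \<open>j\<close> by \<open>k - j\<close> turns the condition on the
    negated multiples into one on the multiples themselves. The two conditions confine the sum of
    the residues of \<open>j * p\<close> and \<open>j * q\<close> to a window of length
    \<open>k\<close>.\<close>
  have compl: "(- ((k - j) * x)) mod k = (j * x) mod k" for j x :: int
  proof -
    have "- ((k - j) * x) = j * x + (- x) * k" by (simp add: algebra_simps)
    then show ?thesis by (simp only: mod_mult_self1)
  qed
  have E': "k < (j * p) mod k + (j * q) mod k + (k - j)" if "0 < j" "j < k" for j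
    using E[of "k - j"] that by (simp add: compl)
  \<comment> \<open>If one residue vanished, the conditions at \<open>j\<close> and
    \<open>k - j\<close> would place the other both below and above \<open>j\<close>; if both
    vanished, \<open>j\<close> would exceed \<open>k\<close>.\<close>
  have A: "(j * p) mod k \<noteq> 0 \<and> (j * q) mod k \<noteq> 0" if j: "0 < j" "j < k" for j
  proof (rule ccontr)
    assume "\<not> ?thesis"
    then have "(j * p) mod k = 0 \<or> (j * q) mod k = 0" by auto
    then show False
    proof
      assume z: "(j * p) mod k = 0"
      show False
        using E[OF j] E'[OF j] fac[OF z] z uminus_mod_nonzero[OF k0, of "j * q"] fac[of "j * q"] j
        by (cases "(j * q) mod k = 0") auto
    next
      assume z: "(j * q) mod k = 0"
      show False
        using E[OF j] E'[OF j] fac[OF z] z uminus_mod_nonzero[OF k0, of "j * p"] fac[of "j * p"] j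
        by (cases "(j * p) mod k = 0") auto
    qed
  qed
  have up: "(j * p) mod k + (j * q) mod k < k + j" and lo: "j < (j * p) mod k + (j * q) mod k"
    if "0 < j" "j < k" for j
    using E[OF that] E'[OF that] A[OF that] uminus_mod_nonzero[OF k0] by auto
  \<comment> \<open>The projected apex has barycentric coordinates \<open>1 - p - q\<close>,
    \<open>p\<close> and \<open>q\<close>. The window for the first two residues determines the
    third, and the three sum to \<open>j + k\<close>.\<close>
  define r where "r = 1 - p - q"
  have C: "(j * r) mod k = j + k - (j * p) mod k - (j * q) mod k" if "0 < j" "j < k" for j
  proof -
    have "j * r = (j + k - (j * p) mod k - (j * q) mod k) + (- 1 - (j*p) div k - (j*q) div k) * k"
      using mult_div_mod_eq[of k "j*p"] mult_div_mod_eq[of k "j*q"]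
      unfolding r_def by (simp add: algebra_simps)
    then have "(j * r) mod k = (j + k - (j * p) mod k - (j * q) mod k) mod k"
      by (simp only: mod_mult_self1)
    also have "\<dots> = j + k - (j * p) mod k - (j * q) mod k"
      using up[OF that] lo[OF that] by (intro mod_pos_pos_trivial) auto
    finally show ?thesis .
  qed
  have Ap: "(j * p) mod k \<noteq> 0" and Aq: "(j * q) mod k \<noteq> 0" if "0 < j" "j < k" for j
    using A[OF that] by simp_all
  show cp: "coprime p k" using k0 Ap by (rule coprime_if_mod_nonzero)
  show cq: "coprime q k" using k0 Aq by (rule coprime_if_mod_nonzero)
  show cr: "coprime (1 - p - q) k"
  proof -
    have "(j * r) mod k \<noteq> 0" if "0 < j" "j < k" for j using up[OF that] C[OF that] by linarith
    then have "coprime r k" by (rule coprime_if_mod_nonzero[OF k0])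
    then show ?thesis by (simp add: r_def)
  qed
  define a b c where "a = p mod k" and "b = q mod k" and "c = r mod k"
  have nz: "a \<noteq> 0" "b \<noteq> 0" using A[of 1] k by (auto simp: a_def b_def)
  have c_eq: "c = 1 + k - a - b" using C[of 1] k by (simp add: a_def b_def c_def)
  have nzc: "c \<noteq> 0" using c_eq up[of 1] k by (auto simp: a_def b_def)
  have pos: "0 < a" "0 < b" "0 < c" using nz nzc bnd[of p] bnd[of q] bnd[of r]
    unfolding a_def b_def c_def by linarith+
  have cop: "coprime a k" "coprime b k" "coprime c k"
    using k0 cp cq cr unfolding a_def b_def c_def r_def by simp_all
  have sum: "a + b + c = k + 1" using c_eq by simp
  \<comment> \<open>Division with remainder: the multiples sum to \<open>j * (k + 1)\<close> and the
    residues to \<open>j + k\<close>, which leaves \<open>k * (j - 1)\<close>.\<close>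
  have fl: "j * a div k + j * b div k + j * c div k = j - 1" if j: "0 < j" "j < k" for j
  proof -
    have m: "(j * a) mod k = (j * p) mod k" "(j * b) mod k = (j * q) mod k" "(j * c) mod k = (j * r) mod k"
      by (simp_all add: a_def b_def c_def mod_mult_right_eq)
    have "k * (j * a div k + j * b div k + j * c div k) = j * (a + b + c) - (j * a) mod k - (j * b) mod k - (j * c) mod k"
      using mult_div_mod_eq[of k "j*a"] mult_div_mod_eq[of k "j*b"] mult_div_mod_eq[of k "j*c"]
      by (simp add: algebra_simps)
    also have "\<dots> = j * (k + 1) - (j + k)" using C[OF j] unfolding sum m by simp
    also have "\<dots> = k * (j - 1)" by (simp add: algebra_simps)
    finally show ?thesis using k0 by simp
  qed
  have one: "a = 1 \<or> b = 1 \<or> c = 1"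
  proof (rule ccontr)
    assume "\<not> ?thesis"
    then have ge: "2 \<le> a" "2 \<le> b" "2 \<le> c" using pos by auto
    consider "b \<le> a" "c \<le> b" | "c \<le> a" "b \<le> c" | "a \<le> b" "c \<le> a" | "c \<le> b" "a \<le> c" | "a \<le> c" "b \<le> a" | "b \<le> c" "a \<le> b" by linarith
    then show False
    proof cases
      case 1
      have "j * a div k + j * b div k + j * c div k = j - 1" if "0 < j" "j < k" for j
        using fl[OF that] by linarith
      moreover have "a + b + c = k + 1" using sum by linarith
      ultimately show False
        using three_floor_sequences[OF 1(1,2) ge(3) _ cop(1) cop(2) cop(3)] by blast
    next
      case 2
      have "j * a div k + j * c div k + j * b div k = j - 1" if "0 < j" "j < k" for j
        using fl[OF that] by linarith
      moreover have "a + c + b = k + 1" using sum by linarith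
      ultimately show False
        using three_floor_sequences[OF 2(1,2) ge(2) _ cop(1) cop(3) cop(2)] by blast
    next
      case 3
      have "j * b div k + j * a div k + j * c div k = j - 1" if "0 < j" "j < k" for j
        using fl[OF that] by linarith
      moreover have "b + a + c = k + 1" using sum by linarith
      ultimately show False
        using three_floor_sequences[OF 3(1,2) ge(3) _ cop(2) cop(1) cop(3)] by blast
    next
      case 4
      have "j * b div k + j * c div k + j * a div k = j - 1" if "0 < j" "j < k" for j
        using fl[OF that] by linarith
      moreover have "b + c + a = k + 1" using sum by linarith
      ultimately show False
        using three_floor_sequences[OF 4(1,2) ge(1) _ cop(2) cop(3) cop(1)] by blast
    next
      case 5
      have "j * c div k + j * a div k + j * b div k = j - 1" if "0 < j" "j < k" for j
        using fl[OF that] by linarith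
      moreover have "c + a + b = k + 1" using sum by linarith
      ultimately show False
        using three_floor_sequences[OF 5(1,2) ge(2) _ cop(3) cop(1) cop(2)] by blast
    next
      case 6
      have "j * c div k + j * b div k + j * a div k = j - 1" if "0 < j" "j < k" for j
        using fl[OF that] by linarith
      moreover have "c + b + a = k + 1" using sum by linarith
      ultimately show False
        using three_floor_sequences[OF 6(1,2) ge(1) _ cop(3) cop(2) cop(1)] by blast
    qed
  qed
  have "x mod k = 1 \<Longrightarrow> k dvd x - 1" for x :: int
    using mult_div_mod_eq[of k x] by (metis add_diff_cancel_right' dvd_triv_left)
  then have "k dvd p - 1 \<or> k dvd q - 1 \<or> k dvd r - 1"
    using one unfolding a_def b_def c_def by blast
  moreover have "k dvd r - 1 \<longleftrightarrow> k dvd p + q"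
    using dvd_minus_iff[of k "p + q"] by (simp add: r_def)
  ultimately show "k dvd p - 1 \<or> k dvd q - 1 \<or> k dvd p + q" by blast
qed

section \<open>Lattice pyramids over plane lattice sets\<close>

lemma dvd_linear_combination:
  fixes k x y z m n :: int
  assumes "k dvd x" "k dvd y" "z = m * x + n * y"
  shows "k dvd z"
  using assms by (simp add: dvd_add dvd_mult)

lemma dvd_two_odd:
  fixes k m :: int
  assumes "2 \<le> k" "k dvd 2" "coprime m k"
  shows "k = 2" "odd m"
proof -
  show k: "k = 2" using assms(1,2) zdvd_imp_le[of k 2] by simp
  then show "odd m" using assms(3) by (simp add: coprime_right_2_iff_odd)
qed

text \<open>Convexity of a plane set tested on its lattice points: with denominators cleared,
  integer weights on three points suffice by Caratheodory's theorem.\<close>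

locale lattice_convex2 =
  fixes S :: "(int \<times> int) set"
  assumes conv: "\<And>x0 y0 x1 y1 x2 y2 c0 c1 c2 x y. (x0,y0) \<in> S \<Longrightarrow> (x1,y1) \<in> S \<Longrightarrow> (x2,y2) \<in> S \<Longrightarrow>
    0 \<le> c0 \<Longrightarrow> 0 \<le> c1 \<Longrightarrow> 0 \<le> c2 \<Longrightarrow> 0 < c0 + c1 + c2 \<Longrightarrow>
    (c0 + c1 + c2) * x = c0 * x0 + c1 * x1 + c2 * x2 \<Longrightarrow>
    (c0 + c1 + c2) * y = c0 * y0 + c1 * y1 + c2 * y2 \<Longrightarrow> (x,y) \<in> S"

text \<open>The pyramid over the plane set with apex (a,b,k) has no lattice points besides those of its base
  and its apex: the slice at height j is described by integer weights with sum k.\<close>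

locale lattice_pyramid = lattice_convex2 +
  fixes a b k :: int
  assumes k2: "2 \<le> k"
    and empty: "\<And>x0 y0 x1 y1 x2 y2 c0 c1 c2 j x y. (x0,y0) \<in> S \<Longrightarrow> (x1,y1) \<in> S \<Longrightarrow> (x2,y2) \<in> S \<Longrightarrow>
    0 \<le> c0 \<Longrightarrow> 0 \<le> c1 \<Longrightarrow> 0 \<le> c2 \<Longrightarrow> 0 < j \<Longrightarrow> j < k \<Longrightarrow> c0 + c1 + c2 + j = k \<Longrightarrow>
    k * x = c0 * x0 + c1 * x1 + c2 * x2 + j * a \<Longrightarrow>
    k * y = c0 * y0 + c1 * y1 + c2 * y2 + j * b \<Longrightarrow> False"
begin

text \<open>A failure of White's inequality at height \<open>j\<close> exhibits a forbidden point.
  The residues \<open>c1\<close> and \<open>c2\<close> become the weights of the second and third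
  vertex; they make its coordinates integral, and the failure says that the weight left for the
  first vertex is nonnegative.\<close>

lemma triangle:
  assumes S: "(p1,p2) \<in> S" "(p1+d1,p2+d2) \<in> S" "(p1+e1,p2+e2) \<in> S"
    and u: "a = p1 + l*d1 + m*e1" "b = p2 + l*d2 + m*e2"
  shows "coprime l k" "coprime m k" "coprime (1-l-m) k"
    and "k dvd l - 1 \<or> k dvd m - 1 \<or> k dvd l + m"
proof -
  have main: "k < (- (j * l)) mod k + (- (j * m)) mod k + j" if j: "0 < j" "j < k" for j
  proof (rule ccontr)
    assume A: "\<not> ?thesis"
    define c1 where "c1 = (- (j * l)) mod k"
    define c2 where "c2 = (- (j * m)) mod k"
    define X where "X = - ((- (j * l)) div k)"
    define Y where "Y = - ((- (j * m)) div k)"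
    have X: "k * X = j * l + c1" using mult_div_mod_eq[of k "- (j*l)"] unfolding X_def c1_def by linarith
    have Y: "k * Y = j * m + c2" using mult_div_mod_eq[of k "- (j*m)"] unfolding Y_def c2_def by linarith
    have nn: "0 \<le> c1" "0 \<le> c2" using k2 unfolding c1_def c2_def by auto
    have *: "k * (q + X * f + Y * g) = (k - j - c1 - c2) * q + c1 * (q + f) + c2 * (q + g) + j * (q + l * f + m * g)"
      for q f g
    proof -
      have "k * (q + X * f + Y * g) = k * q + (k * X) * f + (k * Y) * g" by (simp add: algebra_simps)
      then show ?thesis unfolding X Y by (simp add: algebra_simps)
    qed
    show False
      by (rule empty[OF S, of "k - j - c1 - c2" c1 c2 j "p1 + X*d1 + Y*e1" "p2 + X*d2 + Y*e2"])
        (use A nn j * u in \<open>auto simp: c1_def[symmetric] c2_def[symmetric]\<close>)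
  qed
  from white_arithmetic[OF k2 this]
  show "coprime l k" "coprime m k" "coprime (1-l-m) k" "k dvd l - 1 \<or> k dvd m - 1 \<or> k dvd l + m"
    by blast+
qed

lemma not_dvd_coprime: "coprime m k \<Longrightarrow> \<not> k dvd m"
  using k2 by (metis coprime_common_divisor dvd_refl not_one_le_zero zdvd1_eq numeral_le_one_iff
      semiring_norm(69) abs_of_nonneg order_trans zero_le_numeral)

text \<open>The two halves see the apex at \<open>(l, m)\<close> and \<open>(1 - l, 1 - m)\<close>.
  Coprimality in one half excludes the first two alternatives in the other, so \<open>l + m\<close>
  is congruent to both 0 and 2; then \<open>k\<close> is 2, and \<open>l\<close> and
  \<open>1 - l\<close> are both odd.\<close>

lemma parallelogram:
  assumes S: "(p1,p2) \<in> S" "(p1+d1,p2+d2) \<in> S" "(p1+e1,p2+e2) \<in> S" "(p1+d1+e1,p2+d2+e2) \<in> S"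
    and u: "a = p1 + l*d1 + m*e1" "b = p2 + l*d2 + m*e2"
  shows False
proof -
  note T1 = triangle[OF S(1,2,3) u]
  have T2: "coprime (1 - l) k" "coprime (1 - m) k" "k dvd (1 - l) - 1 \<or> k dvd (1 - m) - 1 \<or> k dvd (1 - l) + (1 - m)"
    using triangle[of "p1+d1+e1" "p2+d2+e2" "-d1" "-d2" "-e1" "-e2" "1-l" "1-m"] S u
    by (auto simp: algebra_simps)
  have n: "\<not> k dvd l" "\<not> k dvd m" "\<not> k dvd 1 - l" "\<not> k dvd 1 - m"
    using T1 T2 not_dvd_coprime by blast+
  have "k dvd l + m" using T1(4) n(3,4) by (metis dvd_minus_iff minus_diff_eq)
  moreover have "k dvd 2 - (l + m)" using T2(3) n(1,2) by (auto simp: algebra_simps)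
  ultimately have "k dvd 2" by (rule dvd_linear_combination[of _ _ _ _ 1 1]) simp
  then have "odd l" "odd (1 - l)" using dvd_two_odd k2 T1 T2 by blast+
  then show False by simp
qed

text \<open>Convexity pulls a lattice point inside the cone back to the fourth corner of the unit
  parallelogram; the surplus of the larger coordinate is balanced by the vertex in the other
  direction.\<close>

lemma no_opposite_corner:
  assumes S: "(p1,p2) \<in> S" "(p1+d1,p2+d2) \<in> S" "(p1+e1,p2+e2) \<in> S" "(p1+x*d1+y*e1,p2+x*d2+y*e2) \<in> S"
    and u: "a = p1 + l*d1 + m*e1" "b = p2 + l*d2 + m*e2"
    and xy: "1 \<le> x" "1 \<le> y"
  shows False
proof (rule parallelogram[OF S(1,2,3) _ u])
  show "(p1+d1+e1,p2+d2+e2) \<in> S"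
  proof (cases "y \<le> x")
    case True
    show ?thesis
      by (rule conv[OF S(1,3,4), of "y - 1" "x - y" 1]) (use True xy in \<open>auto simp: algebra_simps\<close>)
  next
    case False
    show ?thesis
      by (rule conv[OF S(1,2,4), of "x - 1" "y - x" 1]) (use False xy in \<open>auto simp: algebra_simps\<close>)
  qed
qed

text \<open>The triangles on either side of the middle point see the apex at \<open>(l, m)\<close>
  and \<open>(- l, m)\<close>. Every pair of their alternatives yields \<open>k dvd m - 1\<close> or
  \<open>k dvd 2\<close>, and in the latter case \<open>m\<close> is odd, hence 1 modulo
  \<open>k\<close> as well.\<close>

lemma collinear_triple:
  assumes S: "(p1,p2) \<in> S" "(p1+d1,p2+d2) \<in> S" "(p1-d1,p2-d2) \<in> S" "(p1+e1,p2+e2) \<in> S"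
    and u: "a = p1 + l*d1 + m*e1" "b = p2 + l*d2 + m*e2"
  shows "k dvd m - 1"
proof -
  note T1 = triangle[OF S(1,2,4) u]
  have T2: "k dvd - l - 1 \<or> k dvd m - 1 \<or> k dvd - l + m"
    using triangle[of p1 p2 "-d1" "-d2" e1 e2 "-l" m] S u by auto
  have "k dvd m - 1 \<or> k dvd 2"
  proof (rule ccontr)
    assume "\<not> ?thesis"
    then have n: "\<not> k dvd m - 1" "\<not> k dvd 2" by auto
    from T1(4) n consider "k dvd l - 1" | "k dvd l + m" by blast
    then show False
    proof cases
      case 1
      have "\<not> k dvd - l - 1" using n dvd_linear_combination[OF 1, of "-l-1" 2 "-1" "-1"] by auto
      moreover have "\<not> k dvd - l + m" using n dvd_linear_combination[OF 1, of "-l+m" "m-1" 1 1] by auto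
      ultimately show False using T2 n by blast
    next
      case 2
      have "\<not> k dvd - l - 1" using n dvd_linear_combination[OF 2, of "-l-1" "m-1" 1 1] by auto
      moreover have "\<not> k dvd - l + m"
      proof
        assume "k dvd - l + m"
        then have "k dvd 2 * m" using dvd_linear_combination[OF 2, of "-l+m" "2*m" 1 1] by auto
        then show False using T1(2) n by (simp add: coprime_dvd_mult_left_iff coprime_commute)
      qed
      ultimately show False using T2 n by blast
    qed
  qed
  then show ?thesis
  proof
    assume "k dvd 2"
    with dvd_two_odd[OF k2 this T1(2)] show ?thesis by simp
  qed
qed

text \<open>Neighbours on the two sides measure the apex at heights \<open>m\<close> and
  \<open>- m\<close>, both congruent to 1.\<close>

lemma collinear_triple_both_sides:
  assumes S: "(p1,p2) \<in> S" "(p1+d1,p2+d2) \<in> S" "(p1-d1,p2-d2) \<in> S" "(p1+e1,p2+e2) \<in> S" "(p1+f1,p2+f2) \<in> S"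
    and u: "a = p1 + l*d1 + m*e1" "b = p2 + l*d2 + m*e2" "a = p1 + l'*d1 - m*f1" "b = p2 + l'*d2 - m*f2"
  shows "k = 2"
proof -
  have "k dvd m - 1" by (rule collinear_triple[OF S(1-4) u(1,2)])
  moreover have "k dvd - m - 1" by (rule collinear_triple[OF S(1-3,5), of l' "-m"]) (use u in auto)
  ultimately have "k dvd 2" by (rule dvd_linear_combination[of _ _ _ _ "-1" "-1"]) simp
  then show ?thesis using k2 zdvd_imp_le[of k 2] by simp
qed

text \<open>The larger of \<open>m\<close> and \<open>n\<close> decides: the smaller coordinate is
  cancelled by the vertex in its direction, and rescaling leaves a single step backwards; a tie
  gives the diagonal step.\<close>

lemma opposite_cone:
  assumes S: "(p1,p2) \<in> S" "(p1+d1,p2+d2) \<in> S" "(p1+e1,p2+e2) \<in> S" "(p1-m*d1-n*e1,p2-m*d2-n*e2) \<in> S"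
    and mn: "0 \<le> m" "0 \<le> n" "0 < m + n"
  shows "(p1-d1,p2-d2) \<in> S \<or> (p1-e1,p2-e2) \<in> S \<or> (p1-d1-e1,p2-d2-e2) \<in> S"
proof -
  consider "n < m" | "m < n" | "m = n" by linarith
  then show ?thesis
  proof cases
    case 1
    have "(p1-d1,p2-d2) \<in> S"
      by (rule conv[OF S(1,3,4), of "m - 1 - n" n 1]) (use 1 mn in \<open>auto simp: algebra_simps\<close>)
    then show ?thesis by simp
  next
    case 2
    have "(p1-e1,p2-e2) \<in> S"
      by (rule conv[OF S(1,2,4), of "n - 1 - m" m 1]) (use 2 mn in \<open>auto simp: algebra_simps\<close>)
    then show ?thesis by simp
  next
    case 3
    have "(p1-d1-e1,p2-d2-e2) \<in> S"
      by (rule conv[OF S(1,1,4), of "m - 1" 0 1]) (use 3 mn in \<open>auto simp: algebra_simps\<close>)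
    then show ?thesis by simp
  qed
qed

end

section \<open>Pyramids whose base contains the standard triangle\<close>

locale standard_pyramid = lattice_pyramid +
  assumes origin: "(0,0) \<in> S" and unit1: "(1,0) \<in> S" and unit2: "(0,1) \<in> S"
begin

text \<open>The numbers \<open>x\<close>, \<open>y\<close> and \<open>1 - x - y\<close> are
  barycentric weights. Two positive ones put the point into the open cone at the remaining vertex,
  where \<open>no_opposite_corner\<close> applies.\<close>

lemma at_most_one_positive_weight:
  assumes "(x,y) \<in> S"
  shows "\<not> (1 \<le> x \<and> 1 \<le> y)" "\<not> (1 \<le> x \<and> 1 \<le> 1 - x - y)" "\<not> (1 \<le> y \<and> 1 \<le> 1 - x - y)"
proof -
  show "\<not> (1 \<le> x \<and> 1 \<le> y)"
    using no_opposite_corner[of 0 0 1 0 0 1 x y a b] origin unit1 unit2 assms by auto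
  show "\<not> (1 \<le> x \<and> 1 \<le> 1 - x - y)"
    using no_opposite_corner[of 0 1 1 "-1" 0 "-1" x "1-x-y" a "1-a-b"] origin unit1 unit2 assms by auto
  show "\<not> (1 \<le> y \<and> 1 \<le> 1 - x - y)"
    using no_opposite_corner[of 1 0 "-1" 1 "-1" 0 y "1-x-y" b "1-a-b"] origin unit1 unit2 assms by auto
qed

text \<open>A further point has exactly one positive barycentric weight, so it lies in the cone
  opposite to the triangle at the corresponding vertex, and \<open>opposite_cone\<close> applies. A
  step back along the second edge is reduced to the first by exchanging the edges, which is why the
  determinant is fixed only up to sign.\<close>

lemma trichotomy:
  "S = {(0,0),(1,0),(0,1)} \<or>
    (\<exists>p1 p2 d1 d2 e1 e2. (d1*e2-d2*e1)\<^sup>2 = 1 \<and> (p1,p2) \<in> S \<and> (p1+d1,p2+d2) \<in> S \<and> (p1+e1,p2+e2) \<in> S \<and>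
      ((p1-d1,p2-d2) \<in> S \<or> (p1-d1-e1,p2-d2-e2) \<in> S))"
proof (rule disjCI)
  let ?goal = "\<exists>p1 p2 d1 d2 e1 e2. (d1*e2-d2*e1)\<^sup>2 = 1 \<and> (p1,p2) \<in> S \<and> (p1+d1,p2+d2) \<in> S \<and> (p1+e1,p2+e2) \<in> S \<and>
      ((p1-d1,p2-d2) \<in> S \<or> (p1-d1-e1,p2-d2-e2) \<in> S)"
  assume contra: "\<not> ?goal"
  have c: False if "(p1,p2) \<in> S" "(p1+d1,p2+d2) \<in> S" "(p1+e1,p2+e2) \<in> S" "(p1-m*d1-n*e1,p2-m*d2-n*e2) \<in> S"
    "0 \<le> m" "0 \<le> n" "0 < m + n" "d1*e2-d2*e1 = 1 \<or> d1*e2-d2*e1 = -1" for p1 p2 d1 d2 e1 e2 m n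
  proof -
    have "(d1*e2-d2*e1)\<^sup>2 = 1" "(e1*d2-e2*d1)\<^sup>2 = 1"
      using that(8) by (auto simp: power2_eq_1_iff algebra_simps)
    moreover from opposite_cone[OF that(1-7)] have "(p1-d1,p2-d2) \<in> S \<or> (p1-e1,p2-e2) \<in> S \<or> (p1-d1-e1,p2-d2-e2) \<in> S" .
    ultimately show False using contra that(1-3) by blast
  qed
  show "S = {(0,0),(1,0),(0,1)}"
  proof (rule ccontr)
    assume "S \<noteq> {(0,0),(1,0),(0,1)}"
    then obtain x y where p: "(x,y) \<in> S" "(x,y) \<notin> {(0,0),(1,0),(0,1)}"
      using origin unit1 unit2 by auto
    consider "x \<le> 0" "y \<le> 0" | "1 \<le> x" "y \<le> 0" "1 - x - y \<le> 0" | "1 \<le> y" "x \<le> 0" "1 - x - y \<le> 0"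
      using at_most_one_positive_weight[OF p(1)] by linarith
    then show False
    proof cases
      case 1 then show False using c[of 0 0 1 0 0 1 "-x" "-y"] origin unit1 unit2 p by auto
    next
      case 2 then show False using c[of 1 0 "-1" 1 "-1" 0 "-y" "x+y-1"] origin unit1 unit2 p by auto
    next
      case 3 then show False using c[of 0 1 1 "-1" 0 "-1" "-x" "x+y-1"] origin unit1 unit2 p by auto
    qed
  qed
qed

lemma empty_triangle: "k dvd a - 1 \<or> k dvd b - 1 \<or> k dvd a + b"
  using triangle(4)[of 0 0 1 0 0 1 a b] origin unit1 unit2 by simp

lemma coprime_apex: "coprime a k" "coprime b k"
  using triangle(1,2)[of 0 0 1 0 0 1 a b] origin unit1 unit2 by simp_all

end

locale collinear_pyramid = standard_pyramid +
  assumes minus1: "(-1,0) \<in> S"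
begin

lemma height_cong: "k dvd b - 1"
  using collinear_triple[of 0 0 1 0 0 1 a b] origin unit1 unit2 minus1 by simp

text \<open>A point off the strip produces a collinear triple with neighbours on both sides. Above
  the strip it must lie on the second axis, so (0,2) belongs to the set and (0,1) is a middle point;
  below, some point at height -1 faces (0,1) across the given line.\<close>

lemma height_two:
  assumes q: "(x,y) \<in> S" "y \<noteq> 0" "y \<noteq> 1"
  shows "k = 2"
proof -
  have "2 \<le> y \<or> y \<le> -1" using q by auto
  then show ?thesis
  proof
    assume y: "2 \<le> y"
    have "x \<le> 0" using at_most_one_positive_weight(1)[OF q(1)] y by linarith
    moreover have "0 \<le> x"
      using no_opposite_corner[of 0 0 "-1" 0 0 1 "-x" y "-a" b] origin minus1 unit2 q y by fastforce
    ultimately have "(0,y) \<in> S" using q by simp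
    then have "(0,2) \<in> S"
      by (rule conv[OF origin origin, of 0 y 0 "y-2" 2]) (use y in auto)
    then show ?thesis
      using collinear_triple_both_sides[of 0 1 0 1 1 "-1" "-1" "-1" "b-1+a" a "b-1-a"] origin unit1 unit2 minus1 by simp
  next
    assume y: "y \<le> -1"
    \<comment> \<open>Weight \<open>r\<close> at (-1,0), weight 1 at the given point and the rest at
      the origin make the weighted first coordinate divisible by the total \<open>- y\<close>, and
      the average lands at height -1.\<close>
    define r where "r = x mod (- y)"
    define z where "z = x div (- y)"
    have r: "0 \<le> r" "r < - y" using y by (auto simp: r_def)
    have z: "(- y) * z + r = x" unfolding r_def z_def by (rule mult_div_mod_eq)
    have "(z,-1) \<in> S"
      by (rule conv[OF origin minus1 q(1), of "-y-1-r" r 1]) (use y r z in \<open>auto simp: algebra_simps\<close>)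
    then show ?thesis
      using collinear_triple_both_sides[of 0 0 1 0 0 1 z "-1" a b "a+b*z"] origin unit1 unit2 minus1 by simp
  qed
qed

end

locale centered_pyramid = standard_pyramid +
  assumes unit3: "(-1,-1) \<in> S"
begin

lemma apex_conditions:
  "coprime a k" "coprime b k" "coprime (a-b) k" "k dvd a - 1 \<or> k dvd b - 1 \<or> k dvd a + b"
  "k dvd a - b - 1 \<or> k dvd - b - 1 \<or> k dvd a - 2*b" "k dvd b - a - 1 \<or> k dvd - a - 1 \<or> k dvd b - 2*a"
  using triangle[of 0 0 1 0 0 1 a b] triangle[of 0 0 1 0 "-1" "-1" "a-b" "-b"]
    triangle[of 0 0 0 1 "-1" "-1" "b-a" "-a"] origin unit1 unit2 unit3 by (simp_all add: algebra_simps)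

lemma not_dvd_two: "\<not> k dvd 2"
proof
  assume "k dvd 2"
  then have "odd a" "odd b" "odd (a - b)" using dvd_two_odd k2 apex_conditions(1-3) by blast+
  then show False by simp
qed

text \<open>Each of the three triangles around the barycentre offers three congruences. The facts
  \<open>p0\<close> to \<open>p8\<close> refute pairs and \<open>q0\<close> to \<open>q7\<close>
  refute triples, which covers all 27 choices. Each refutation is a linear combination whose value,
  such as 2, 3, \<open>b\<close> or \<open>3 * a\<close>, is not divisible by
  \<open>k\<close>.\<close>

lemma dvd_three: "k dvd 3"
proof (rule ccontr)
  assume n3: "\<not> k dvd 3"
  have n: "\<not> k dvd a" "\<not> k dvd b" "\<not> k dvd a - b" using apex_conditions(1-3) not_dvd_coprime by blast+
  have n3a: "\<not> k dvd 3 * a" "\<not> k dvd 3 * b" using n3 apex_conditions(1,2) 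
    by (auto simp: coprime_dvd_mult_left_iff coprime_commute)
  have n1: "\<not> k dvd 1" using k2 by auto
  have P: "\<not> (k dvd u \<and> k dvd v)" if "m * u + n * v = t" "\<not> k dvd t" for u v m n t
    using that dvd_linear_combination[of k u v t m n] by auto
  have Q: "\<not> (k dvd u \<and> k dvd v \<and> k dvd w)" if "m * u + n * v + r * w = 3" for u v w m n r
  proof
    assume A: "k dvd u \<and> k dvd v \<and> k dvd w"
    then have "k dvd m * u + n * v + r * w" by (intro dvd_add dvd_mult) auto
    with that n3 show False by simp
  qed
  have p0: "\<not> (k dvd a - 1 \<and> k dvd a - b - 1)" by (rule P[of "1" _ "-1", OF _ n(2)]) simp
  have p1: "\<not> (k dvd b - 1 \<and> k dvd - b - 1)" by (rule P[of "-1" _ "-1", OF _ not_dvd_two]) simp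
  have p2: "\<not> (k dvd a + b \<and> k dvd a - 2*b)" by (rule P[of "1" _ "-1", OF _ n3a(2)]) simp
  have p3: "\<not> (k dvd a - 1 \<and> k dvd - a - 1)" by (rule P[of "-1" _ "-1", OF _ not_dvd_two]) simp
  have p4: "\<not> (k dvd b - 1 \<and> k dvd b - a - 1)" by (rule P[of "1" _ "-1", OF _ n(1)]) simp
  have p5: "\<not> (k dvd a + b \<and> k dvd b - 2*a)" by (rule P[of "1" _ "-1", OF _ n3a(1)]) simp
  have p6: "\<not> (k dvd a - b - 1 \<and> k dvd b - a - 1)" by (rule P[of "-1" _ "-1", OF _ not_dvd_two]) simp
  have p7: "\<not> (k dvd - b - 1 \<and> k dvd - a - 1)" by (rule P[of "1" _ "-1", OF _ n(3)]) simp
  have p8: "\<not> (k dvd a - 2*b \<and> k dvd b - 2*a)" by (rule P[of "-1" _ "-2", OF _ n3a(1)]) simp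
  have q0: "\<not> (k dvd a - 1 \<and> k dvd - b - 1 \<and> k dvd b - a - 1)" by (rule Q[of "-1" _ "-1" _ "-1"]) simp
  have q1: "\<not> (k dvd a - 1 \<and> k dvd - b - 1 \<and> k dvd b - 2*a)" by (rule Q[of "-2" _ "-1" _ "-1"]) simp
  have q2: "\<not> (k dvd a - 1 \<and> k dvd a - 2*b \<and> k dvd b - a - 1)" by (rule Q[of "-1" _ "-1" _ "-2"]) simp
  have q3: "\<not> (k dvd b - 1 \<and> k dvd a - b - 1 \<and> k dvd - a - 1)" by (rule Q[of "-1" _ "-1" _ "-1"]) simp
  have q4: "\<not> (k dvd b - 1 \<and> k dvd a - b - 1 \<and> k dvd b - 2*a)" by (rule Q[of "-1" _ "-2" _ "-1"]) simp
  have q5: "\<not> (k dvd b - 1 \<and> k dvd a - 2*b \<and> k dvd - a - 1)" by (rule Q[of "-2" _ "-1" _ "-1"]) simp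
  have q6: "\<not> (k dvd a + b \<and> k dvd a - b - 1 \<and> k dvd - a - 1)" by (rule Q[of "-1" _ "-1" _ "-2"]) simp
  have q7: "\<not> (k dvd a + b \<and> k dvd - b - 1 \<and> k dvd b - a - 1)" by (rule Q[of "-1" _ "-2" _ "-1"]) simp
  show False using apex_conditions(4-6) p0 p1 p2 p3 p4 p5 p6 p7 p8 q0 q1 q2 q3 q4 q5 q6 q7 by blast
qed

lemma not_collinear_triple:
  assumes S: "(p1,p2) \<in> S" "(p1+d1,p2+d2) \<in> S" "(p1-d1,p2-d2) \<in> S" "(p1+e1,p2+e2) \<in> S" "(p1+f1,p2+f2) \<in> S"
    and u: "a = p1 + l*d1 + m*e1" "b = p2 + l*d2 + m*e2" "a = p1 + l'*d1 - m*f1" "b = p2 + l'*d2 - m*f2"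
  shows False
  using collinear_triple_both_sides[OF assms] not_dvd_two by simp

text \<open>The open cones spanned by two triangle vertices are excluded by
  \<open>no_opposite_corner\<close>, which leaves three rays. A second step along a ray would make
  its vertex the middle of a collinear triple with the other two vertices on opposite sides.\<close>

lemma lattice_points: "S = {(0,0),(1,0),(0,1),(-1,-1)}"
proof -
  have "(x,y) \<in> {(0,0),(1,0),(0,1),(-1,-1)}" if p: "(x,y) \<in> S" for x y
  proof -
    have c1: "\<not> (1 \<le> x \<and> 1 \<le> y)" using at_most_one_positive_weight(1)[OF p] .
    have c2: "\<not> (1 \<le> x - y \<and> 1 \<le> - y)"
      using no_opposite_corner[of 0 0 1 0 "-1" "-1" "x-y" "-y" "a-b" "-b"] origin unit1 unit3 p by auto
    have c3: "\<not> (1 \<le> y - x \<and> 1 \<le> - x)"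
      using no_opposite_corner[of 0 0 0 1 "-1" "-1" "y-x" "-x" "b-a" "-a"] origin unit2 unit3 p by auto
    have "(y = 0 \<and> 2 \<le> x) \<or> (x = 0 \<and> 2 \<le> y) \<or> (x = y \<and> x \<le> -2) \<or>
        (x = 0 \<and> y = 0) \<or> (x = 1 \<and> y = 0) \<or> (x = 0 \<and> y = 1) \<or> (x = -1 \<and> y = -1)"
      using c1 c2 c3 by presburger
    then consider "y = 0" "2 \<le> x" | "x = 0" "2 \<le> y" | "x = y" "x \<le> -2" | 
      "(x,y) \<in> {(0,0),(1,0),(0,1),(-1,-1)}" by auto
    then show ?thesis
    proof cases
      case 1
      have "(2,0) \<in> S" by (rule conv[OF origin origin p, of 0 "x-2" 2]) (use 1 in auto)
      then show ?thesis 
        using not_collinear_triple[of 1 0 1 0 "-1" 1 "-2" "-1" "a-1+b" b "a-1-2*b"] origin unit1 unit2 unit3 by simp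
    next
      case 2
      have "(0,2) \<in> S" by (rule conv[OF origin origin p, of 0 "y-2" 2]) (use 2 in auto)
      then show ?thesis 
        using not_collinear_triple[of 0 1 0 1 1 "-1" "-1" "-2" "b-1+a" a "b-1-2*a"] origin unit1 unit2 unit3 by simp
    next
      case 3
      have "(-2,-2) \<in> S" by (rule conv[OF origin origin p, of 0 "-x-2" 2]) (use 3 in auto)
      then show ?thesis 
        using not_collinear_triple[of "-1" "-1" 1 1 2 1 1 2 "2*b-a+1" "a-b" "2*a-b+1"] origin unit1 unit2 unit3 by simp
    qed
  qed
  then show ?thesis using origin unit1 unit2 unit3 by auto
qed

lemma apex_height: "k = 3" "3 dvd a + b" "\<not> 3 dvd a"
proof -
  show k: "k = 3" using dvd_three k2 not_dvd_two zdvd_imp_le[of k 3] by (cases "k = 2") auto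
  show "3 dvd a + b" "\<not> 3 dvd a" using apex_conditions not_dvd_coprime[of a] not_dvd_coprime[of b] not_dvd_coprime[of "a-b"] 
    unfolding k by presburger+
qed

end

section \<open>Existence of a unimodular triangle\<close>

context lattice_convex2
begin

text \<open>A triangle of minimal positive determinant works: if the determinant were larger than
  one, the triangle would contain a further lattice point and hence a smaller lattice
  triangle.\<close>

lemma unimodular_triangle:
  assumes "(p1,p2) \<in> S" "(p1+d1,p2+d2) \<in> S" "(p1+e1,p2+e2) \<in> S" "d1*e2-d2*e1 \<noteq> 0"
  obtains p1 p2 d1 d2 e1 e2 where "(p1,p2) \<in> S" "(p1+d1,p2+d2) \<in> S" "(p1+e1,p2+e2) \<in> S" "d1*e2-d2*e1 = 1"
proof -
  define T where "T D \<longleftrightarrow> (\<exists>p1 p2 d1 d2 e1 e2. (p1,p2) \<in> S \<and> (p1+d1,p2+d2) \<in> S \<and> (p1+e1,p2+e2) \<in> S \<and> d1*e2-d2*e1 = D)"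
    for D :: int
  have "T (d1*e2-d2*e1)" "T (e1*d2-e2*d1)" using assms unfolding T_def by blast+
  then have "\<exists>n>0. T (int n)"
    using assms(4) by (intro exI[of _ "nat \<bar>d1*e2-d2*e1\<bar>"]) (auto simp: abs_if algebra_simps)
  then obtain n where n: "0 < n" "T (int n)" and least: "\<And>m. 0 < m \<Longrightarrow> T (int m) \<Longrightarrow> n \<le> m"
    using exists_least_iff[of "\<lambda>n. 0 < n \<and> T (int n)"] by (metis not_less)
  define D where "D = int n"
  have D0: "0 < D" and min: "\<And>E. 0 < E \<Longrightarrow> T E \<Longrightarrow> D \<le> E"
    using n(1) least unfolding D_def by (simp, metis nat_le_iff int_nat_eq zero_less_nat_eq less_le zle_int)
  obtain p1 p2 d1 d2 e1 e2 where S: "(p1,p2) \<in> S" "(p1+d1,p2+d2) \<in> S" "(p1+e1,p2+e2) \<in> S"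
    and det: "d1*e2-d2*e1 = D"
    using n(2) unfolding T_def D_def by blast
  \<comment> \<open>By Cramer's rule a lattice point with barycentric numerators \<open>i\<close>
    and \<open>j\<close> over \<open>D\<close> spans triangles of determinants \<open>i\<close> and
    \<open>j\<close>; both are below \<open>D\<close> and one is positive.\<close>
  have no: False if ij: "0 \<le> i" "0 \<le> j" "0 < i + j" "i + j \<le> D" "i < D" "j < D"
    and xy: "D * x = i * d1 + j * e1" "D * y = i * d2 + j * e2" for i j x y
  proof -
    have q: "(p1+x,p2+y) \<in> S"
      by (rule conv[OF S, of "D-i-j" i j]) (use ij xy D0 in \<open>auto simp: algebra_simps\<close>)
    have "D * (x*e2 - y*e1) = (D*x)*e2 - (D*y)*e1" by (simp add: algebra_simps)
    also have "\<dots> = i * (d1*e2-d2*e1)" unfolding xy by (simp add: algebra_simps)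
    finally have "x*e2 - y*e1 = i" using D0 det by simp
    then have "T i" using S q unfolding T_def by blast
    have "D * (d1*y - d2*x) = d1*(D*y) - d2*(D*x)" by (simp add: algebra_simps)
    also have "\<dots> = j * (d1*e2-d2*e1)" unfolding xy by (simp add: algebra_simps)
    finally have "d1*y - d2*x = j" using D0 det by simp
    then have "T j" using S q unfolding T_def by blast
    show False using min[of i] min[of j] \<open>T i\<close> \<open>T j\<close> ij by linarith
  qed
  have "D = 1"
  proof (rule ccontr)
    assume "D \<noteq> 1"
    have "\<not> (D dvd d1 \<and> D dvd d2 \<and> D dvd e1 \<and> D dvd e2)"
    proof
      assume "D dvd d1 \<and> D dvd d2 \<and> D dvd e1 \<and> D dvd e2"
      then have "D * D dvd d1*e2-d2*e1" by (intro dvd_diff mult_dvd_mono) auto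
      then show False using det D0 \<open>D \<noteq> 1\<close> by simp
    qed
    \<comment> \<open>Cramer's rule writes each unit vector as an integer combination of the edges
      divided by \<open>D\<close>; for one of them the coefficients are not both multiples of
      \<open>D\<close>.\<close>
    then obtain i0 j0 x0 y0 where 0: "D * x0 = i0 * d1 + j0 * e1" "D * y0 = i0 * d2 + j0 * e2" "\<not> (D dvd i0 \<and> D dvd j0)"
    proof (cases "D dvd e2 \<and> D dvd d2")
      case False
      then show ?thesis using that[of 1 e2 "-d2" 0] det by (auto simp: algebra_simps)
    next
      case True
      then show ?thesis using that[of 0 "-e1" d1 1] det \<open>\<not> (D dvd d1 \<and> _)\<close> by (auto simp: algebra_simps)
    qed
    define i where "i = i0 mod D"
    define j where "j = j0 mod D"
    define x where "x = x0 - (i0 div D) * d1 - (j0 div D) * e1"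
    define y where "y = y0 - (i0 div D) * d2 - (j0 div D) * e2"
    have ij: "0 \<le> i" "i < D" "0 \<le> j" "j < D" using D0 unfolding i_def j_def by auto
    have nz: "i \<noteq> 0 \<or> j \<noteq> 0" using 0(3) unfolding i_def j_def by auto
    have m: "D * (i0 div D) = i0 - i" "D * (j0 div D) = j0 - j"
      using mult_div_mod_eq[of D i0] mult_div_mod_eq[of D j0] unfolding i_def j_def by linarith+
    have "D * x = D * x0 - (D * (i0 div D)) * d1 - (D * (j0 div D)) * e1" unfolding x_def by (simp add: algebra_simps)
    also have "\<dots> = i * d1 + j * e1" unfolding m 0(1) by (simp add: algebra_simps)
    finally have x: "D * x = i * d1 + j * e1" .
    have "D * y = D * y0 - (D * (i0 div D)) * d2 - (D * (j0 div D)) * e2" unfolding y_def by (simp add: algebra_simps)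
    also have "\<dots> = i * d2 + j * e2" unfolding m 0(2) by (simp add: algebra_simps)
    finally have y: "D * y = i * d2 + j * e2" .
    show False
    \<comment> \<open>In the far half of the fundamental parallelogram, reflection in its centre
      returns the point to the triangle.\<close>
    proof (cases "i + j \<le> D")
      case True
      show False by (rule no[of i j x y]) (use True ij nz x y in auto)
    next
      case False
      show False by (rule no[of "D-i" "D-j" "d1+e1-x" "d2+e2-y"]) (use False ij x y in \<open>auto simp: algebra_simps\<close>)
    qed
  qed
  with that S det show ?thesis by blast
qed

end

section \<open>Unimodular maps\<close>

lemma convex_hull_affine_image: "affine_map t \<Longrightarrow> t ` (convex hull S) = convex hull (t ` S)"
proof -
  assume "affine_map t"
  then obtain L c where L: "linear L" and t: "t = (+) c \<circ> L"
    by (auto simp: affine_map_def fun_eq_iff add.commute)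
  show ?thesis
    unfolding t image_comp[symmetric] convex_hull_linear_image[OF L] convex_hull_translation ..
qed

lemma affine_map_comp: "affine_map f \<Longrightarrow> affine_map g \<Longrightarrow> affine_map (f \<circ> g)"
proof -
  assume "affine_map f" "affine_map g"
  then obtain L c M d where L: "linear L" "\<And>x. f x = L x + c" and M: "linear M" "\<And>x. g x = M x + d"
    by (auto simp: affine_map_def)
  have "linear (L \<circ> M)" using L M by (intro linear_compose)
  moreover have "(f \<circ> g) x = (L \<circ> M) x + (L d + c)" for x
    using L M by (simp add: linear_add)
  ultimately show ?thesis unfolding affine_map_def by blast
qed

lemma axis_in_int_lattice: "axis i 1 \<in> int_lattice"
  by (auto simp: int_lattice_def axis_def)

lemma int_lattice_add: "x \<in> int_lattice \<Longrightarrow> y \<in> int_lattice \<Longrightarrow> x + y \<in> int_lattice"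
  by (auto simp: int_lattice_def)

locale unimodular_map =
  fixes t :: "real ^ 'n \<Rightarrow> real ^ 'n"
  assumes affine: "affine_map t" and lattice: "t ` int_lattice = int_lattice"
begin

text \<open>The image of the lattice contains every unit vector translated by \<open>c\<close>, so
  the linear part is onto and therefore invertible.\<close>

lemma linear_bijection: obtains L c where "linear L" "bij L" "\<And>x. t x = L x + c"
proof -
  obtain L c where L: "linear L" "\<And>x. t x = L x + c" using affine by (auto simp: affine_map_def)
  have "0 \<in> int_lattice" by (simp add: int_lattice_def)
  then have "t 0 \<in> int_lattice" using lattice by blast
  then have c: "c \<in> int_lattice" using L by (simp add: linear_0)
  have ax: "axis i 1 \<in> range L" for i
  proof -
    have "axis i 1 + c \<in> t ` int_lattice"
      using lattice int_lattice_add[OF axis_in_int_lattice c] by simp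
    then show ?thesis using L by auto
  qed
  have "span (range (\<lambda>i. axis i 1 :: real^'n)) \<subseteq> range L"
    using ax linear_subspace_image[OF L(1) subspace_UNIV] by (intro span_minimal) auto
  moreover have "(Basis :: (real^'n) set) \<subseteq> range (\<lambda>i. axis i 1)" by (auto simp: Basis_vec_def)
  then have "span (range (\<lambda>i. axis i 1 :: real^'n)) = UNIV"
    using span_Basis span_mono by blast
  ultimately have "surj L" by auto
  moreover from this have "inj L" using L(1) by (intro linear_surjective_imp_injective) auto
  ultimately show ?thesis using that L by (auto simp: bij_def)
qed

lemma bij: "bij t"
proof -
  obtain L c where L: "bij L" "\<And>x. t x = L x + c" using linear_bijection by metis
  have "t = (+) c \<circ> L" using L by (auto simp: fun_eq_iff)
  then show ?thesis using L(1) bij_plus_right by (metis bij_comp bij_plus)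
qed

lemma inj: "inj t" and surj: "surj t"
  using bij by (auto simp: bij_def)

lemma image_minus: "t ` (A - {x}) = t ` A - {t x}"
  using inj by (simp add: image_set_diff)

lemma image_inter_lattice: "t ` A \<inter> int_lattice = t ` (A \<inter> int_lattice)"
  using lattice by (metis image_Int inj)

lemma inverse: "unimodular_map (inv t)"
proof
  obtain L c where L: "linear L" "bij L" "\<And>x. t x = L x + c" using linear_bijection by metis
  have lin: "linear (inv L)" using L by (intro inj_linear_imp_inv_linear) (auto simp: bij_def)
  have "inv t y = inv L y + (- inv L c)" for y
  proof -
    have "t (inv L (y - c)) = y" using L by (simp add: bij_def surj_f_inv_f)
    then have "inv t y = inv L (y - c)" using inj by (metis inv_f_f)
    then show ?thesis using lin by (simp add: linear_diff)
  qed
  then show "affine_map (inv t)" using lin unfolding affine_map_def by blast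
  show "inv t ` int_lattice = int_lattice"
    using lattice inj by (metis image_inv_f_f)
qed

lemma aff_dim_image: "aff_dim (t ` S) = aff_dim S"
proof -
  obtain L c where L: "linear L" "bij L" "\<And>x. t x = L x + c" using linear_bijection by metis
  have "t ` S = (+) c ` (L ` S)" using L by (auto simp: image_image add.commute)
  then show ?thesis using L by (simp add: aff_dim_translation_eq aff_dim_injective_linear_image bij_def)
qed

lemma convex_image_iff: "convex (t ` S) \<longleftrightarrow> convex S"
proof -
  interpret i: unimodular_map "inv t" by (rule inverse)
  have *: "convex (s ` A)" if "affine_map s" "convex A" for s :: "real ^ 'n \<Rightarrow> real ^ 'n" and A
    using convex_hull_affine_image[OF that(1), of A] that(2) by (metis convex_convex_hull hull_same)
  show ?thesis
    using *[OF affine] *[OF i.affine, of "t ` S"] inj by (auto simp: image_inv_f_f)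
qed

lemma extreme_point_image: "convex P \<Longrightarrow> t x extreme_point_of t ` P \<longleftrightarrow> x extreme_point_of P"
  using inj by (simp add: extreme_point_of_stillconvex convex_image_iff image_minus[symmetric] inj_image_mem_iff)

lemma delete_vertex_image: "delete_vertex (t ` P) (t v) = t ` delete_vertex P v"
  unfolding delete_vertex_def image_inter_lattice image_minus[symmetric] convex_hull_affine_image[OF affine] ..

lemma integer_functional_comp:
  assumes "integer_functional f" shows "integer_functional (f \<circ> t)"
  using assms affine_map_comp[OF _ affine] lattice unfolding integer_functional_def
  by (metis image_comp)

lemma constant_comp: "(f \<circ> t) constant_on UNIV \<longleftrightarrow> f constant_on UNIV"
  using surj unfolding constant_on_def by (metis UNIV_I comp_apply surj_def)

lemma width_image: "width (t ` S) = width S"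
proof -
  interpret i: unimodular_map "inv t" by (rule inverse)
  have "{Sup (f ` t ` S) - Inf (f ` t ` S) | f. integer_functional f \<and> \<not> f constant_on UNIV}
    = {Sup (f ` S) - Inf (f ` S) | f. integer_functional f \<and> \<not> f constant_on UNIV}" (is "?A = ?B")
  proof
    show "?A \<subseteq> ?B"
    proof
      fix x assume "x \<in> ?A"
      then obtain f where "x = Sup (f ` t ` S) - Inf (f ` t ` S)" "integer_functional f" "\<not> f constant_on UNIV" by auto
      then show "x \<in> ?B" using integer_functional_comp[of f] constant_comp[of f]
        by (auto simp: image_comp intro!: exI[of _ "f \<circ> t"])
    qed
    show "?B \<subseteq> ?A"
    proof
      fix x assume "x \<in> ?B"
      then obtain f where f: "x = Sup (f ` S) - Inf (f ` S)" "integer_functional f" "\<not> f constant_on UNIV" by auto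
      have "(f \<circ> inv t) ` t ` S = f ` S" using inj by (auto simp: image_comp comp_def)
      then have "x = Sup ((f \<circ> inv t) ` t ` S) - Inf ((f \<circ> inv t) ` t ` S)" using f(1) by simp
      moreover have "integer_functional (f \<circ> inv t)" "\<not> (f \<circ> inv t) constant_on UNIV"
        using f(2,3) i.integer_functional_comp[of f] i.constant_comp[of f] by auto
      ultimately show "x \<in> ?A" by blast
    qed
  qed
  then show ?thesis unfolding width_def by simp
qed

lemma essential_vertex_image: "convex P \<Longrightarrow> essential_vertex (t ` P) (t v) \<longleftrightarrow> essential_vertex P v"
  by (simp add: essential_vertex_def extreme_point_image delete_vertex_image width_image)

lemma quasi_minimal_image: "convex P \<Longrightarrow> quasi_minimal (t ` P) \<longleftrightarrow> quasi_minimal P"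
proof -
  assume P: "convex P"
  have *: "(\<forall>v. Q v) \<longleftrightarrow> (\<forall>v. Q (t v))" for Q using surj by (metis surjD)
  show ?thesis unfolding quasi_minimal_def
    by (subst *, subst (2) *) (simp add: P extreme_point_image essential_vertex_image inj_eq[OF inj])
qed

lemma merged_image: "convex P \<Longrightarrow> merged (t ` P) \<longleftrightarrow> merged P"
proof -
  assume P: "convex P"
  have *: "(\<exists>v. Q v) \<longleftrightarrow> (\<exists>v. Q (t v))" for Q using surj by (metis surjD)
  show ?thesis unfolding merged_def
    by (subst *, subst (2) *)
      (simp add: P extreme_point_image delete_vertex_image width_image aff_dim_image inj_eq[OF inj])
qed

lemma lattice_size_image: "lattice_size (t ` P) = lattice_size P"
  unfolding lattice_size_def image_inter_lattice using inj by (simp add: card_image inj_on_def)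

lemma lattice_polytope_image: "lattice_polytope P \<Longrightarrow> lattice_polytope (t ` P)"
proof -
  assume "lattice_polytope P"
  then obtain V where V: "finite V" "V \<subseteq> int_lattice" "P = convex hull V" by (auto simp: lattice_polytope_def)
  then have "finite (t ` V)" "t ` V \<subseteq> int_lattice" "t ` P = convex hull (t ` V)"
    using lattice convex_hull_affine_image[OF affine] by auto
  then show ?thesis unfolding lattice_polytope_def by blast
qed

lemma unimodularly_equivalent_image: "unimodularly_equivalent P (t ` P)"
  using affine lattice unfolding unimodularly_equivalent_def by blast

end

lemma unimodularly_equivalentE:
  assumes "unimodularly_equivalent P Q"
  obtains t where "unimodular_map t" "t ` P = Q"
  using assms unfolding unimodularly_equivalent_def by (auto intro: unimodular_map.intro)

lemma unimodularly_equivalent_trans: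
  assumes "unimodularly_equivalent P Q" "unimodularly_equivalent Q R"
  shows "unimodularly_equivalent P R"
proof -
  obtain t where t: "unimodular_map t" "t ` P = Q" using assms(1) by (rule unimodularly_equivalentE)
  obtain s where s: "unimodular_map s" "s ` Q = R" using assms(2) by (rule unimodularly_equivalentE)
  interpret t: unimodular_map t by fact
  interpret s: unimodular_map s by fact
  have "affine_map (s \<circ> t)" by (rule affine_map_comp[OF s.affine t.affine])
  moreover have "(s \<circ> t) ` int_lattice = int_lattice" "(s \<circ> t) ` P = R"
    unfolding image_comp[symmetric] t.lattice s.lattice t s by (rule refl)+
  ultimately show ?thesis unfolding unimodularly_equivalent_def by blast
qed

lemma lattice_polytope_convex: "lattice_polytope P \<Longrightarrow> convex P"
  by (auto simp: lattice_polytope_def)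

lemma lattice_polytope_compact: "lattice_polytope P \<Longrightarrow> compact P"
  by (auto simp: lattice_polytope_def finite_imp_compact_convex_hull)

section \<open>Integer coordinates\<close>

type_synonym ipoint = "int \<times> int \<times> int"

fun ipt :: "ipoint \<Rightarrow> real ^ 3" where
  "ipt (x, y, z) = vector [of_int x, of_int y, of_int z]"

fun ev :: "ipoint \<Rightarrow> ipoint \<Rightarrow> int" where
  "ev (a, b, c) (x, y, z) = a * x + b * y + c * z"

definition lattice_points :: "(real ^ 3) set \<Rightarrow> ipoint set" where
  "lattice_points P = {p. ipt p \<in> P}"

text \<open>Integer form of width larger than one: constant terms cancel in differences, and the
  oscillation on a lattice polytope is an integer, so exceeding 1 means reaching 2.\<close>

definition wide :: "ipoint set \<Rightarrow> bool" where
  "wide L \<longleftrightarrow> (\<forall>n. n \<noteq> (0,0,0) \<longrightarrow> (\<exists>p\<in>L. \<exists>q\<in>L. ev n p - ev n q \<ge> 2))"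

lemma inj_ipt: "inj ipt"
  by (rule injI) (auto elim!: ipt.elims simp: vec_eq_iff forall_3)

lemma ipt_eq_iff [simp]: "ipt p = ipt q \<longleftrightarrow> p = q"
  using inj_ipt by (simp add: inj_eq)

lemma range_ipt: "range ipt = int_lattice"
proof
  show "range ipt \<subseteq> int_lattice" by (auto simp: int_lattice_def forall_3)
  show "int_lattice \<subseteq> range ipt"
  proof
    fix x :: "real^3" assume "x \<in> int_lattice"
    then have "x $ 1 \<in> \<int>" "x $ 2 \<in> \<int>" "x $ 3 \<in> \<int>" by (auto simp: int_lattice_def)
    then obtain a b c where "x $ 1 = of_int a" "x $ 2 = of_int b" "x $ 3 = of_int c" by (metis Ints_cases)
    then have "x = ipt (a, b, c)" by (simp add: vec_eq_iff forall_3)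
    then show "x \<in> range ipt" by blast
  qed
qed

lemma ipt_in_lattice [simp]: "ipt p \<in> int_lattice"
  unfolding range_ipt[symmetric] by (rule rangeI)

lemma image_lattice_points: "ipt ` lattice_points P = P \<inter> int_lattice"
  unfolding lattice_points_def range_ipt[symmetric] by auto

lemma lattice_size_eq: "lattice_size P = card (lattice_points P)"
  unfolding lattice_size_def image_lattice_points[symmetric] using inj_ipt
  by (simp add: card_image inj_on_def)

lemma delete_vertex_eq: "delete_vertex P (ipt v) = convex hull (ipt ` (lattice_points P - {v}))"
  unfolding delete_vertex_def image_lattice_points[symmetric]
  using inj_ipt by (simp add: image_set_diff)

lemma lattice_polytope_eq: "lattice_polytope P \<Longrightarrow> P = convex hull (ipt ` lattice_points P)"
proof -
  assume "lattice_polytope P"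
  then obtain V where V: "V \<subseteq> int_lattice" "P = convex hull V" by (auto simp: lattice_polytope_def)
  then have "V \<subseteq> P \<inter> int_lattice" using hull_subset by fastforce
  then have "P \<subseteq> convex hull (P \<inter> int_lattice)" using V(2) hull_mono by metis
  moreover have "convex hull (P \<inter> int_lattice) \<subseteq> P"
    using V(2) by (metis convex_convex_hull hull_minimal inf_le1)
  ultimately show ?thesis by (simp add: image_lattice_points)
qed

lemma finite_lattice_points: "bounded P \<Longrightarrow> finite (lattice_points P)"
proof -
  assume "bounded P"
  then obtain B where B: "\<And>x. x \<in> P \<Longrightarrow> norm x \<le> B" by (auto simp: bounded_iff)
  have "lattice_points P \<subseteq> {-\<lceil>B\<rceil>..\<lceil>B\<rceil>} \<times> {-\<lceil>B\<rceil>..\<lceil>B\<rceil>} \<times> {-\<lceil>B\<rceil>..\<lceil>B\<rceil>}"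
  proof
    fix p assume p: "p \<in> lattice_points P"
    obtain x y z where xyz: "p = (x, y, z)" by (metis prod_cases3)
    have "\<bar>ipt p $ i\<bar> \<le> B" for i
      using B[of "ipt p"] p component_le_norm_cart[of "ipt p" i] unfolding lattice_points_def by simp
    from this[of 1] this[of 2] this[of 3]
    have "\<bar>x\<bar> \<le> \<lceil>B\<rceil>" "\<bar>y\<bar> \<le> \<lceil>B\<rceil>" "\<bar>z\<bar> \<le> \<lceil>B\<rceil>"
      unfolding xyz by (auto simp: abs_le_iff) linarith+
    then show "p \<in> {-\<lceil>B\<rceil>..\<lceil>B\<rceil>} \<times> {-\<lceil>B\<rceil>..\<lceil>B\<rceil>} \<times> {-\<lceil>B\<rceil>..\<lceil>B\<rceil>}" unfolding xyz by auto
  qed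
  then show ?thesis by (rule finite_subset) auto
qed

lemma finite_lattice_points_polytope: "lattice_polytope P \<Longrightarrow> finite (lattice_points P)"
  by (intro finite_lattice_points compact_imp_bounded lattice_polytope_compact)

lemma integer_functional_iff:
  fixes f :: "real ^ 3 \<Rightarrow> real"
  shows "integer_functional f \<longleftrightarrow>
    (\<exists>a b c d. \<forall>x. f x = of_int a * x $ 1 + of_int b * x $ 2 + of_int c * x $ 3 + of_int d)" (is "_ \<longleftrightarrow> ?R")
proof
  assume f: "integer_functional f"
  then obtain L c where L: "linear L" "\<And>x. f x = L x + c" by (auto simp: integer_functional_def affine_map_def)
  have int: "f (ipt p) \<in> \<int>" for p using f by (auto simp: integer_functional_def)
  have "f (ipt (0,0,0)) \<in> \<int>" by (rule int)
  moreover have z: "ipt (0,0,0) = 0" by (simp add: vec_eq_iff forall_3)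
  ultimately have c: "c \<in> \<int>" using L by (simp add: linear_0)
  have Li: "L (ipt p) \<in> \<int>" for p using int[of p] c L(2)[of "ipt p"] by (metis Ints_diff add_diff_cancel_right')
  obtain d where d: "c = of_int d" using c by (metis Ints_cases)
  obtain a1 a2 a3 where a: "L (ipt (1,0,0)) = of_int a1" "L (ipt (0,1,0)) = of_int a2" "L (ipt (0,0,1)) = of_int a3"
    using Li by (metis Ints_cases)
  have "f x = of_int a1 * x $ 1 + of_int a2 * x $ 2 + of_int a3 * x $ 3 + of_int d" for x
  proof -
    have x: "x = x $ 1 *\<^sub>R ipt (1,0,0) + x $ 2 *\<^sub>R ipt (0,1,0) + x $ 3 *\<^sub>R ipt (0,0,1)"
      by (simp add: vec_eq_iff forall_3)
    have "L x = x $ 1 * L (ipt (1,0,0)) + x $ 2 * L (ipt (0,1,0)) + x $ 3 * L (ipt (0,0,1))"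
      by (subst x) (simp only: linear_add[OF L(1)] linear_scale[OF L(1)] real_scaleR_def)
    then show ?thesis unfolding a d[symmetric] L(2) by simp
  qed
  then show ?R by blast
next
  assume ?R
  then obtain a b c d where f: "\<And>x. f x = of_int a * x $ 1 + of_int b * x $ 2 + of_int c * x $ 3 + of_int d" by blast
  have "linear (\<lambda>x::real^3. of_int a * x $ 1 + of_int b * x $ 2 + of_int c * x $ 3)"
    by (rule linearI) (simp_all add: algebra_simps)
  then have "affine_map f" unfolding affine_map_def using f by blast
  moreover have "f ` int_lattice \<subseteq> \<int>" using f by (auto simp: int_lattice_def)
  ultimately show "integer_functional f" by (simp add: integer_functional_def)
qed

text \<open>A normal varying by at most one on \<open>L\<close> confines the hull to a slab of
  thickness one. Conversely all oscillations are at least 2, a uniform gap, so the strict inequality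
  survives the infimum.\<close>

lemma width_gt_one_iff:
  assumes "finite L" "L \<noteq> {}"
  shows "width (convex hull (ipt ` L)) > 1 \<longleftrightarrow> wide L"
proof -
  define H where "H = convex hull (ipt ` L)"
  define W where "W = {Sup (f ` H) - Inf (f ` H) | f. integer_functional f \<and> \<not> f constant_on UNIV}"
  have H: "compact H" "H \<noteq> {}" unfolding H_def using assms by (auto simp: finite_imp_compact_convex_hull)
  have sub: "ipt ` L \<subseteq> H" unfolding H_def by (rule hull_subset)
  define F where "F a b c d x = of_int a * x $ 1 + of_int b * x $ 2 + of_int c * x $ 3 + of_int d" 
    for a b c d :: int and x :: "real^3"
  have F: "F a b c d (ipt p) = of_int (ev (a,b,c) p) + of_int d" for a b c d p
    unfolding F_def by (cases p) simp
  have bdd: "bdd_above (F a b c d ` H)" "bdd_below (F a b c d ` H)" for a b c d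
  proof -
    have "compact (F a b c d ` H)" using H(1) unfolding F_def
      by (intro compact_continuous_image continuous_intros)
    then show "bdd_above (F a b c d ` H)" "bdd_below (F a b c d ` H)"
      by (auto intro: bounded_imp_bdd_above bounded_imp_bdd_below compact_imp_bounded)
  qed
  have Fle: "of_int (ev (a,b,c) p - ev (a,b,c) q) \<le> Sup (F a b c d ` H) - Inf (F a b c d ` H)"
    if "p \<in> L" "q \<in> L" for a b c d p q
  proof -
    have "F a b c d (ipt p) \<le> Sup (F a b c d ` H)" using that sub bdd by (intro cSup_upper) auto
    moreover have "Inf (F a b c d ` H) \<le> F a b c d (ipt q)" using that sub bdd by (intro cInf_lower) auto
    ultimately show ?thesis unfolding F by simp
  qed
  have nonconst: "\<not> F a b c d constant_on UNIV \<longleftrightarrow> (a,b,c) \<noteq> (0,0,0)" for a b c d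
  proof
    assume *: "(a,b,c) \<noteq> (0,0,0)"
    show "\<not> F a b c d constant_on UNIV"
    proof
      assume "F a b c d constant_on UNIV"
      then have "F a b c d (ipt p) = F a b c d (ipt (0,0,0))" for p unfolding constant_on_def by (metis UNIV_I)
      from this[of "(1,0,0)"] this[of "(0,1,0)"] this[of "(0,0,1)"] show False using * unfolding F by simp
    qed
  next
    assume "\<not> F a b c d constant_on UNIV"
    then show "(a,b,c) \<noteq> (0,0,0)" by (auto simp: constant_on_def F_def)
  qed
  have W: "W = {Sup (F a b c d ` H) - Inf (F a b c d ` H) | a b c d. (a,b,c) \<noteq> (0,0,0)}"
  proof -
    have I: "integer_functional f \<longleftrightarrow> (\<exists>a b c d. f = F a b c d)" for f
      unfolding integer_functional_iff F_def fun_eq_iff ..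
    show ?thesis
    proof (intro equalityI subsetI)
      fix w assume "w \<in> W"
      then obtain f where f: "w = Sup (f ` H) - Inf (f ` H)" "integer_functional f" "\<not> f constant_on UNIV"
        unfolding W_def by blast
      from f(2) obtain a b c d where "f = F a b c d" unfolding I by blast
      with f show "w \<in> {Sup (F a b c d ` H) - Inf (F a b c d ` H) | a b c d. (a,b,c) \<noteq> (0,0,0)}"
        using nonconst by blast
    next
      fix w assume "w \<in> {Sup (F a b c d ` H) - Inf (F a b c d ` H) | a b c d. (a,b,c) \<noteq> (0,0,0)}"
      then obtain a b c d where f: "w = Sup (F a b c d ` H) - Inf (F a b c d ` H)" "(a,b,c) \<noteq> (0,0,0)" by blast
      have "integer_functional (F a b c d)" unfolding I by blast
      then show "w \<in> W" unfolding W_def using f nonconst[of a b c d] by blast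
    qed
  qed
  have W0: "0 \<le> w" if "w \<in> W" for w
  proof -
    obtain p where "p \<in> L" using assms(2) by blast
    with that show ?thesis using Fle[of p p] unfolding W by auto
  qed
  have "Sup (F 1 0 0 0 ` H) - Inf (F 1 0 0 0 ` H) \<in> W"
    unfolding W by (intro CollectI exI[of _ 1] exI[of _ 0] conjI refl) simp
  then have "W \<noteq> {}" by blast
  have "Inf W > 1 \<longleftrightarrow> wide L"
  proof
    assume I: "Inf W > 1"
    show "wide L" unfolding wide_def
    proof (intro allI impI)
      fix n :: ipoint assume n: "n \<noteq> (0,0,0)"
      obtain a b c where abc: "n = (a,b,c)" by (metis prod_cases3)
      show "\<exists>p\<in>L. \<exists>q\<in>L. ev n p - ev n q \<ge> 2"
      proof (rule ccontr)
        assume "\<not> ?thesis"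
        then have le: "ev n p - ev n q \<le> 1" if "p \<in> L" "q \<in> L" for p q using that by (metis linorder_not_le zle_add1_eq_le one_add_one)
        define m where "m = Min (ev n ` L)"
        have m: "m \<in> ev n ` L" "\<And>p. p \<in> L \<Longrightarrow> m \<le> ev n p" unfolding m_def using assms by auto
        obtain p0 where p0: "p0 \<in> L" "m = ev n p0" using m(1) by blast
        have m1: "ev n p \<le> m + 1" if "p \<in> L" for p using le[OF that p0(1)] p0(2) by simp
        have "ipt ` L \<subseteq> {x. F a b c 0 x \<le> of_int (m + 1)} \<inter> {x. F a b c 0 x \<ge> of_int m}"
        proof
          fix x assume "x \<in> ipt ` L"
          then obtain p where p: "p \<in> L" "x = ipt p" by blast
          have "m \<le> ev (a,b,c) p" "ev (a,b,c) p \<le> m + 1" using m(2)[OF p(1)] m1[OF p(1)] unfolding abc by auto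
          then show "x \<in> {x. F a b c 0 x \<le> of_int (m + 1)} \<inter> {x. F a b c 0 x \<ge> of_int m}"
            unfolding p(2) by (simp add: F del: of_int_add)
        qed
        moreover have "convex ({x. F a b c 0 x \<le> of_int (m + 1)} \<inter> {x. F a b c 0 x \<ge> of_int m})"
        proof -
          have "{x. F a b c 0 x \<le> of_int (m + 1)} = {x. vector [of_int a, of_int b, of_int c] \<bullet> x \<le> of_int (m+1)}"
            "{x. F a b c 0 x \<ge> of_int m} = {x. vector [of_int a, of_int b, of_int c] \<bullet> x \<ge> of_int m}"
            unfolding F_def inner_vec_def by (simp_all add: sum_3)
          then show ?thesis by (simp add: convex_Int convex_halfspace_le convex_halfspace_ge)
        qed
        ultimately have "H \<subseteq> {x. F a b c 0 x \<le> of_int (m + 1)} \<inter> {x. F a b c 0 x \<ge> of_int m}"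
          unfolding H_def by (rule hull_minimal)
        then have "Sup (F a b c 0 ` H) \<le> of_int (m + 1)" "Inf (F a b c 0 ` H) \<ge> of_int m"
          using H(2) by (auto intro!: cSup_least cInf_greatest)
        then have "Sup (F a b c 0 ` H) - Inf (F a b c 0 ` H) \<le> 1" by simp
        moreover have "Sup (F a b c 0 ` H) - Inf (F a b c 0 ` H) \<in> W" using n unfolding W abc by blast
        then have "Inf W \<le> Sup (F a b c 0 ` H) - Inf (F a b c 0 ` H)"
          using bdd_belowI[of W 0, OF W0] by (intro cInf_lower)
        ultimately show False using I by linarith
      qed
    qed
  next
    assume wide: "wide L"
    have "2 \<le> Inf W"
    proof (rule cInf_greatest[OF \<open>W \<noteq> {}\<close>])
      fix w assume "w \<in> W"
      then obtain a b c d where w: "w = Sup (F a b c d ` H) - Inf (F a b c d ` H)" "(a,b,c) \<noteq> (0,0,0)"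
        unfolding W by blast
      then obtain p q where "p \<in> L" "q \<in> L" "ev (a,b,c) p - ev (a,b,c) q \<ge> 2" using wide unfolding wide_def by metis
      then show "2 \<le> w" using Fle[of p q a b c d] unfolding w by linarith
    qed
    then show "Inf W > 1" by simp
  qed
  then show ?thesis unfolding W_def H_def width_def .
qed

declare ipt.simps [simp del]

lemma ipt_nth [simp]: "ipt (x, y, z) $ 1 = of_int x" "ipt (x, y, z) $ 2 = of_int y" "ipt (x, y, z) $ 3 = of_int z"
  by (simp_all add: ipt.simps)

section \<open>Vertices and lattice points of lattice polytopes\<close>

lemma extreme_point_of_iff:
  assumes "lattice_polytope P"
  shows "ipt v extreme_point_of P \<longleftrightarrow> v \<in> lattice_points P \<and> ipt v \<notin> delete_vertex P (ipt v)"
proof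
  have P: "convex P" by (rule lattice_polytope_convex[OF assms])
  assume E: "ipt v extreme_point_of P"
  then have v: "ipt v \<in> P" "convex (P - {ipt v})" using extreme_point_of_stillconvex[OF P] by auto
  have "ipt ` (lattice_points P - {v}) \<subseteq> P - {ipt v}" by (auto simp: lattice_points_def)
  then have "delete_vertex P (ipt v) \<subseteq> P - {ipt v}" unfolding delete_vertex_eq using v(2) by (rule hull_minimal)
  then show "v \<in> lattice_points P \<and> ipt v \<notin> delete_vertex P (ipt v)"
    using v(1) by (auto simp: lattice_points_def)
next
  assume v: "v \<in> lattice_points P \<and> ipt v \<notin> delete_vertex P (ipt v)"
  then have "insert (ipt v) (ipt ` (lattice_points P - {v})) = ipt ` lattice_points P" by auto
  then have "P = convex hull insert (ipt v) (ipt ` (lattice_points P - {v}))"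
    using lattice_polytope_eq[OF assms] by simp
  then show "ipt v extreme_point_of P"
    using v extreme_point_of_convex_hull_insert[of "ipt ` (lattice_points P - {v})" "ipt v"]
      finite_lattice_points_polytope[OF assms] unfolding delete_vertex_eq by simp
qed

lemma extreme_point_lattice:
  assumes "lattice_polytope P" "x extreme_point_of P"
  obtains v where "x = ipt v" "v \<in> lattice_points P"
proof -
  have "x \<in> ipt ` lattice_points P"
    using extreme_point_of_convex_hull assms lattice_polytope_eq by metis
  then show ?thesis using that by blast
qed

lemma hull_lattice_polytope: "finite L \<Longrightarrow> lattice_polytope (convex hull (ipt ` L))"
  unfolding lattice_polytope_def by (intro exI[of _ "ipt ` L"]) auto

text \<open>The smaller hull stays inside \<open>P\<close> and misses its deleted extreme point.
  Hence iterated deletions can be computed on sets of lattice points.\<close>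

lemma lattice_points_delete_vertex:
  assumes "lattice_polytope P" "ipt v extreme_point_of P"
  shows "lattice_points (delete_vertex P (ipt v)) = lattice_points P - {v}"
proof
  have "delete_vertex P (ipt v) \<subseteq> P"
    unfolding delete_vertex_def by (rule hull_minimal) (auto simp: lattice_polytope_convex assms(1))
  then show "lattice_points (delete_vertex P (ipt v)) \<subseteq> lattice_points P - {v}"
    using assms extreme_point_of_iff by (auto simp: lattice_points_def)
  show "lattice_points P - {v} \<subseteq> lattice_points (delete_vertex P (ipt v))"
    unfolding delete_vertex_eq using hull_subset[of "ipt ` (lattice_points P - {v})" convex]
    by (auto simp: lattice_points_def)
qed

lemma convex_delete_vertex: "convex (delete_vertex P v)"
  unfolding delete_vertex_def by (rule convex_convex_hull)

lemma lattice_points_conv: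
  fixes c0 c1 c2 c3 :: int
  assumes P: "convex P"
    and p: "(x0,y0,z0) \<in> lattice_points P" "(x1,y1,z1) \<in> lattice_points P"
      "(x2,y2,z2) \<in> lattice_points P" "(x3,y3,z3) \<in> lattice_points P"
    and c: "0 \<le> c0" "0 \<le> c1" "0 \<le> c2" "0 \<le> c3" and N: "N = c0 + c1 + c2 + c3" "0 < N"
    and eq: "N * x = c0 * x0 + c1 * x1 + c2 * x2 + c3 * x3"
      "N * y = c0 * y0 + c1 * y1 + c2 * y2 + c3 * y3"
      "N * z = c0 * z0 + c1 * z1 + c2 * z2 + c3 * z3"
  shows "(x,y,z) \<in> lattice_points P"
proof -
  define d where "d i = (of_int ([c0,c1,c2,c3] ! i) / of_int N :: real)" for i
  define q where "q i = ipt ([(x0,y0,z0),(x1,y1,z1),(x2,y2,z2),(x3,y3,z3)] ! i)" for i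
  have *: "sum f {0,1,2,3::nat} = f 0 + f 1 + f 2 + f 3" for f :: "nat \<Rightarrow> 'b::comm_monoid_add"
    by (simp add: add.assoc)
  have q: "q i \<in> P" if "i \<in> {0,1,2,3}" for i
    using that p unfolding q_def lattice_points_def by auto
  have d: "0 \<le> d i" if "i \<in> {0,1,2,3}" for i
    using that c N unfolding d_def by auto
  have s: "sum d {0,1,2,3} = 1" unfolding * d_def using N by (simp add: field_simps flip: of_int_add)
  have R: "real_of_int N * real_of_int u = of_int c0 * of_int u0 + of_int c1 * of_int u1 + of_int c2 * of_int u2 + of_int c3 * of_int u3"
    if "N * u = c0 * u0 + c1 * u1 + c2 * u2 + c3 * u3" for u u0 u1 u2 u3
    using arg_cong[OF that, of real_of_int] by simp
  have "ipt (x,y,z) = (\<Sum>i\<in>{0,1,2,3}. d i *\<^sub>R q i)"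
  proof -
    have K: "real_of_int u = of_int c0 / of_int N * of_int u0 + of_int c1 / of_int N * of_int u1
        + of_int c2 / of_int N * of_int u2 + of_int c3 / of_int N * of_int u3"
      if "N * u = c0 * u0 + c1 * u1 + c2 * u2 + c3 * u3" for u u0 u1 u2 u3
    proof -
      have "real_of_int u = (real_of_int N * real_of_int u) / of_int N" using N(2) by simp
      then show ?thesis unfolding R[OF that] by (simp add: add_divide_distrib)
    qed
    show ?thesis unfolding * d_def q_def using K[OF eq(1)] K[OF eq(2)] K[OF eq(3)]
      by (simp add: vec_eq_iff forall_3)
  qed
  also have "\<dots> \<in> P" by (rule convex_sum[OF _ P s d q]) simp
  finally show ?thesis unfolding lattice_points_def by simp
qed

text \<open>A polytope is the hull of its vertices, and three points span at most a plane.\<close>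

lemma another_vertex:
  assumes "lattice_polytope P" "aff_dim P = 3" "finite E" "card E \<le> 3"
  obtains v where "ipt v extreme_point_of P" "v \<notin> E"
proof (rule ccontr)
  assume contra: "\<not> thesis"
  note outer = that
  have "x \<in> ipt ` E" if x: "x extreme_point_of P" for x
  proof -
    obtain v where "x = ipt v" using extreme_point_lattice[OF assms(1) x] by blast
    then show ?thesis using outer[of v] contra x by auto
  qed
  then have sub: "{x. x extreme_point_of P} \<subseteq> ipt ` E" by blast
  have "P = convex hull {x. x extreme_point_of P}"
    using Krein_Milman_Minkowski lattice_polytope_compact lattice_polytope_convex assms(1) by blast
  then have "aff_dim P \<le> aff_dim (ipt ` E)"
    using sub by (metis aff_dim_convex_hull aff_dim_subset)
  also have "\<dots> \<le> int (card (ipt ` E)) - 1" using assms(3) by (intro aff_dim_le_card) auto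
  also have "card (ipt ` E) = card E" using inj_ipt by (simp add: card_image inj_on_def)
  finally show False using assms by simp
qed

text \<open>The hyperplane supplied by the dimension count has only a real normal. A nonzero cross
  product of two lattice differences is an integral one; collinear sets and single points are
  treated separately.\<close>

lemma integer_normal:
  assumes "aff_dim (convex hull (ipt ` M)) \<noteq> 3"
  obtains n c where "n \<noteq> (0,0,0)" "\<And>p. p \<in> M \<Longrightarrow> ev n p = c"
proof -
  have "aff_dim (ipt ` M) < int DIM(real^3)"
    using assms aff_dim_le_DIM[of "ipt ` M"] by (simp add: aff_dim_convex_hull)
  then obtain u r where u: "u \<noteq> 0" "ipt ` M \<subseteq> {x. u \<bullet> x = r}" by (rule aff_lowdim_subset_hyperplane)
  define A B C where "A = u $ 1" and "B = u $ 2" and "C = u $ 3"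
  have nz: "A \<noteq> 0 \<or> B \<noteq> 0 \<or> C \<noteq> 0" using u(1) unfolding A_def B_def C_def by (auto simp: vec_eq_iff forall_3)
  have eq: "A * of_int x + B * of_int y + C * of_int z = r" if "(x,y,z) \<in> M" for x y z
    using u(2) that unfolding A_def B_def C_def by (force simp: inner_vec_def sum_3)
  show ?thesis
  proof (cases "M = {}")
    case True
    then show ?thesis using that[of "(1,0,0)"] by auto
  next
    case False
    then obtain x0 y0 z0 where p0: "(x0,y0,z0) \<in> M" by auto
    define D where "D x1 y1 z1 x2 y2 z2 = ((y1-y0)*(z2-z0)-(z1-z0)*(y2-y0), (z1-z0)*(x2-x0)-(x1-x0)*(z2-z0), (x1-x0)*(y2-y0)-(y1-y0)*(x2-x0))"
      for x1 y1 z1 x2 y2 z2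
    show ?thesis
    proof (cases "\<exists>x1 y1 z1 x2 y2 z2. (x1,y1,z1) \<in> M \<and> (x2,y2,z2) \<in> M \<and> D x1 y1 z1 x2 y2 z2 \<noteq> (0,0,0)")
      case True
      then obtain x1 y1 z1 x2 y2 z2 where p: "(x1,y1,z1) \<in> M" "(x2,y2,z2) \<in> M" and D: "D x1 y1 z1 x2 y2 z2 \<noteq> (0,0,0)" by blast
      have "ev (D x1 y1 z1 x2 y2 z2) p = ev (D x1 y1 z1 x2 y2 z2) (x0,y0,z0)" if "p \<in> M" for p
      proof -
        obtain x y z where xyz: "p = (x,y,z)" by (metis prod_cases3)
        have e: "A * of_int (x1-x0) + B * of_int (y1-y0) + C * of_int (z1-z0) = 0"
          "A * of_int (x2-x0) + B * of_int (y2-y0) + C * of_int (z2-z0) = 0"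
          "A * of_int (x-x0) + B * of_int (y-y0) + C * of_int (z-z0) = 0"
          using eq[OF p0] eq[OF p(1)] eq[OF p(2)] eq[OF that[unfolded xyz]] by (auto simp: algebra_simps)
        define a1 b1 c1 a2 b2 c2 a b c where "a1 = x1-x0" "b1 = y1-y0" "c1 = z1-z0" "a2 = x2-x0" "b2 = y2-y0" "c2 = z2-z0"
          "a = x-x0" "b = y-y0" "c = z-z0"
        note defs = this
        \<comment> \<open>The determinant of three differences. They share a nonzero real normal, so
          it vanishes.\<close>
        define E where "E = (b1*c2-c1*b2)*a + (c1*a2-a1*c2)*b + (a1*b2-b1*a2)*c"
        have "A * of_int E = 0" "B * of_int E = 0" "C * of_int E = 0"
          using e unfolding E_def defs[symmetric] by (simp_all, algebra+)
        then have "E = 0" using nz by auto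
        then show ?thesis unfolding E_def D_def xyz defs by (simp add: algebra_simps)
      qed
      then show ?thesis using that D by blast
    next
      case False
      then have F: "D x1 y1 z1 x2 y2 z2 = (0,0,0)" if "(x1,y1,z1) \<in> M" "(x2,y2,z2) \<in> M" for x1 y1 z1 x2 y2 z2
        using that by blast
      show ?thesis
      proof (cases "\<exists>x1 y1 z1. (x1,y1,z1) \<in> M \<and> (x1,y1,z1) \<noteq> (x0,y0,z0)")
        case True
        then obtain x1 y1 z1 where p1: "(x1,y1,z1) \<in> M" "(x1,y1,z1) \<noteq> (x0,y0,z0)" by blast
        \<comment> \<open>All points lie on one line here. The horizontal part of its direction is
          turned by a right angle; a vertical line takes the first axis.\<close>
        define n :: ipoint where "n = (if (x1,y1) = (x0,y0) then (1,0,0) else (y1-y0,x0-x1,0))"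
        have "ev n p = ev n (x0,y0,z0)" if "p \<in> M" for p
        proof -
          obtain x y z where xyz: "p = (x,y,z)" by (metis prod_cases3)
          have f: "(z1-z0)*(x-x0)-(x1-x0)*(z-z0) = 0" "(x1-x0)*(y-y0)-(y1-y0)*(x-x0) = 0"
            using F[OF p1(1) that[unfolded xyz]] unfolding D_def by simp_all
          show ?thesis
          proof (cases "(x1,y1) = (x0,y0)")
            case True
            then have "x = x0" using f(1) p1(2) by auto
            then show ?thesis using True by (simp add: n_def xyz)
          next
            case False
            then show ?thesis using f(2) by (auto simp: n_def xyz algebra_simps)
          qed
        qed
        moreover have "n \<noteq> (0,0,0)" unfolding n_def by auto
        ultimately show ?thesis using that by blast
      next
        case False
        then show ?thesis using that[of "(1,0,0)" x0] by auto
      qed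
    qed
  qed
qed

lemma full_dimensional:
  assumes "\<And>n. n \<noteq> (0,0,0) \<Longrightarrow> \<exists>p\<in>M. \<exists>q\<in>M. ev n p \<noteq> ev n q"
  shows "aff_dim (convex hull (ipt ` M)) = 3"
  using integer_normal assms by metis

section \<open>Critical pairs of vertices\<close>

fun frame :: "ipoint \<Rightarrow> ipoint \<Rightarrow> ipoint \<Rightarrow> ipoint \<Rightarrow> ipoint \<Rightarrow> ipoint" where
  "frame (o1,o2,o3) (a1,a2,a3) (b1,b2,b3) (c1,c2,c3) (x,y,z) =
    (o1 + a1*x + b1*y + c1*z, o2 + a2*x + b2*y + c2*z, o3 + a3*x + b3*y + c3*z)"

fun idet :: "ipoint \<Rightarrow> ipoint \<Rightarrow> ipoint \<Rightarrow> int" where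
  "idet (a1,a2,a3) (b1,b2,b3) (c1,c2,c3) =
    a1*(b2*c3-b3*c2) - b1*(a2*c3-a3*c2) + c1*(a2*b3-a3*b2)"

text \<open>The determinant is its own inverse, so Cramer's rule multiplies by \<open>D\<close>
  instead of dividing and yields integer preimages.\<close>

lemma frame_unimodular:
  assumes "(idet a b c)\<^sup>2 = 1"
  obtains t where "unimodular_map t" "\<And>p. t (ipt p) = ipt (frame o' a b c p)"
proof -
  obtain o1 o2 o3 where o: "o' = (o1,o2,o3)" by (metis prod_cases3)
  obtain a1 a2 a3 where a: "a = (a1,a2,a3)" by (metis prod_cases3)
  obtain b1 b2 b3 where b: "b = (b1,b2,b3)" by (metis prod_cases3)
  obtain c1 c2 c3 where c: "c = (c1,c2,c3)" by (metis prod_cases3)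
  define D where "D = idet a b c"
  have DD: "D * D = 1" using assms by (simp add: D_def power2_eq_square)
  define L :: "real^3 \<Rightarrow> real^3" where "L x = x $ 1 *\<^sub>R ipt a + x $ 2 *\<^sub>R ipt b + x $ 3 *\<^sub>R ipt c" for x
  define t where "t x = L x + ipt o'" for x
  have L: "linear L" unfolding L_def by (rule linearI) (simp_all add: algebra_simps)
  have tp: "t (ipt p) = ipt (frame o' a b c p)" for p
    unfolding t_def L_def o a b c by (cases p) (simp add: vec_eq_iff forall_3 algebra_simps)
  have "t ` int_lattice = int_lattice"
  proof
    show "t ` int_lattice \<subseteq> int_lattice" unfolding range_ipt[symmetric] using tp by auto
    show "int_lattice \<subseteq> t ` int_lattice"
    proof
      fix y :: "real^3" assume "y \<in> int_lattice"
      then obtain p where y: "y = ipt p" unfolding range_ipt[symmetric] by blast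
      obtain y1 y2 y3 where p: "p = (y1,y2,y3)" by (metis prod_cases3)
      define u1 u2 u3 where "u1 = y1 - o1" "u2 = y2 - o2" "u3 = y3 - o3"
      define q where "q = (D * (u1*(b2*c3-b3*c2) - b1*(u2*c3-u3*c2) + c1*(u2*b3-u3*b2)),
        D * (a1*(u2*c3-u3*c2) - u1*(a2*c3-a3*c2) + c1*(a2*u3-a3*u2)),
        D * (a1*(b2*u3-b3*u2) - b1*(a2*u3-a3*u2) + u1*(a2*b3-a3*b2)))"
      have "a1 * fst q + b1 * fst (snd q) + c1 * snd (snd q) = (D * D) * u1"
        "a2 * fst q + b2 * fst (snd q) + c2 * snd (snd q) = (D * D) * u2"
        "a3 * fst q + b3 * fst (snd q) + c3 * snd (snd q) = (D * D) * u3"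
        unfolding q_def D_def a b c by (simp_all, algebra+)
      then have "frame o' a b c q = p" unfolding DD p o a b c u1_u2_u3_def
        by (cases q) simp
      then have "y = t (ipt q)" unfolding tp y by simp
      then show "y \<in> t ` int_lattice" by simp
    qed
  qed
  moreover have "affine_map t" unfolding affine_map_def t_def using L by blast
  ultimately have "unimodular_map t" by unfold_locales
  then show ?thesis using that tp by blast
qed

text \<open>The configuration to be classified: a lattice 3-polytope that is neither quasi-minimal
  nor merged has two such vertices.\<close>

definition critical :: "(real ^ 3) set \<Rightarrow> ipoint \<Rightarrow> ipoint \<Rightarrow> bool" where
  "critical P v w \<longleftrightarrow> lattice_polytope P \<and> aff_dim P = 3 \<and> \<not> merged P \<and> v \<noteq> w \<and>
    ipt v extreme_point_of P \<and> ipt w extreme_point_of P \<and>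
    width (delete_vertex P (ipt v)) > 1 \<and> width (delete_vertex P (ipt w)) > 1"

definition exceptional :: "(real ^ 3) set \<Rightarrow> bool" where
  "exceptional P \<longleftrightarrow> lattice_size P = 6 \<and> unimodularly_equivalent P exceptional_polytope"

text \<open>Normal forms are reached by writing \<open>P\<close> in the coordinates of a lattice
  frame: \<open>P'\<close> is the preimage, and the conclusion \<open>exceptional\<close> is handed
  back to \<open>P\<close>.\<close>

lemma transport:
  assumes crit: "critical P v w" and det: "(idet a b c)\<^sup>2 = 1"
  obtains P' v' w' where "critical P' v' w'" "\<And>p. p = v' \<longleftrightarrow> frame o' a b c p = v" "\<And>p. p = w' \<longleftrightarrow> frame o' a b c p = w"
    "\<And>p. p \<in> lattice_points P' \<longleftrightarrow> frame o' a b c p \<in> lattice_points P"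
    "exceptional P' \<Longrightarrow> exceptional P"
proof -
  obtain t where t: "unimodular_map t" and tp: "\<And>p. t (ipt p) = ipt (frame o' a b c p)"
    using frame_unimodular[OF det] by metis
  interpret t: unimodular_map t by fact
  interpret i: unimodular_map "inv t" by (rule t.inverse)
  define P' where "P' = inv t ` P"
  have P: "P = t ` P'" unfolding P'_def using t.surj by (simp add: image_f_inv_f)
  have ex: "\<exists>q. frame o' a b c q = p" for p
  proof -
    have "ipt p \<in> t ` range ipt" using t.lattice by (simp add: range_ipt)
    then obtain q where "ipt p = t (ipt q)" by blast
    then show ?thesis unfolding tp by (metis ipt_eq_iff)
  qed
  have fi: "frame o' a b c p = frame o' a b c q \<longleftrightarrow> p = q" for p q
    using tp t.inj by (metis injD ipt_eq_iff)
  from ex obtain v' w' where v: "frame o' a b c v' = v" and w: "frame o' a b c w' = w" by metis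
  have lp: "p \<in> lattice_points P' \<longleftrightarrow> frame o' a b c p \<in> lattice_points P" for p
    using t.inj by (simp add: lattice_points_def P tp[symmetric] inj_image_mem_iff)
  have LP: "lattice_polytope P'" using crit unfolding critical_def P'_def by (auto intro: i.lattice_polytope_image)
  have C: "convex P'" by (rule lattice_polytope_convex[OF LP])
  have crit': "critical P' v' w'"
    using crit LP unfolding critical_def v[symmetric] w[symmetric] tp[symmetric] P
    by (auto simp: t.aff_dim_image t.merged_image C t.extreme_point_image t.delete_vertex_image t.width_image)
  have "exceptional P' \<Longrightarrow> exceptional P"
    unfolding exceptional_def
    by (metis P P'_def t.lattice_size_image i.unimodularly_equivalent_image unimodularly_equivalent_trans)
  then show ?thesis using that[OF crit' _ _ lp] fi[of _ v', unfolded v] fi[of _ w', unfolded w] by blast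
qed

lemma critical_sym: "critical P v w \<Longrightarrow> critical P w v"
  unfolding critical_def by auto

lemma critical_wide:
  assumes "critical P v w"
  shows "wide (lattice_points P - {v})" 
proof -
  have "w \<in> lattice_points P - {v}" "finite (lattice_points P - {v})"
    using assms unfolding critical_def by (auto simp: extreme_point_of_iff finite_lattice_points_polytope)
  then show ?thesis using assms width_gt_one_iff[of "lattice_points P - {v}"]
    unfolding critical_def delete_vertex_eq by auto
qed

lemma delete_two_vertices:
  assumes "lattice_polytope P" "ipt v extreme_point_of P"
  shows "delete_vertex (delete_vertex P (ipt v)) (ipt w) = convex hull (ipt ` (lattice_points P - {v} - {w}))"
  unfolding delete_vertex_eq[of "delete_vertex P (ipt v)"] lattice_points_delete_vertex[OF assms] ..

lemma mergedI:
  assumes "lattice_polytope P" "v \<noteq> w" "ipt v extreme_point_of P" "ipt w extreme_point_of P"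
    "wide (lattice_points P - {v})" "wide (lattice_points P - {w})"
    "\<And>n. n \<noteq> (0,0,0) \<Longrightarrow> \<exists>p\<in>lattice_points P - {v} - {w}. \<exists>q\<in>lattice_points P - {v} - {w}. ev n p \<noteq> ev n q"
  shows "merged P"
proof -
  have "finite (lattice_points P)" "v \<in> lattice_points P" "w \<in> lattice_points P"
    using assms by (auto simp: extreme_point_of_iff finite_lattice_points_polytope)
  then have "width (delete_vertex P (ipt v)) > 1" "width (delete_vertex P (ipt w)) > 1"
    using assms width_gt_one_iff[of "lattice_points P - {v}"] width_gt_one_iff[of "lattice_points P - {w}"]
    unfolding delete_vertex_eq by auto
  moreover have "aff_dim (delete_vertex (delete_vertex P (ipt v)) (ipt w)) = int CARD(3)"
    unfolding delete_two_vertices[OF assms(1,3)] using full_dimensional[OF assms(7)] by simp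
  ultimately show ?thesis unfolding merged_def using assms by (intro exI[of _ "ipt v"] exI[of _ "ipt w"]) auto
qed

lemma critical_normal:
  assumes "critical P v w"
  obtains n c where "n \<noteq> (0,0,0)" "\<And>p. p \<in> lattice_points P - {v} - {w} \<Longrightarrow> ev n p = c"
proof -
  have "aff_dim (convex hull (ipt ` (lattice_points P - {v} - {w}))) \<noteq> 3"
  proof
    assume "aff_dim (convex hull (ipt ` (lattice_points P - {v} - {w}))) = 3"
    then have "merged P" unfolding merged_def using assms
      by (intro exI[of _ "ipt v"] exI[of _ "ipt w"]) (auto simp: critical_def delete_two_vertices)
    then show False using assms unfolding critical_def by simp
  qed
  then show ?thesis using integer_normal that by metis
qed

text \<open>A unimodular column operation turning the row \<open>(m, n)\<close> into
  \<open>(0, g)\<close>. The last clause keeps a nonzero normal nonzero.\<close>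

lemma bezout_matrix:
  obtains r s t u g :: int where "r * u - s * t = 1" "m * r + n * t = 0" "m * s + n * u = g" "g = 0 \<Longrightarrow> m = 0 \<and> n = 0"
proof (cases "m = 0 \<and> n = 0")
  case True
  then show ?thesis using that[of 1 1 0 0 0] by simp
next
  case False
  define g where "g = gcd m n"
  have g: "g \<noteq> 0" using False by (simp add: g_def)
  obtain m' n' where mn: "m = g * m'" "n = g * n'" unfolding g_def by (metis dvdE gcd_dvd1 gcd_dvd2)
  obtain s u where su: "s * m + u * n = g" unfolding g_def using bezout_int by blast
  then have "g * (s * m' + u * n') = g * 1" unfolding mn by (simp add: algebra_simps)
  then have 1: "s * m' + u * n' = 1" using g by simp
  show ?thesis by (rule that[of n' u s "-m'" g]) (use 1 su mn g in \<open>auto simp: algebra_simps\<close>)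
qed

text \<open>Two Bezout steps carry the normal to \<open>(0, g, n3)\<close> and then to
  \<open>(0, 0, h)\<close>. Any remaining lattice point satisfies \<open>h * z = d\<close>, so the
  division in the final translation by \<open>d div h\<close> is exact.\<close>

lemma critical_flat:
  assumes "critical P v w"
  obtains P' v' w' where "critical P' v' w'" "\<And>x y z. (x,y,z) \<in> lattice_points P' - {v'} - {w'} \<Longrightarrow> z = 0"
    "exceptional P' \<Longrightarrow> exceptional P"
proof -
  obtain n0 d where n0: "n0 \<noteq> (0,0,0)" "\<And>p. p \<in> lattice_points P - {v} - {w} \<Longrightarrow> ev n0 p = d"
    using critical_normal[OF assms] by metis
  obtain n1 n2 n3 where n: "n0 = (n1,n2,n3)" by (metis prod_cases3)
  obtain r s t u g where A: "r * u - s * t = 1" "n1 * r + n2 * t = 0" "n1 * s + n2 * u = g" "g = 0 \<Longrightarrow> n1 = 0 \<and> n2 = 0"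
    by (rule bezout_matrix[of n1 n2]) blast
  have "(idet (r,t,0) (s,u,0) (0,0,1))\<^sup>2 = 1" using A(1) by (simp add: algebra_simps)
  then obtain P1 v1 w1 where 1: "critical P1 v1 w1"
    and f1: "\<And>p. p = v1 \<longleftrightarrow> frame (0,0,0) (r,t,0) (s,u,0) (0,0,1) p = v"
    "\<And>p. p = w1 \<longleftrightarrow> frame (0,0,0) (r,t,0) (s,u,0) (0,0,1) p = w"
    "\<And>p. p \<in> lattice_points P1 \<longleftrightarrow> frame (0,0,0) (r,t,0) (s,u,0) (0,0,1) p \<in> lattice_points P"
    "exceptional P1 \<Longrightarrow> exceptional P"
    using transport[OF assms, of "(r,t,0)" "(s,u,0)" "(0,0,1)" "(0,0,0)"] by blast
  have e1: "g * y + n3 * z = d" if p: "(x,y,z) \<in> lattice_points P1 - {v1} - {w1}" for x y z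
  proof -
    have "frame (0,0,0) (r,t,0) (s,u,0) (0,0,1) (x,y,z) \<in> lattice_points P - {v} - {w}"
      using p f1(1,2)[of "(x,y,z)"] f1(3)[of "(x,y,z)"] by blast
    from n0(2)[OF this] have "(n1 * r + n2 * t) * x + (n1 * s + n2 * u) * y + n3 * z = d"
      unfolding n by (simp add: algebra_simps)
    then show ?thesis unfolding A by simp
  qed
  obtain r' s' t' u' h where B: "r' * u' - s' * t' = 1" "g * r' + n3 * t' = 0" "g * s' + n3 * u' = h" "h = 0 \<Longrightarrow> g = 0 \<and> n3 = 0"
    by (rule bezout_matrix[of g n3]) blast
  have h: "h \<noteq> 0" using B(4) A(4) n0(1) unfolding n by auto
  have "(idet (1,0,0) (0,r',t') (0,s',u'))\<^sup>2 = 1" using B(1) by (simp add: algebra_simps)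
  then obtain P2 v2 w2 where 2: "critical P2 v2 w2"
    and f2: "\<And>p. p = v2 \<longleftrightarrow> frame (0,0,0) (1,0,0) (0,r',t') (0,s',u') p = v1"
    "\<And>p. p = w2 \<longleftrightarrow> frame (0,0,0) (1,0,0) (0,r',t') (0,s',u') p = w1"
    "\<And>p. p \<in> lattice_points P2 \<longleftrightarrow> frame (0,0,0) (1,0,0) (0,r',t') (0,s',u') p \<in> lattice_points P1"
    "exceptional P2 \<Longrightarrow> exceptional P1"
    using transport[OF 1, of "(1,0,0)" "(0,r',t')" "(0,s',u')" "(0,0,0)"] by blast
  have e2: "h * z = d" if p: "(x,y,z) \<in> lattice_points P2 - {v2} - {w2}" for x y z
  proof -
    have "frame (0,0,0) (1,0,0) (0,r',t') (0,s',u') (x,y,z) \<in> lattice_points P1 - {v1} - {w1}"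
      using p f2(1,2)[of "(x,y,z)"] f2(3)[of "(x,y,z)"] by blast
    then have "g * (r' * y + s' * z) + n3 * (t' * y + u' * z) = d" using e1 by simp
    then have "(g * r' + n3 * t') * y + (g * s' + n3 * u') * z = d" by (simp add: algebra_simps)
    then show ?thesis unfolding B by simp
  qed
  have "(idet (1,0,0) (0,1,0) (0,0,1))\<^sup>2 = 1" by simp
  then obtain P3 v3 w3 where 3: "critical P3 v3 w3"
    and f3: "\<And>p. p = v3 \<longleftrightarrow> frame (0,0,d div h) (1,0,0) (0,1,0) (0,0,1) p = v2"
    "\<And>p. p = w3 \<longleftrightarrow> frame (0,0,d div h) (1,0,0) (0,1,0) (0,0,1) p = w2"
    "\<And>p. p \<in> lattice_points P3 \<longleftrightarrow> frame (0,0,d div h) (1,0,0) (0,1,0) (0,0,1) p \<in> lattice_points P2"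
    "exceptional P3 \<Longrightarrow> exceptional P2"
    using transport[OF 2, of "(1,0,0)" "(0,1,0)" "(0,0,1)" "(0,0,d div h)"] by blast
  have "z = 0" if p: "(x,y,z) \<in> lattice_points P3 - {v3} - {w3}" for x y z
  proof -
    have "frame (0,0,d div h) (1,0,0) (0,1,0) (0,0,1) (x,y,z) \<in> lattice_points P2 - {v2} - {w2}"
      using p f3(1,2)[of "(x,y,z)"] f3(3)[of "(x,y,z)"] by blast
    then have "h * (d div h + z) = d" using e2 by simp
    then have "d div h = d div h + z" using h by (metis nonzero_mult_div_cancel_left)
    then show ?thesis by simp
  qed
  then show ?thesis using that[OF 3] f1(4)[OF f2(4)[OF f3(4)]] by blast
qed

section \<open>Two apexes over a common plane\<close>

definition plane_points :: "(real ^ 3) set \<Rightarrow> (int \<times> int) set" where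
  "plane_points P = {(x,y). (x,y,0) \<in> lattice_points P}"

lemma plane_points_iff: "(x,y) \<in> plane_points P \<longleftrightarrow> (x,y,0) \<in> lattice_points P"
  by (simp add: plane_points_def)

lemma plane_points_convex: "convex P \<Longrightarrow> lattice_convex2 (plane_points P)"
proof
  fix x0 y0 x1 y1 x2 y2 c0 c1 c2 x y
  assume P: "convex P" and p: "(x0,y0) \<in> plane_points P" "(x1,y1) \<in> plane_points P" "(x2,y2) \<in> plane_points P"
    and c: "0 \<le> c0" "0 \<le> c1" "0 \<le> c2" "0 < c0 + c1 + c2"
    and xy: "(c0 + c1 + c2) * x = c0 * x0 + c1 * x1 + c2 * x2" "(c0 + c1 + c2) * y = c0 * y0 + c1 * y1 + c2 * y2"
  show "(x,y) \<in> plane_points P" unfolding plane_points_iff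
    by (rule lattice_points_conv[OF P p[unfolded plane_points_iff] p(3)[unfolded plane_points_iff] c(1,2,3) order_refl _ c(4)])
      (simp_all only: xy mult_zero_left mult_zero_right add_0_right)
qed

lemma not_wide_if_two_values:
  assumes "wide L" "n \<noteq> (0,0,0)" "\<And>p. p \<in> L \<Longrightarrow> ev n p = c \<or> ev n p = c + 1"
  shows False
proof -
  obtain p q where pq: "p \<in> L" "q \<in> L" "ev n p - ev n q \<ge> 2" using assms(1,2) unfolding wide_def by metis
  then show False using assms(3)[OF pq(1)] assms(3)[OF pq(2)] by linarith
qed

text \<open>The unprimed point is the apex that remains when the primed one is deleted. Facts are
  stated for this pyramid, and \<open>swap\<close> supplies the other.\<close>

locale flat_pair =
  fixes P :: "(real ^ 3) set" and a b k a' b' k' :: int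
  assumes crit: "critical P (a',b',k') (a,b,k)"
    and flat: "\<And>x y z. (x,y,z) \<in> lattice_points P - {(a',b',k')} - {(a,b,k)} \<Longrightarrow> z = 0"
begin

lemma swap: "flat_pair P a' b' k' a b k"
  by unfold_locales (use critical_sym[OF crit] flat in blast)+

lemma polytope: "lattice_polytope P" and dim: "aff_dim P = 3" and not_merged: "\<not> merged P"
  and apexes_distinct: "(a',b',k') \<noteq> (a,b,k)"
  and extreme': "ipt (a',b',k') extreme_point_of P" and extreme: "ipt (a,b,k) extreme_point_of P"
  using crit unfolding critical_def by auto

lemma convex: "convex P"
  by (rule lattice_polytope_convex[OF polytope])

lemma apex_in: "(a,b,k) \<in> lattice_points P" "(a',b',k') \<in> lattice_points P"
  using extreme_point_of_iff[OF polytope] extreme extreme' by blast+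

lemma wide_apex: "wide (lattice_points P - {(a',b',k')})"
  by (rule critical_wide[OF crit])

text \<open>Otherwise the third coordinate takes at most two consecutive values on the
  pyramid.\<close>

lemma height: "2 \<le> \<bar>k\<bar>"
proof (rule ccontr)
  assume "\<not> 2 \<le> \<bar>k\<bar>"
  then have k: "k = 0 \<or> k = 1 \<or> k = -1" by auto
  have z: "z = 0 \<or> z = k" if "(x,y,z) \<in> lattice_points P - {(a',b',k')}" for x y z
    using flat[of x y z] that by auto
  show False
  proof (rule not_wide_if_two_values[OF wide_apex, of "(0,0,1)" "min 0 k"])
    fix p assume p: "p \<in> lattice_points P - {(a',b',k')}"
    obtain x y u where xyz: "p = (x,y,u)" by (metis prod_cases3)
    show "ev (0,0,1) p = min 0 k \<or> ev (0,0,1) p = min 0 k + 1"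
      using z[OF p[unfolded xyz]] k unfolding xyz by auto
  qed simp
qed

end

context flat_pair
begin

lemma height': "2 \<le> \<bar>k'\<bar>"
  using flat_pair.height[OF swap] .

lemma lattice_points_iff:
  "(x,y,z) \<in> lattice_points P \<longleftrightarrow> (z = 0 \<and> (x,y) \<in> plane_points P) \<or> (x,y,z) = (a,b,k) \<or> (x,y,z) = (a',b',k')"
  using flat[of x y z] apex_in unfolding plane_points_iff by blast

lemma lattice_points_minus_apex:
  "(x,y,z) \<in> lattice_points P - {(a',b',k')} \<longleftrightarrow> (z = 0 \<and> (x,y) \<in> plane_points P) \<or> (x,y,z) = (a,b,k)"
  unfolding Diff_iff lattice_points_iff using height' apexes_distinct by auto

lemma not_thin:
  assumes "n \<noteq> (0,0,0)" "ev n (a,b,k) = c \<or> ev n (a,b,k) = c + 1"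
    and "\<And>x y. (x,y) \<in> plane_points P \<Longrightarrow> ev n (x,y,0) = c \<or> ev n (x,y,0) = c + 1"
  shows False
proof (rule not_wide_if_two_values[OF wide_apex assms(1)])
  fix p assume p: "p \<in> lattice_points P - {(a',b',k')}"
  obtain x y z where xyz: "p = (x,y,z)" by (metis prod_cases3)
  show "ev n p = c \<or> ev n p = c + 1"
    using p assms(2,3) unfolding xyz lattice_points_minus_apex by auto
qed

sublocale lattice_convex2 "plane_points P"
  by (rule plane_points_convex[OF convex])

sublocale lattice_pyramid "plane_points P" a b "\<bar>k\<bar>"
proof
  show "2 \<le> \<bar>k\<bar>" by (rule height)
  fix x0 y0 x1 y1 x2 y2 c0 c1 c2 j x y
  assume S: "(x0,y0) \<in> plane_points P" "(x1,y1) \<in> plane_points P" "(x2,y2) \<in> plane_points P"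
    and c: "0 \<le> c0" "0 \<le> c1" "0 \<le> c2" "0 < j" "j < \<bar>k\<bar>" "c0 + c1 + c2 + j = \<bar>k\<bar>"
    and xy: "\<bar>k\<bar> * x = c0 * x0 + c1 * x1 + c2 * x2 + j * a" "\<bar>k\<bar> * y = c0 * y0 + c1 * y1 + c2 * y2 + j * b"
  let ?Q = "delete_vertex P (ipt (a',b',k'))"
  have L: "lattice_points ?Q = lattice_points P - {(a',b',k')}"
    by (rule lattice_points_delete_vertex[OF polytope extreme'])
  have in_Q: "(x0,y0,0) \<in> lattice_points ?Q" "(x1,y1,0) \<in> lattice_points ?Q" "(x2,y2,0) \<in> lattice_points ?Q"
    "(a,b,k) \<in> lattice_points ?Q"
    unfolding L lattice_points_minus_apex using S by simp_all
  \<comment> \<open>The apex may lie below the plane, hence the sign: the forbidden point has a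
    height strictly between 0 and \<open>k\<close>.\<close>
  have "\<bar>k\<bar> * (sgn k * j) = j * k" by (simp add: sgn_if)
  then have "(x, y, sgn k * j) \<in> lattice_points ?Q"
    using c by (intro lattice_points_conv[OF convex_delete_vertex in_Q c(1-3) _ _ _ xy]) simp_all
  then have "sgn k * j = 0 \<or> sgn k * j = k" unfolding L lattice_points_minus_apex by auto
  then show False using c height by (auto simp: sgn_if split: if_splits)
qed

lemma noncollinear:
  obtains p1 p2 d1 d2 e1 e2 where "(p1,p2) \<in> plane_points P" "(p1+d1,p2+d2) \<in> plane_points P"
    "(p1+e1,p2+e2) \<in> plane_points P" "d1*e2-d2*e1 \<noteq> 0"
proof (rule ccontr)
  assume contra: "\<not> thesis"
  note outer = that
  have "\<exists>p1 p2 d1 d2. (d1,d2) \<noteq> (0,0) \<and> (\<forall>x y. (x,y) \<in> plane_points P \<longrightarrow> d1*(y-p2) = d2*(x-p1))"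
  proof (cases "\<exists>p1 p2 q1 q2. (p1,p2) \<in> plane_points P \<and> (q1,q2) \<in> plane_points P \<and> (p1,p2) \<noteq> (q1,q2)")
    case True
    then obtain p1 p2 q1 q2 where pq: "(p1,p2) \<in> plane_points P" "(q1,q2) \<in> plane_points P" "(p1,p2) \<noteq> (q1,q2)" by blast
    have "(q1-p1)*(y-p2) = (q2-p2)*(x-p1)" if "(x,y) \<in> plane_points P" for x y
      using contra outer[of p1 p2 "q1-p1" "q2-p2" "x-p1" "y-p2"] pq that by auto
    then show ?thesis using pq(3) by (intro exI[of _ p1] exI[of _ p2] exI[of _ "q1-p1"] exI[of _ "q2-p2"]) auto
  next
    case False
    show ?thesis
    proof (cases "plane_points P = {}")
      case True
      then show ?thesis by (intro exI[of _ 1]) auto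
    next
      case F: False
      then obtain p1 p2 where "(p1,p2) \<in> plane_points P" by auto
      with False have "\<And>x y. (x,y) \<in> plane_points P \<Longrightarrow> x = p1 \<and> y = p2" by blast
      then show ?thesis by (intro exI[of _ p1] exI[of _ p2] exI[of _ 1]) auto
    qed
  qed
  then obtain p1 p2 d1 d2 where d: "(d1,d2) \<noteq> (0,0)" "\<And>x y. (x,y) \<in> plane_points P \<Longrightarrow> d1*(y-p2) = d2*(x-p1)" by blast
  show False
  \<comment> \<open>The normal of the plane through the line and the apex, which contains the whole
    pyramid.\<close>
  proof (rule not_thin[of "(d2*k, -d1*k, d1*(b-p2)-d2*(a-p1))" "k*(d2*p1-d1*p2)"])
    show "(d2*k, -d1*k, d1*(b-p2)-d2*(a-p1)) \<noteq> (0,0,0)" using d(1) height by auto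
    show "ev (d2*k, -d1*k, d1*(b-p2)-d2*(a-p1)) (a,b,k) = k*(d2*p1-d1*p2) \<or> ev (d2*k, -d1*k, d1*(b-p2)-d2*(a-p1)) (a,b,k) = k*(d2*p1-d1*p2) + 1"
      by (simp add: algebra_simps)
    fix x y assume "(x,y) \<in> plane_points P"
    then have "k * (d1*(y-p2)) = k * (d2*(x-p1))" using d(2) by simp
    then show "ev (d2*k, -d1*k, d1*(b-p2)-d2*(a-p1)) (x,y,0) = k*(d2*p1-d1*p2) \<or> ev (d2*k, -d1*k, d1*(b-p2)-d2*(a-p1)) (x,y,0) = k*(d2*p1-d1*p2) + 1"
      by (simp add: algebra_simps)
  qed
qed

lemma planar_change:
  assumes det: "(d1*e2-d2*e1)\<^sup>2 = 1"
  obtains P' A B K A' B' K' where "flat_pair P' A B K A' B' K'"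
    "\<And>x y. (x,y) \<in> plane_points P' \<longleftrightarrow> (p1+d1*x+e1*y, p2+d2*x+e2*y) \<in> plane_points P"
    "exceptional P' \<Longrightarrow> exceptional P"
proof -
  let ?f = "frame (p1,p2,0) (d1,d2,0) (e1,e2,0) (0,0,1)"
  have "(idet (d1,d2,0) (e1,e2,0) (0,0,1))\<^sup>2 = 1" using det by (simp add: algebra_simps)
  then obtain P' v' w' where P': "critical P' v' w'" and f: "\<And>p. p = v' \<longleftrightarrow> ?f p = (a',b',k')"
    "\<And>p. p = w' \<longleftrightarrow> ?f p = (a,b,k)"
    "\<And>p. p \<in> lattice_points P' \<longleftrightarrow> ?f p \<in> lattice_points P"
    "exceptional P' \<Longrightarrow> exceptional P"
    using transport[OF crit, of "(d1,d2,0)" "(e1,e2,0)" "(0,0,1)" "(p1,p2,0)"] by blast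
  obtain A' B' K' where v': "v' = (A',B',K')" by (metis prod_cases3)
  obtain A B K where w': "w' = (A,B,K)" by (metis prod_cases3)
  have "flat_pair P' A B K A' B' K'"
  proof
    show "critical P' (A',B',K') (A,B,K)" using P' unfolding v' w' .
    fix x y z assume "(x,y,z) \<in> lattice_points P' - {(A',B',K')} - {(A,B,K)}"
    then have "?f (x,y,z) \<in> lattice_points P - {(a',b',k')} - {(a,b,k)}"
      using f(1,2)[of "(x,y,z)"] f(3)[of "(x,y,z)"] unfolding v' w' by blast
    then show "z = 0" using flat[of "p1+d1*x+e1*y" "p2+d2*x+e2*y" z] by simp
  qed
  moreover have "(x,y) \<in> plane_points P' \<longleftrightarrow> (p1+d1*x+e1*y, p2+d2*x+e2*y) \<in> plane_points P" for x y
    unfolding plane_points_iff f(3) by simp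
  ultimately show ?thesis using that f(4) by blast
qed

end

locale standard_pair = flat_pair +
  assumes origin_in: "(0,0) \<in> plane_points P" and unit1_in: "(1,0) \<in> plane_points P" and unit2_in: "(0,1) \<in> plane_points P"
begin

sublocale standard_pyramid "plane_points P" a b "\<bar>k\<bar>"
  by unfold_locales (rule origin_in unit1_in unit2_in)+

lemma standard_swap: "standard_pair P a' b' k' a b k"
  using swap origin unit1 unit2 by (auto intro!: standard_pair.intro simp: standard_pair_axioms_def)

lemma abs_dvdE: 
  assumes "\<bar>k\<bar> dvd x" obtains q where "x = k * q"
  using assms by (metis abs_dvd_iff dvdE)

text \<open>Each alternative of White's congruence, corrected by a multiple of the height, is a
  functional with values 0 and 1 on the triangle and the apex.\<close>

lemma not_triangle: "plane_points P \<noteq> {(0,0),(1,0),(0,1)}"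
proof
  assume S: "plane_points P = {(0,0),(1,0),(0,1)}"
  consider "\<bar>k\<bar> dvd a - 1" | "\<bar>k\<bar> dvd b - 1" | "\<bar>k\<bar> dvd a + b" using empty_triangle by blast
  then show False
  proof cases
    case 1
    then obtain q where "a - 1 = k * q" by (rule abs_dvdE)
    then show False by (intro not_thin[of "(1,0,-q)" 0]) (auto simp: S algebra_simps)
  next
    case 2
    then obtain q where "b - 1 = k * q" by (rule abs_dvdE)
    then show False by (intro not_thin[of "(0,1,-q)" 0]) (auto simp: S algebra_simps)
  next
    case 3
    then obtain q where "a + b = k * q" by (rule abs_dvdE)
    then show False by (intro not_thin[of "(1,1,-q)" 0]) (auto simp: S algebra_simps)
  qed
qed

end

section \<open>The case of a collinear triple\<close>

lemma lattice_convex_combination_not_extreme: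
  assumes P: "lattice_polytope P" and E: "ipt (x,y,z) extreme_point_of P"
    and p: "(x0,y0,z0) \<in> lattice_points P - {(x,y,z)}" "(x1,y1,z1) \<in> lattice_points P - {(x,y,z)}"
      "(x2,y2,z2) \<in> lattice_points P - {(x,y,z)}"
    and c: "0 \<le> c0" "0 \<le> c1" "0 \<le> c2" "0 < c0 + c1 + c2"
    and eq: "(c0 + c1 + c2) * x = c0 * x0 + c1 * x1 + c2 * x2"
      "(c0 + c1 + c2) * y = c0 * y0 + c1 * y1 + c2 * y2"
      "(c0 + c1 + c2) * z = c0 * z0 + c1 * z1 + c2 * z2"
  shows False
proof -
  have L: "lattice_points (delete_vertex P (ipt (x,y,z))) = lattice_points P - {(x,y,z)}"
    by (rule lattice_points_delete_vertex[OF P E])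
  have "(x,y,z) \<in> lattice_points (delete_vertex P (ipt (x,y,z)))"
    by (rule lattice_points_conv[OF convex_delete_vertex p[folded L] p(3)[folded L] c(1,2,3) order_refl _ c(4)])
      (simp_all only: eq mult_zero_left add_0_right)
  then show False unfolding L by simp
qed

context flat_pair
begin

lemma midpoint_in:
  assumes "2 * x = a + a'" "2 * y = b + b'" "2 * z = k + k'"
  shows "(x,y,z) \<in> lattice_points P"
  by (rule lattice_points_conv[OF convex apex_in apex_in, of 1 1 0 0 2]) (use assms in simp_all)

lemma thin_functionalE:
  assumes "\<not> wide L"
  obtains n1 n2 n3 where "(n1,n2,n3) \<noteq> (0,0,0)" "\<And>p q. p \<in> L \<Longrightarrow> q \<in> L \<Longrightarrow> ev (n1,n2,n3) p - ev (n1,n2,n3) q \<le> 1"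
proof -
  obtain n where n: "n \<noteq> (0,0,0)" "\<And>p q. p \<in> L \<Longrightarrow> q \<in> L \<Longrightarrow> \<not> ev n p - ev n q \<ge> 2"
    using assms unfolding wide_def by blast
  obtain n1 n2 n3 where n': "n = (n1,n2,n3)" by (metis prod_cases3)
  have "ev (n1,n2,n3) p - ev (n1,n2,n3) q \<le> 1" if "p \<in> L" "q \<in> L" for p q
    using n(2)[OF that] unfolding n' by linarith
  with n(1) show ?thesis unfolding n' by (rule that)
qed

end

locale collinear_pair = standard_pair +
  assumes minus1_in: "(-1,0) \<in> plane_points P"
begin

sublocale collinear_pyramid "plane_points P" a b "\<bar>k\<bar>"
  by unfold_locales (rule minus1_in)

lemma collinear_swap: "collinear_pair P a' b' k' a b k"
  using standard_swap minus1 by (auto intro!: collinear_pair.intro simp: collinear_pair_axioms_def)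

lemma off_strip_point: obtains x y where "(x,y) \<in> plane_points P" "y \<noteq> 0" "y \<noteq> 1"
proof (rule ccontr)
  assume contra: "\<not> thesis"
  obtain q where q: "b - 1 = k * q" using height_cong by (rule abs_dvdE)
  show False
  proof (rule not_thin[of "(0,1,-q)" 0])
    fix x y assume "(x,y) \<in> plane_points P"
    then show "ev (0,1,-q) (x,y,0) = 0 \<or> ev (0,1,-q) (x,y,0) = 0 + 1" using contra that by auto
  qed (use q in \<open>auto simp: algebra_simps\<close>)
qed

lemma apex_parity: "\<bar>k\<bar> = 2" "odd a" "odd b"
proof -
  obtain x y where "(x,y) \<in> plane_points P" "y \<noteq> 0" "y \<noteq> 1" by (rule off_strip_point)
  then show k: "\<bar>k\<bar> = 2" by (rule height_two)
  show "odd a" "odd b" using coprime_apex unfolding k by (simp_all add: coprime_right_2_iff_odd)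
qed

text \<open>The apex has odd plane coordinates and height 2 or -2, so its midpoint with such a point
  would be a lattice point halfway up the pyramid.\<close>

lemma no_odd_point: "(x,y) \<in> plane_points P \<Longrightarrow> odd x \<Longrightarrow> odd y \<Longrightarrow> False"
proof -
  assume p: "(x,y) \<in> plane_points P" "odd x" "odd y"
  then obtain X Y where "x + a = 2 * X" "y + b = 2 * Y" using apex_parity(2,3) by (metis evenE odd_even_add)
  then show False using empty[OF p(1) p(1) p(1), of 1 0 0 1 X Y] unfolding apex_parity(1) by simp
qed

lemma impossible: False
proof -
  interpret swapped: collinear_pair P a' b' k' a b k by (rule collinear_swap)
  have k: "k = 2 \<or> k = -2" and k': "k' = 2 \<or> k' = -2" using apex_parity(1) swapped.apex_parity(1) by linarith+
  obtain m1 m2 where m: "a + a' = 2 * m1" "b + b' = 2 * m2"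
    using apex_parity swapped.apex_parity by (metis evenE odd_even_add)
  \<comment> \<open>At equal heights the midpoint of the apexes would be a third lattice point at
    height \<open>k\<close>.\<close>
  have kk: "k' = - k"
  proof (rule ccontr)
    assume "k' \<noteq> - k"
    then have "k' = k" using k k' by auto
    then have "(m1,m2,k) \<in> lattice_points P" using m by (intro midpoint_in) auto
    then have "(m1,m2) = (a,b) \<or> (m1,m2) = (a',b')" using height unfolding lattice_points_iff by auto
    then have "(a',b',k') = (a,b,k)" using m \<open>k' = k\<close> by auto
    then show False using apexes_distinct by simp
  qed
  have m_in: "(m1,m2) \<in> plane_points P" unfolding plane_points_iff using m kk by (intro midpoint_in) auto
  have m_not: "\<not> ipt (m1,m2,0) extreme_point_of P"
  proof
    assume E: "ipt (m1,m2,0) extreme_point_of P"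
    show False
      by (rule lattice_convex_combination_not_extreme[OF polytope E, of a b k a' b' k' a b k 1 1 0])
        (use apex_in height height' m kk in auto)
  qed
  have origin_not: "\<not> ipt (0,0,0) extreme_point_of P"
  proof
    assume E: "ipt (0,0,0) extreme_point_of P"
    show False
      by (rule lattice_convex_combination_not_extreme[OF polytope E, of 1 0 0 "-1" 0 0 1 0 0 1 1 0])
        (use unit1 minus1 in \<open>auto simp: plane_points_iff\<close>)
  qed
  obtain u1 u2 where u: "(u1,u2) \<in> plane_points P" "u2 \<noteq> 0" "u2 \<noteq> 1" by (rule off_strip_point)
  \<comment> \<open>deleting a vertex in the plane leaves a thin polytope, which forces all other points of the plane
    except the midpoint of the apexes onto one line at distance one from that midpoint\<close>
  have bad: "\<exists>n1 n2 n3. (n1,n2,n3) \<noteq> (0,0,0) \<and> ev (n1,n2,n3) (a,b,k) = n1*m1 + n2*m2 \<and>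
      (\<forall>x y. (x,y) \<in> plane_points P \<longrightarrow> (x,y) \<noteq> (v1,v2) \<longrightarrow> (x,y) \<noteq> (m1,m2) \<longrightarrow> n1*(x-m1) + n2*(y-m2) = 1)"
    if E: "ipt (v1,v2,0) extreme_point_of P" for v1 v2
  proof -
    let ?M = "lattice_points P - {(v1,v2,0)}"
    have v: "(v1,v2) \<noteq> (m1,m2)" "(v1,v2) \<noteq> (0,0)" using E m_not origin_not by auto
    have M: "(x,y,0) \<in> ?M" if "(x,y) \<in> plane_points P" "(x,y) \<noteq> (v1,v2)" for x y
      using that unfolding plane_points_iff by auto
    have M_apex: "(a,b,k) \<in> ?M" "(a',b',k') \<in> ?M" using apex_in height height' by auto
    \<comment> \<open>Without \<open>(v1,v2,0)\<close> and one apex the points still span space. So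
      if deleting \<open>(v1,v2,0)\<close> left a wide set, this vertex and that apex would make
      \<open>P\<close> merged.\<close>
    have full: "\<exists>p\<in>?M - {(a,b,k)}. \<exists>q\<in>?M - {(a,b,k)}. ev n p \<noteq> ev n q" if n: "n \<noteq> (0,0,0)" for n
    proof (rule ccontr)
      assume "\<not> ?thesis"
      then have eq: "ev n p = ev n q" if "p \<in> ?M - {(a,b,k)}" "q \<in> ?M - {(a,b,k)}" for p q using that by blast
      obtain n1 n2 n3 where n': "n = (n1,n2,n3)" by (metis prod_cases3)
      have M0: "(x,y,0) \<in> ?M - {(a,b,k)}" if "(x,y) \<in> plane_points P" "(x,y) \<noteq> (v1,v2)" for x y
        using M[OF that] height by auto
      have z: "n1 * x + n2 * y = 0" if "(x,y) \<in> plane_points P" "(x,y) \<noteq> (v1,v2)" for x y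
        using eq[OF M0[OF that] M0[OF origin]] v unfolding n' by simp
      have n1: "n1 = 0" using z[OF unit1] z[OF minus1] by (cases "(1,0) = (v1,v2)") auto
      have n2: "n2 = 0" using z[OF unit2] z[OF u(1)] u n1 by (cases "(0,1) = (v1,v2)") auto
      have "(a',b',k') \<in> ?M - {(a,b,k)}" using M_apex apexes_distinct by auto
      then have "n3 * k' = 0" using eq[OF _ M0[OF origin], of "(a',b',k')"] v n1 n2 unfolding n' by simp
      then show False using n n1 n2 height' unfolding n' by auto
    qed
    have "\<not> wide ?M"
    proof
      assume W: "wide ?M"
      have "merged P"
        by (rule mergedI[OF polytope _ E extreme W swapped.wide_apex full]) (use height in auto)
      then show False using not_merged by simp
    qed
    then obtain n1 n2 n3 where n: "(n1,n2,n3) \<noteq> (0,0,0)"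
      "\<And>p q. p \<in> ?M \<Longrightarrow> q \<in> ?M \<Longrightarrow> ev (n1,n2,n3) p - ev (n1,n2,n3) q \<le> 1" using thin_functionalE by metis
    \<comment> \<open>The functional is measured from the midpoint: \<open>g\<close> on the plane,
      \<open>h\<close> at the unprimed apex, \<open>- h\<close> at the other. A variation of at most
      one forces \<open>h = 0\<close>.\<close>
    define g where "g x y = n1*(x-m1) + n2*(y-m2)" for x y
    define h where "h = n1*(a-m1) + n2*(b-m2) + n3*k"
    have Mm: "(m1,m2,0) \<in> ?M" using M[OF m_in] v by auto
    have h': "n1*(a'-m1) + n2*(b'-m2) + n3*k' = - h"
    proof -
      have a': "a' = 2 * m1 - a" "b' = 2 * m2 - b" using m by auto
      show ?thesis unfolding h_def kk a' by (simp add: algebra_simps)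
    qed
    have "h = 0"
      using n(2)[OF M_apex(1) M_apex(2)] n(2)[OF M_apex(2) M_apex(1)] h' unfolding h_def by (simp add: algebra_simps)
    then have nk: "n1*(a-m1) + n2*(b-m2) = - n3 * k" unfolding h_def by simp
    then have even: "even (n1*(a-m1) + n2*(b-m2))" using k by auto
    have n12: "(n1,n2) \<noteq> (0,0)" using nk n(1) height by auto
    have g1: "\<bar>g x y - g x' y'\<bar> \<le> 1"
      if "(x,y) \<in> plane_points P" "(x,y) \<noteq> (v1,v2)" "(x',y') \<in> plane_points P" "(x',y') \<noteq> (v1,v2)" for x y x' y'
      using n(2)[OF M[OF that(1,2)] M[OF that(3,4)]] n(2)[OF M[OF that(3,4)] M[OF that(1,2)]]
      unfolding g_def by (simp add: algebra_simps)
    have gm: "g m1 m2 = 0" unfolding g_def by simp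
    have odd_n: "\<exists>x y. g x y = 1 \<or> g x y = -1"
    proof (rule ccontr)
      assume "\<not> ?thesis"
      then have z: "g x y = 0" if "(x,y) \<in> plane_points P" "(x,y) \<noteq> (v1,v2)" for x y
        using g1[OF that m_in] v gm by (smt (verit))
      have z0: "n1 * x + n2 * y = 0" if "(x,y) \<in> plane_points P" "(x,y) \<noteq> (v1,v2)" for x y
        using z[OF that] z[OF origin] v unfolding g_def by (simp add: algebra_simps)
      have n1: "n1 = 0" using z0[OF unit1] z0[OF minus1] by (cases "(1,0) = (v1,v2)") auto
      have n2: "n2 = 0" using z0[OF unit2] z0[OF u(1)] u n1 by (cases "(0,1) = (v1,v2)") auto
      show False using n1 n2 n12 by simp
    qed
    then have cop: "coprime n1 n2"
    proof -
      obtain x y where "g x y = 1 \<or> g x y = -1" using odd_n by blast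
      then show ?thesis unfolding g_def
        by (intro coprimeI) (metis dvd_add dvd_mult2 dvd_minus_iff)
    qed
    \<comment> \<open>A second point on the zero line of \<open>g\<close> brings, by convexity, a
      neighbour of the midpoint in the primitive direction \<open>(- n2, n1)\<close> or its negative
      into the plane set. Since \<open>n1*(a-m1) + n2*(b-m2)\<close> is even with \<open>a\<close>
      and \<open>b\<close> odd, each of the three admissible parities of the midpoint makes both
      coordinates of that neighbour odd.\<close>
    have nonzero: "g x y \<noteq> 0" if p: "(x,y) \<in> plane_points P" "(x,y) \<noteq> (m1,m2)" for x y
    proof
      assume "g x y = 0"
      then have e: "n1*(x-m1) = - n2*(y-m2)" unfolding g_def by simp
      obtain c where c: "x - m1 = - n2 * c" "y - m2 = n1 * c"
      proof (cases "n1 = 0")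
        case True
        then have n2: "n2 = 1 \<or> n2 = -1" using cop by auto
        show ?thesis by (rule that[of "- n2 * (x - m1)"]) (use n2 e True in auto)
      next
        case False
        have "n1 dvd n2 * (y-m2)" using e by (metis dvd_triv_left dvd_minus_iff mult_minus_left)
        then obtain c where c: "y - m2 = n1 * c" using cop by (metis coprime_dvd_mult_right_iff dvdE)
        then have "n1 * (x - m1) = n1 * (- n2 * c)" using e by (simp add: algebra_simps)
        then have "x - m1 = - n2 * c" unfolding mult_cancel_left using False by blast
        then show ?thesis using c by (rule that)
      qed
      define s where "s = sgn c"
      have c0: "c \<noteq> 0" using c p(2) by auto
      then have s: "s = 1 \<or> s = -1" and sc: "\<bar>c\<bar> * s = c" unfolding s_def by (auto simp: sgn_if)
      have x: "\<bar>c\<bar> * (m1 - s * n2) = (\<bar>c\<bar> - 1) * m1 + x" "\<bar>c\<bar> * (m2 + s * n1) = (\<bar>c\<bar> - 1) * m2 + y"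
        using c sc by (simp_all add: algebra_simps)
      have "(m1 - s * n2, m2 + s * n1) \<in> plane_points P"
        by (rule conv[OF m_in m_in p(1), of "\<bar>c\<bar> - 1" 0 1]) (use c0 x in auto)
      then have "\<not> (odd (m1 - s * n2) \<and> odd (m2 + s * n1))" using no_odd_point by blast
      moreover have "\<not> (odd m1 \<and> odd m2)" using no_odd_point[OF m_in] by blast
      moreover have "odd n1 \<or> odd n2" using cop by auto
      moreover have "odd s" using s by auto
      ultimately show False using even apex_parity(2,3) by auto
    qed
    have pm: "g x y = 1 \<or> g x y = -1" if "(x,y) \<in> plane_points P" "(x,y) \<noteq> (v1,v2)" "(x,y) \<noteq> (m1,m2)" for x y
      using nonzero[OF that(1,3)] g1[OF that(1,2) m_in] v gm by auto
    have evw: "ev (n1,n2,n3) (a,b,k) = n1*m1 + n2*m2" using nk by (simp add: algebra_simps)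
    \<comment> \<open>The values 1 and -1 differ by 2, so only one of them occurs; the sign of the
      functional is chosen to make it 1.\<close>
    show ?thesis
    proof (cases "\<forall>x y. (x,y) \<in> plane_points P \<longrightarrow> (x,y) \<noteq> (v1,v2) \<longrightarrow> (x,y) \<noteq> (m1,m2) \<longrightarrow> g x y = 1")
      case True
      then show ?thesis using n(1) evw unfolding g_def by blast
    next
      case False
      then obtain x0 y0 where 0: "(x0,y0) \<in> plane_points P" "(x0,y0) \<noteq> (v1,v2)" "(x0,y0) \<noteq> (m1,m2)" "g x0 y0 \<noteq> 1" by blast
      then have "g x0 y0 = -1" using pm by blast
      then have neg: "g x y = -1" if "(x,y) \<in> plane_points P" "(x,y) \<noteq> (v1,v2)" "(x,y) \<noteq> (m1,m2)" for x y
        using g1[OF that(1,2) 0(1,2)] pm[OF that] by auto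
      have "(- n1)*(x-m1) + (- n2)*(y-m2) = 1" if "(x,y) \<in> plane_points P" "(x,y) \<noteq> (v1,v2)" "(x,y) \<noteq> (m1,m2)" for x y
        using neg[OF that] unfolding g_def by simp
      moreover have "ev (-n1,-n2,-n3) (a,b,k) = (-n1)*m1 + (-n2)*m2" using evw by simp
      moreover have "(-n1,-n2,-n3) \<noteq> (0,0,0)" using n(1) by auto
      ultimately show ?thesis by blast
    qed
  qed
  have flat_vertex: "\<exists>v1 v2. p = (v1,v2,0)" if "ipt p extreme_point_of P" "p \<noteq> (a,b,k)" "p \<noteq> (a',b',k')" for p
  proof -
    obtain x y z where p: "p = (x,y,z)" by (metis prod_cases3)
    show ?thesis using that extreme_point_of_iff[OF polytope, of p] unfolding p lattice_points_iff by auto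
  qed
  obtain v where "ipt v extreme_point_of P" "v \<notin> {(a,b,k),(a',b',k'),(m1,m2,0)}"
    by (rule another_vertex[OF polytope dim, of "{(a,b,k),(a',b',k'),(m1,m2,0)}"]) (auto simp: card_insert_if)
  then obtain v1 v2 where v: "ipt (v1,v2,0) extreme_point_of P" using flat_vertex by blast
  obtain w where "ipt w extreme_point_of P" "w \<notin> {(a,b,k),(a',b',k'),(v1,v2,0)}"
    by (rule another_vertex[OF polytope dim, of "{(a,b,k),(a',b',k'),(v1,v2,0)}"]) (auto simp: card_insert_if)
  then obtain w1 w2 where w: "ipt (w1,w2,0) extreme_point_of P" "(w1,w2) \<noteq> (v1,v2)" using flat_vertex by blast
  obtain n1 n2 n3 where n: "(n1,n2,n3) \<noteq> (0,0,0)" "ev (n1,n2,n3) (a,b,k) = n1*m1 + n2*m2"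
    "\<And>x y. (x,y) \<in> plane_points P \<Longrightarrow> (x,y) \<noteq> (v1,v2) \<Longrightarrow> (x,y) \<noteq> (m1,m2) \<Longrightarrow> n1*(x-m1) + n2*(y-m2) = 1"
    using bad[OF v] by blast
  obtain l1 l2 where l: "\<And>x y. (x,y) \<in> plane_points P \<Longrightarrow> (x,y) \<noteq> (w1,w2) \<Longrightarrow> (x,y) \<noteq> (m1,m2) \<Longrightarrow> l1*(x-m1) + l2*(y-m2) = 1"
    using bad[OF w(1)] by blast
  \<comment> \<open>Removing two vertices and the midpoint from five points leaves two on which both
    line equations hold. Both lines avoid the midpoint, so they coincide and the normals
    agree.\<close>
  let ?T = "{(0,0),(1,0),(-1,0),(0,1),(u1,u2)}"
  have "card ?T = 5" using u by (simp add: card_insert_if)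
  then have "2 \<le> card (?T - {(v1,v2),(w1,w2),(m1,m2)})"
    using diff_card_le_card_Diff[of "{(v1,v2),(w1,w2),(m1,m2)}" ?T] by (simp add: card_insert_if split: if_splits)
  then obtain r t where rt: "r \<in> ?T - {(v1,v2),(w1,w2),(m1,m2)}" "t \<in> ?T - {(v1,v2),(w1,w2),(m1,m2)}" "r \<noteq> t"
    by (meson card_2_iff' ex_card subset_iff)
  have T: "?T \<subseteq> plane_points P" using origin unit1 minus1 unit2 u by auto
  obtain r1 r2 where r: "r = (r1,r2)" by (cases r)
  obtain t1 t2 where t: "t = (t1,t2)" by (cases t)
  have R: "n1*(r1-m1) + n2*(r2-m2) = 1" "l1*(r1-m1) + l2*(r2-m2) = 1"
    "n1*(t1-m1) + n2*(t2-m2) = 1" "l1*(t1-m1) + l2*(t2-m2) = 1"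
  proof -
    have "(r1,r2) \<in> plane_points P" "(t1,t2) \<in> plane_points P" using rt T unfolding r t by blast+
    moreover have "(r1,r2) \<noteq> (v1,v2)" "(r1,r2) \<noteq> (w1,w2)" "(r1,r2) \<noteq> (m1,m2)"
      "(t1,t2) \<noteq> (v1,v2)" "(t1,t2) \<noteq> (w1,w2)" "(t1,t2) \<noteq> (m1,m2)"
      using rt unfolding r t by blast+
    ultimately show "n1*(r1-m1) + n2*(r2-m2) = 1" "l1*(r1-m1) + l2*(r2-m2) = 1"
      "n1*(t1-m1) + n2*(t2-m2) = 1" "l1*(t1-m1) + l2*(t2-m2) = 1"
      by (auto intro: n(3) l)
  qed
  have c: "n1 * l2 = n2 * l1"
  proof -
    have d: "n1*(r1-t1) + n2*(r2-t2) = 0" "l1*(r1-t1) + l2*(r2-t2) = 0"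
      using R by (simp_all add: algebra_simps)
    have "(n1*l2 - n2*l1) * (r1-t1) = l2 * (n1*(r1-t1) + n2*(r2-t2)) - n2 * (l1*(r1-t1) + l2*(r2-t2))"
      "(n1*l2 - n2*l1) * (r2-t2) = n1 * (l1*(r1-t1) + l2*(r2-t2)) - l1 * (n1*(r1-t1) + n2*(r2-t2))"
      by (simp_all add: algebra_simps)
    then have "(n1*l2 - n2*l1) * (r1-t1) = 0" "(n1*l2 - n2*l1) * (r2-t2) = 0" unfolding d by simp_all
    then show ?thesis using rt(3) unfolding r t by auto
  qed
  have "n1 * (l1*(r1-m1) + l2*(r2-m2)) - l1 * (n1*(r1-m1) + n2*(r2-m2)) = (n1*l2 - n2*l1) * (r2-m2)"
    "n2 * (l1*(r1-m1) + l2*(r2-m2)) - l2 * (n1*(r1-m1) + n2*(r2-m2)) = (n2*l1 - n1*l2) * (r1-m1)"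
    by (simp_all add: algebra_simps)
  then have e1: "n1 = l1" and e2: "n2 = l2" unfolding R c by simp_all
  \<comment> \<open>The vertex omitted by the first equation is covered by the second. Thus the apex
    has the same value as the midpoint, and all other plane points have one more.\<close>
  show False
  proof (rule not_thin[OF n(1), of "n1*m1 + n2*m2"])
    show "ev (n1,n2,n3) (a,b,k) = n1*m1 + n2*m2 \<or> ev (n1,n2,n3) (a,b,k) = n1*m1 + n2*m2 + 1" using n(2) by simp
    fix x y assume p: "(x,y) \<in> plane_points P"
    have "(x,y) = (m1,m2) \<or> n1*(x-m1) + n2*(y-m2) = 1"
      using n(3)[OF p] l[OF p] w(2) e1 e2 by (cases "(x,y) = (v1,v2)") auto
    then show "ev (n1,n2,n3) (x,y,0) = n1*m1 + n2*m2 \<or> ev (n1,n2,n3) (x,y,0) = n1*m1 + n2*m2 + 1"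
      by (auto simp: algebra_simps)
  qed
qed

end

section \<open>The case of a centred triangle\<close>

lemma vertex_by_functional:
  assumes P: "lattice_polytope P" and v: "v \<in> lattice_points P"
    and less: "\<And>q. q \<in> lattice_points P \<Longrightarrow> q \<noteq> v \<Longrightarrow> ev n q < ev n v"
  shows "ipt v extreme_point_of P"
proof -
  obtain n1 n2 n3 where n: "n = (n1,n2,n3)" by (metis prod_cases3)
  define u :: "real^3" where "u = vector [of_int n1, of_int n2, of_int n3]"
  have u: "u \<bullet> ipt p = of_int (ev n p)" for p
    unfolding u_def n by (cases p) (simp add: inner_vec_def sum_3)
  have "ipt ` (lattice_points P - {v}) \<subseteq> {x. u \<bullet> x \<le> of_int (ev n v - 1)}"
    using less unfolding image_subset_iff mem_Collect_eq u of_int_le_iff by force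
  then have "delete_vertex P (ipt v) \<subseteq> {x. u \<bullet> x \<le> of_int (ev n v - 1)}"
    unfolding delete_vertex_eq by (rule hull_minimal) (rule convex_halfspace_le)
  then have "ipt v \<notin> delete_vertex P (ipt v)" using u[of v] by auto
  then show ?thesis using extreme_point_of_iff[OF P] v by blast
qed

definition exceptional_points :: "ipoint set" where
  "exceptional_points = {(0,0,0),(1,0,0),(0,1,0),(-1,-1,0),(1,2,3),(-1,-2,-3)}"

lemma exceptional_polytope_eq: "exceptional_polytope = convex hull (ipt ` exceptional_points)"
  unfolding exceptional_polytope_def exceptional_points_def by (simp add: ipt.simps)

lemma thin_image:
  assumes "s \<in> A" "t \<in> A" "A \<subseteq> ev n ` M" "\<And>p q. p \<in> M \<Longrightarrow> q \<in> M \<Longrightarrow> ev n p - ev n q \<le> 1"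
  shows "s - t \<le> 1"
proof -
  have "s \<in> ev n ` M" "t \<in> ev n ` M" using assms(1-3) by auto
  then obtain p q where "p \<in> M" "q \<in> M" "s = ev n p" "t = ev n q" by blast
  then show ?thesis using assms(4)[of p q] by simp
qed

text \<open>The set holds the values at the origin, two triangle vertices and both apexes. If
  \<open>\<alpha>\<close> and \<open>\<beta>\<close> are equal and nonzero, \<open>f\<close> and
  \<open>f'\<close> are multiples of 3 and vanish; if only one of them is nonzero, \<open>f\<close>
  and \<open>f'\<close> are not multiples of 3 and must equal it. The heights cancel in the sum of
  \<open>f\<close> and \<open>f'\<close>.\<close>

lemma apex_sum_if_thin:
  fixes a b a' b' k \<alpha> \<beta> \<gamma> f f' :: int
  assumes k: "k = 3 \<or> k = -3" and ab: "3 dvd a + b" "\<not> 3 dvd a" "3 dvd a' + b'" "\<not> 3 dvd a'"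
    and n: "(\<alpha>,\<beta>,\<gamma>) \<noteq> (0,0,0)"
    and f: "f = \<alpha>*a + \<beta>*b + \<gamma>*k" "f' = \<alpha>*a' + \<beta>*b' - \<gamma>*k"
    and thin: "\<And>s t. s \<in> {0,\<alpha>,\<beta>,f,f'} \<Longrightarrow> t \<in> {0,\<alpha>,\<beta>,f,f'} \<Longrightarrow> s - t \<le> 1"
  shows "(a+a') + (b+b') = 0 \<or> \<not> 3 dvd a+a' \<and> (a+a' = 2 \<or> b+b' = 2)"
proof -
  have b: "0 - \<alpha> \<le> 1" "0 - \<beta> \<le> 1" "0 - f \<le> 1" "0 - f' \<le> 1" "\<alpha> - 0 \<le> 1" "\<beta> - 0 \<le> 1" "f - 0 \<le> 1" "f' - 0 \<le> 1"
    and d: "\<alpha> - \<beta> \<le> 1" "\<alpha> - f \<le> 1" "\<alpha> - f' \<le> 1" "\<beta> - \<alpha> \<le> 1" "\<beta> - f \<le> 1" "\<beta> - f' \<le> 1" "f - \<alpha> \<le> 1" "f - \<beta> \<le> 1" "f' - \<alpha> \<le> 1" "f' - \<beta> \<le> 1"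
    by (intro thin; simp)+
  define h where "h = (if k = 3 then \<gamma> else - \<gamma>)"
  have h: "\<gamma> * k = 3 * h" using k unfolding h_def by auto
  have h0: "h = 0 \<longleftrightarrow> \<gamma> = 0" unfolding h_def by auto
  have sum_dvd: "3 dvd (a+a') + (b+b')" using dvd_add[OF ab(1,3)] by (simp add: algebra_simps)
  have a_two: ?thesis if "a + a' = 2" using that by simp
  have b_two: ?thesis if "b + b' = 2"
  proof -
    have "\<not> 3 dvd a + a'" using sum_dvd unfolding that by presburger
    with that show ?thesis by simp
  qed
  have nb: "\<not> 3 dvd b" "\<not> 3 dvd b'" using ab by presburger+
  have no: "x + 3 * y \<noteq> 0" "x - 3 * y \<noteq> 0" "- x + 3 * y \<noteq> 0" "- x - 3 * y \<noteq> 0" if "\<not> 3 dvd x" for x y :: int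
    using that by presburger+
  consider "\<alpha> = 0" "\<beta> = 0" | "\<alpha> = 1" "\<beta> = 1" | "\<alpha> = -1" "\<beta> = -1" | "\<alpha> = 1" "\<beta> = 0" | "\<alpha> = -1" "\<beta> = 0"
    | "\<alpha> = 0" "\<beta> = 1" | "\<alpha> = 0" "\<beta> = -1"
  proof -
    have "\<alpha> = -1 \<or> \<alpha> = 0 \<or> \<alpha> = 1" "\<beta> = -1 \<or> \<beta> = 0 \<or> \<beta> = 1" using b by linarith+
    then show thesis using d(1,4) that by (elim disjE) simp_all
  qed
  then show ?thesis
  proof cases
    case 1
    then show ?thesis using f(1) n h0 b unfolding h by auto
  next
    case 2
    have "f = 0" using f(1) b ab(1) unfolding h 2 by presburger
    moreover have "f' = 0" using f(2) b ab(3) unfolding h 2 by presburger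
    ultimately show ?thesis using f unfolding 2 h by auto
  next
    case 3
    have "f = 0" using f(1) b ab(1) unfolding h 3 by presburger
    moreover have "f' = 0" using f(2) b ab(3) unfolding h 3 by presburger
    ultimately show ?thesis using f unfolding 3 h by auto
  next
    case 4
    have rng: "0 \<le> f" "f \<le> 1" "0 \<le> f'" "f' \<le> 1" using b d unfolding 4 by linarith+
    have eq: "f = a + 3 * h" "f' = a' - 3 * h" using f unfolding h 4 by simp_all
    have "f \<noteq> 0" "f' \<noteq> 0" unfolding eq using no ab nb by auto
    then have "f = 1" "f' = 1" using rng by linarith+
    then show ?thesis using eq by (intro a_two) linarith
  next
    case 5
    have rng: "-1 \<le> f" "f \<le> 0" "-1 \<le> f'" "f' \<le> 0" using b d unfolding 5 by linarith+
    have eq: "f = -a + 3 * h" "f' = -a' - 3 * h" using f unfolding h 5 by simp_all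
    have "f \<noteq> 0" "f' \<noteq> 0" unfolding eq using no ab nb by auto
    then have "f = -1" "f' = -1" using rng by linarith+
    then show ?thesis using eq by (intro a_two) linarith
  next
    case 6
    have rng: "0 \<le> f" "f \<le> 1" "0 \<le> f'" "f' \<le> 1" using b d unfolding 6 by linarith+
    have eq: "f = b + 3 * h" "f' = b' - 3 * h" using f unfolding h 6 by simp_all
    have "f \<noteq> 0" "f' \<noteq> 0" unfolding eq using no ab nb by auto
    then have "f = 1" "f' = 1" using rng by linarith+
    then show ?thesis using eq by (intro b_two) linarith
  next
    case 7
    have rng: "-1 \<le> f" "f \<le> 0" "-1 \<le> f'" "f' \<le> 0" using b d unfolding 7 by linarith+
    have eq: "f = -b + 3 * h" "f' = -b' - 3 * h" using f unfolding h 7 by simp_all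
    have "f \<noteq> 0" "f' \<noteq> 0" unfolding eq using no ab nb by auto
    then have "f = -1" "f' = -1" using rng by linarith+
    then show ?thesis using eq by (intro b_two) linarith
  qed
qed

text \<open>\<open>X\<close> and \<open>Y\<close> stand for the coordinates of the sum of the
  apexes. Each of two plane vertices confines it to three lines; of the intersections only two are
  not even in both coordinates.\<close>

lemma odd_apex_sum_23:
  fixes X Y :: int
  assumes "X = 2*Y \<or> X - Y = 2 \<or> Y = -2" "X + Y = 0 \<or> X = 2 \<or> Y = 2" "odd X \<or> odd Y"
  shows "(X = 1 \<and> Y = -1) \<or> (X = 2 \<and> Y = 1)"
proof -
  have p: "\<not> (X = 0 \<and> Y = 0)" "\<not> (X = 4 \<and> Y = 2)" "\<not> (X = 2 \<and> Y = 0)" "\<not> (X = 2 \<and> Y = -2)" using assms(3) by auto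
  show ?thesis using assms(1,2) p by smt
qed

lemma odd_apex_sum_13:
  fixes X Y :: int
  assumes "Y = 2*X \<or> Y - X = 2 \<or> X = -2" "X + Y = 0 \<or> X = 2 \<or> Y = 2" "odd X \<or> odd Y"
  shows "(X = -1 \<and> Y = 1) \<or> (X = 1 \<and> Y = 2)"
proof -
  have p: "\<not> (X = 0 \<and> Y = 0)" "\<not> (X = 2 \<and> Y = 4)" "\<not> (X = 0 \<and> Y = 2)" "\<not> (X = -2 \<and> Y = 2)" using assms(3) by auto
  show ?thesis using assms(1,2) p by smt
qed

lemma odd_apex_sum_12:
  fixes X Y :: int
  assumes "Y = 2*X \<or> Y - X = 2 \<or> X = -2" "X = 2*Y \<or> X - Y = 2 \<or> Y = -2" "odd X \<or> odd Y"
  shows "(X = -1 \<and> Y = -2) \<or> (X = -2 \<and> Y = -1)"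
proof -
  have p: "\<not> (X = 0 \<and> Y = 0)" "\<not> (X = -2 \<and> Y = -4)" "\<not> (X = -4 \<and> Y = -2)" "\<not> (X = -2 \<and> Y = 0)" "\<not> (X = 0 \<and> Y = -2)"  "\<not> (X = -2 \<and> Y = -2)" using assms(3) by auto
  show ?thesis using assms(1,2) p by smt
qed

locale centered_pair = standard_pair +
  assumes unit3_in: "(-1,-1) \<in> plane_points P"
begin

sublocale centered_pyramid "plane_points P" a b "\<bar>k\<bar>"
  by unfold_locales (rule unit3_in)

lemma centered_swap: "centered_pair P a' b' k' a b k"
  using standard_swap unit3 by (auto intro!: centered_pair.intro simp: centered_pair_axioms_def)

lemma height_three: "k = 3 \<or> k = -3"
  using apex_height(1) by linarith

text \<open>Modulo 3 each apex is (1,2) or (2,1). At equal heights, equal classes give a lattice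
  point at one third of the way between the apexes; opposite classes make the centroid of both
  apexes and the origin a lattice point at height 2 or -2.\<close>

lemma opposite_apexes: "k' = - k"
proof (rule ccontr)
  interpret swapped: centered_pair P a' b' k' a b k by (rule centered_swap)
  assume "k' \<noteq> - k"
  then have k': "k' = k" using height_three swapped.height_three by auto
  note A = apex_height(2,3) swapped.apex_height(2,3)
  show False
  proof (cases "3 dvd a - a'")
    case True
    then have "3 dvd 2 * a + a'" "3 dvd 2 * b + b'" using A by presburger+
    then obtain x y where xy: "2 * a + a' = 3 * x" "2 * b + b' = 3 * y" by (metis dvdE)
    have "(x,y,k) \<in> lattice_points P"
      by (rule lattice_points_conv[OF convex apex_in apex_in, of 2 1 0 0 3]) (use xy k' in simp_all)
    then have "(x,y) = (a,b) \<or> (x,y) = (a',b')" using height unfolding lattice_points_iff by auto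
    then have "(a',b',k') = (a,b,k)" using xy k' by auto
    then show False using apexes_distinct by simp
  next
    case False
    then have "3 dvd a + a'" "3 dvd b + b'" using A by presburger+
    then obtain x y where xy: "a + a' = 3 * x" "b + b' = 3 * y" by (metis dvdE)
    obtain z where z: "2 * k = 3 * z" "z = 2 \<or> z = -2" using height_three that[of 2] that[of "-2"] by auto
    have "(x,y,z) \<in> lattice_points P"
      by (rule lattice_points_conv[OF convex apex_in origin[unfolded plane_points_iff] origin[unfolded plane_points_iff], of 1 1 1 0 3])
        (use xy k' z in simp_all)
    then show False using z height_three k' unfolding lattice_points_iff by auto
  qed
qed

lemma lattice_points_eq:
  "lattice_points P = {(0,0,0),(1,0,0),(0,1,0),(-1,-1,0),(a,b,k),(a',b',k')}"
proof -
  have "p \<in> lattice_points P \<longleftrightarrow> p \<in> {(0,0,0),(1,0,0),(0,1,0),(-1,-1,0),(a,b,k),(a',b',k')}" for p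
  proof -
    obtain x y z where p: "p = (x,y,z)" by (metis prod_cases3)
    show ?thesis unfolding p lattice_points_iff lattice_points by auto
  qed
  then show ?thesis by blast
qed

lemma origin_not_extreme: "\<not> ipt (0,0,0) extreme_point_of P"
proof
  assume E: "ipt (0,0,0) extreme_point_of P"
  show False
    by (rule lattice_convex_combination_not_extreme[OF polytope E, of 1 0 0 0 1 0 "-1" "-1" 0 1 1 1])
      (simp_all add: lattice_points_eq)
qed

text \<open>Otherwise \<open>v\<close> and one apex would make \<open>P\<close> merged: the origin,
  two triangle vertices and the other apex span space.\<close>

lemma thin_after_deletion:
  assumes E: "ipt v extreme_point_of P" and v: "v \<in> {(1,0,0),(0,1,0),(-1,-1,0)}"
  obtains n1 n2 n3 where "(n1,n2,n3) \<noteq> (0,0,0)"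
    "\<And>p q. p \<in> lattice_points P - {v} \<Longrightarrow> q \<in> lattice_points P - {v} \<Longrightarrow> ev (n1,n2,n3) p - ev (n1,n2,n3) q \<le> 1"
proof -
  interpret swapped: centered_pair P a' b' k' a b k by (rule centered_swap)
  let ?M = "lattice_points P - {v}"
  have full: "\<exists>p\<in>?M - {(a,b,k)}. \<exists>q\<in>?M - {(a,b,k)}. ev n p \<noteq> ev n q" if n: "n \<noteq> (0,0,0)" for n
  proof (rule ccontr)
    assume "\<not> ?thesis"
    then have eq: "ev n p = ev n q" if "p \<in> ?M - {(a,b,k)}" "q \<in> ?M - {(a,b,k)}" for p q using that by blast
    obtain n1 n2 n3 where n': "n = (n1,n2,n3)" by (metis prod_cases3)
    have "(0,0,0) \<in> ?M - {(a,b,k)}" using v height by (auto simp: lattice_points_eq)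
    then have z: "ev n p = 0" if "p \<in> ?M - {(a,b,k)}" for p using eq[OF that] unfolding n' by force
    have "k \<noteq> 0" using height by auto
    then have "n1 = 0 \<and> n2 = 0"
      using z[of "(1,0,0)"] z[of "(0,1,0)"] z[of "(-1,-1,0)"] v unfolding n' by (auto simp: lattice_points_eq)
    moreover have "(a',b',k') \<in> ?M - {(a,b,k)}" using v height' apexes_distinct by (auto simp: lattice_points_eq)
    ultimately have "n3 * k' = 0" using z[of "(a',b',k')"] unfolding n' by simp
    then show False using n \<open>n1 = 0 \<and> n2 = 0\<close> height' unfolding n' by auto
  qed
  have "\<not> wide ?M"
  proof
    assume W: "wide ?M"
    have "merged P"
      by (rule mergedI[OF polytope _ E extreme W swapped.wide_apex full]) (use v height in auto)
    then show False using not_merged by simp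
  qed
  then show ?thesis using that by (rule thin_functionalE)
qed

text \<open>The points left after the deletion have exactly the values considered in
  \<open>apex_sum_if_thin\<close>. The next two lemmas are its images under the rotation of the
  triangle of order three.\<close>

lemma apex_sum_if_vertex3:
  assumes "ipt (-1,-1,0) extreme_point_of P"
  shows "(a+a') + (b+b') = 0 \<or> \<not> 3 dvd a+a' \<and> (a+a' = 2 \<or> b+b' = 2)"
proof -
  interpret swapped: centered_pair P a' b' k' a b k by (rule centered_swap)
  obtain n1 n2 n3 where n: "(n1,n2,n3) \<noteq> (0,0,0)"
    "\<And>p q. p \<in> lattice_points P - {(-1,-1,0)} \<Longrightarrow> q \<in> lattice_points P - {(-1,-1,0)} \<Longrightarrow> ev (n1,n2,n3) p - ev (n1,n2,n3) q \<le> 1"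
    by (rule thin_after_deletion[OF assms]) auto
  show ?thesis
  proof (rule apex_sum_if_thin[OF height_three apex_height(2,3) swapped.apex_height(2,3) n(1) refl refl])
    fix s t assume "s \<in> {0, n1, n2, n1*a + n2*b + n3*k, n1*a' + n2*b' - n3*k}" "t \<in> {0, n1, n2, n1*a + n2*b + n3*k, n1*a' + n2*b' - n3*k}"
    then show "s - t \<le> 1"
    proof (rule thin_image)
      show "{0, n1, n2, n1*a + n2*b + n3*k, n1*a' + n2*b' - n3*k} \<subseteq> ev (n1,n2,n3) ` (lattice_points P - {(-1,-1,0)})"
        unfolding lattice_points_eq opposite_apexes using height by (auto simp: insert_Diff_if opposite_apexes)
    qed (rule n(2))
  qed
qed

lemma apex_sum_if_vertex1:
  assumes "ipt (1,0,0) extreme_point_of P"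
  shows "(b+b') = 2*(a+a') \<or> \<not> 3 dvd a+a' \<and> ((b+b') - (a+a') = 2 \<or> a+a' = -2)"
proof -
  interpret swapped: centered_pair P a' b' k' a b k by (rule centered_swap)
  obtain n1 n2 n3 where n: "(n1,n2,n3) \<noteq> (0,0,0)"
    "\<And>p q. p \<in> lattice_points P - {(1,0,0)} \<Longrightarrow> q \<in> lattice_points P - {(1,0,0)} \<Longrightarrow> ev (n1,n2,n3) p - ev (n1,n2,n3) q \<le> 1"
    by (rule thin_after_deletion[OF assms]) auto
  note A = apex_height(2,3) swapped.apex_height(2,3)
  have dv: "3 dvd (b-a) + (-a)" "\<not> 3 dvd b-a" "3 dvd (b'-a') + (-a')" "\<not> 3 dvd b'-a'" using A by presburger+
  \<comment> \<open>coordinates with respect to the basis (0,1), (-1,-1) of the plane\<close>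
  have nz: "(n2,-n1-n2,n3) \<noteq> (0,0,0)" using n(1) by auto
  have "((b-a)+(b'-a')) + (-a+-a') = 0 \<or> \<not> 3 dvd (b-a)+(b'-a') \<and> ((b-a)+(b'-a') = 2 \<or> -a+-a' = 2)"
  proof (rule apex_sum_if_thin[OF height_three dv nz, of "n1*a + n2*b + n3*k" "n1*a' + n2*b' - n3*k"])
    fix s t assume "s \<in> {0, n2, -n1-n2, n1*a + n2*b + n3*k, n1*a' + n2*b' - n3*k}" "t \<in> {0, n2, -n1-n2, n1*a + n2*b + n3*k, n1*a' + n2*b' - n3*k}"
    then show "s - t \<le> 1"
    proof (rule thin_image)
      show "{0, n2, -n1-n2, n1*a + n2*b + n3*k, n1*a' + n2*b' - n3*k} \<subseteq> ev (n1,n2,n3) ` (lattice_points P - {(1,0,0)})"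
        unfolding lattice_points_eq opposite_apexes using height by (auto simp: insert_Diff_if opposite_apexes)
    qed (rule n(2))
  qed (simp_all add: algebra_simps)
  moreover have "3 dvd (a+a') + (b+b')" using dvd_add[OF A(1,3)] by (simp add: algebra_simps)
  then have "3 dvd (b-a)+(b'-a') \<longleftrightarrow> 3 dvd a+a'" by presburger
  moreover have "((b-a)+(b'-a')) + (-a+-a') = 0 \<longleftrightarrow> b+b' = 2*(a+a')" by presburger
  moreover have "(b-a)+(b'-a') = 2 \<longleftrightarrow> (b+b') - (a+a') = 2" by presburger
  moreover have "-a+-a' = 2 \<longleftrightarrow> a+a' = -2" by presburger
  ultimately show ?thesis by argo
qed

lemma apex_sum_if_vertex2:
  assumes "ipt (0,1,0) extreme_point_of P"
  shows "(a+a') = 2*(b+b') \<or> \<not> 3 dvd a+a' \<and> ((a+a') - (b+b') = 2 \<or> b+b' = -2)"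
proof -
  interpret swapped: centered_pair P a' b' k' a b k by (rule centered_swap)
  obtain n1 n2 n3 where n: "(n1,n2,n3) \<noteq> (0,0,0)"
    "\<And>p q. p \<in> lattice_points P - {(0,1,0)} \<Longrightarrow> q \<in> lattice_points P - {(0,1,0)} \<Longrightarrow> ev (n1,n2,n3) p - ev (n1,n2,n3) q \<le> 1"
    by (rule thin_after_deletion[OF assms]) auto
  note A = apex_height(2,3) swapped.apex_height(2,3)
  have dv: "3 dvd (-b) + (a-b)" "\<not> 3 dvd -b" "3 dvd (-b') + (a'-b')" "\<not> 3 dvd -b'" using A by presburger+
  \<comment> \<open>coordinates with respect to the basis (-1,-1), (1,0) of the plane\<close>
  have nz: "(-n1-n2,n1,n3) \<noteq> (0,0,0)" using n(1) by auto
  have "(-b+-b') + ((a-b)+(a'-b')) = 0 \<or> \<not> 3 dvd -b+-b' \<and> (-b+-b' = 2 \<or> (a-b)+(a'-b') = 2)"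
  proof (rule apex_sum_if_thin[OF height_three dv nz, of "n1*a + n2*b + n3*k" "n1*a' + n2*b' - n3*k"])
    fix s t assume "s \<in> {0, -n1-n2, n1, n1*a + n2*b + n3*k, n1*a' + n2*b' - n3*k}" "t \<in> {0, -n1-n2, n1, n1*a + n2*b + n3*k, n1*a' + n2*b' - n3*k}"
    then show "s - t \<le> 1"
    proof (rule thin_image)
      show "{0, -n1-n2, n1, n1*a + n2*b + n3*k, n1*a' + n2*b' - n3*k} \<subseteq> ev (n1,n2,n3) ` (lattice_points P - {(0,1,0)})"
        unfolding lattice_points_eq opposite_apexes using height by (auto simp: insert_Diff_if opposite_apexes)
    qed (rule n(2))
  qed (simp_all add: algebra_simps)
  moreover have "3 dvd (a+a') + (b+b')" using dvd_add[OF A(1,3)] by (simp add: algebra_simps)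
  then have "3 dvd -b+-b' \<longleftrightarrow> 3 dvd a+a'" by presburger
  moreover have "(-b+-b') + ((a-b)+(a'-b')) = 0 \<longleftrightarrow> a+a' = 2*(b+b')" by presburger
  moreover have "(a-b)+(a'-b') = 2 \<longleftrightarrow> (a+a') - (b+b') = 2" by presburger
  moreover have "-b+-b' = 2 \<longleftrightarrow> b+b' = -2" by presburger
  ultimately show ?thesis by argo
qed

text \<open>The plane functional is 2 at the vertex, -1 at the other two and 0 at the origin.
  Tilting it in height levels the apexes at half the sum of their values, so a sum below 4 makes the
  vertex the unique maximum. The factor 6 keeps the tilt integral.\<close>

lemma vertex_if:
  fixes r s :: int
  assumes v: "(v1,v2) \<in> {(1,0),(0,1),(-1,-1)}" and rs: "r * v1 + s * v2 = 2"
    and other: "\<forall>p\<in>{(1,0),(0,1),(-1,-1)}. p \<noteq> (v1,v2) \<longrightarrow> r * fst p + s * snd p = -1"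
    and less: "r*(a+a') + s*(b+b') < 4"
  shows "ipt (v1,v2,0) extreme_point_of P"
proof -
  define f f' where "f = r*a + s*b" and "f' = r*a' + s*b'"
  \<comment> \<open>chosen so that the functional takes the same value at both apexes\<close>
  define \<gamma> where "\<gamma> = (if k = 3 then f' - f else f - f')"
  have \<gamma>: "\<gamma> * k = 3 * (f' - f)" using height_three unfolding \<gamma>_def by auto
  show ?thesis
  proof (rule vertex_by_functional[OF polytope, where n = "(6 * r, 6 * s, \<gamma>)"])
    show "(v1,v2,0) \<in> lattice_points P" using v by (auto simp: lattice_points_eq)
    fix q assume q: "q \<in> lattice_points P" "q \<noteq> (v1,v2,0)"
    have ff: "f + f' < 4" using less unfolding f_def f'_def by (simp add: algebra_simps)
    have m: "ev (6 * r, 6 * s, \<gamma>) (v1,v2,0) = 12" using rs(1) by simp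
    have e1: "ev (6 * r, 6 * s, \<gamma>) (a,b,k) = 3 * (f + f')" using \<gamma> unfolding f_def f'_def by (simp add: algebra_simps)
    have e2: "ev (6 * r, 6 * s, \<gamma>) (a',b',k') = 3 * (f + f')" using \<gamma> unfolding opposite_apexes f_def f'_def by (simp add: algebra_simps)
    have e3: "ev (6 * r, 6 * s, \<gamma>) (x,y,0) = -6" if "(x,y) \<in> {(1,0),(0,1),(-1,-1)}" "(x,y) \<noteq> (v1,v2)" for x y
      proof -
      have "r * x + s * y = -1" using bspec[OF other that(1)] that(2) by simp
      then show ?thesis by simp
    qed
    show "ev (6 * r, 6 * s, \<gamma>) q < ev (6 * r, 6 * s, \<gamma>) (v1,v2,0)"
      unfolding m
    proof -
      consider "q = (0,0,0)" | "q = (a,b,k)" | "q = (a',b',k')" | x y where "q = (x,y,0)" "(x,y) \<in> {(1,0),(0,1),(-1,-1)}"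
        using q(1) unfolding lattice_points_eq by auto
      then show "ev (6 * r, 6 * s, \<gamma>) q < 12"
      proof cases
        case 1 then show ?thesis by simp
      next
        case 2 then show ?thesis using e1 ff by (simp del: ev.simps)
      next
        case 3 then show ?thesis using e2 ff by (simp del: ev.simps)
      next
        case 4
        then have "ev (6 * r, 6 * s, \<gamma>) q = -6" using e3[OF 4(2)] q(2) by auto
        then show ?thesis by simp
      qed
    qed
  qed
qed

text \<open>At least two triangle vertices are vertices of \<open>P\<close>. If 3 divides
  \<open>X\<close>, their linear relations already force the sum to be zero. Otherwise two
  candidates remain for each pair; both make the third point a vertex by \<open>vertex_if\<close>,
  and its own condition fails.\<close>

lemma antipodal_apexes: "a' = - a" "b' = - b"
proof -
  interpret swapped: centered_pair P a' b' k' a b k by (rule centered_swap)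
  note A = apex_height(2,3) swapped.apex_height(2,3)
  define V1 V2 V3 where "V1 = (ipt (1,0,0) extreme_point_of P)" and "V2 = (ipt (0,1,0) extreme_point_of P)"
    and "V3 = (ipt (-1,-1,0) extreme_point_of P)"
  have which: "p \<in> {(1,0,0),(0,1,0),(-1,-1,0)}"
    if "ipt p extreme_point_of P" "p \<noteq> (a,b,k)" "p \<noteq> (a',b',k')" for p
    using that extreme_point_of_iff[OF polytope, of p] origin_not_extreme unfolding lattice_points_eq by auto
  obtain v where v: "ipt v extreme_point_of P" "v \<notin> {(a,b,k),(a',b',k')}"
    by (rule another_vertex[OF polytope dim, of "{(a,b,k),(a',b',k')}"]) (auto simp: card_insert_if)
  obtain w where w: "ipt w extreme_point_of P" "w \<notin> {(a,b,k),(a',b',k'),v}"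
    by (rule another_vertex[OF polytope dim, of "{(a,b,k),(a',b',k'),v}"]) (auto simp: card_insert_if)
  have two: "(V1 \<and> V2) \<or> (V1 \<and> V3) \<or> (V2 \<and> V3)"
    using which[of v] which[of w] v w unfolding V1_def V2_def V3_def by auto
  define X Y where "X = a + a'" and "Y = b + b'"
  have B3: "V3 \<Longrightarrow> X + Y = 0 \<or> \<not> 3 dvd X \<and> (X = 2 \<or> Y = 2)" using apex_sum_if_vertex3 unfolding V3_def X_def Y_def .
  have B1: "V1 \<Longrightarrow> Y = 2*X \<or> \<not> 3 dvd X \<and> (Y - X = 2 \<or> X = -2)" using apex_sum_if_vertex1 unfolding V1_def X_def Y_def .
  have B2: "V2 \<Longrightarrow> X = 2*Y \<or> \<not> 3 dvd X \<and> (X - Y = 2 \<or> Y = -2)" using apex_sum_if_vertex2 unfolding V2_def X_def Y_def .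
  have W1: "2*X - Y < 4 \<Longrightarrow> V1" using vertex_if[of 1 0 2 "-1"] unfolding V1_def X_def Y_def by auto
  have W2: "2*Y - X < 4 \<Longrightarrow> V2" using vertex_if[of 0 1 "-1" 2] unfolding V2_def X_def Y_def by auto
  have W3: "- X - Y < 4 \<Longrightarrow> V3" using vertex_if[of "-1" "-1" "-1" "-1"] unfolding V3_def X_def Y_def by auto
  have D: "3 dvd X + Y" using A unfolding X_def Y_def by presburger
  \<comment> \<open>An even sum makes the midpoint of the apexes one of the four plane points;
    divisibility of \<open>X + Y\<close> by 3 leaves only the origin.\<close>
  have ev: "X = 0 \<and> Y = 0" if "even X" "even Y"
  proof -
    obtain x y where xy: "X = 2 * x" "Y = 2 * y" using \<open>even X\<close> \<open>even Y\<close> by (metis evenE)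
    have "(x,y,0) \<in> lattice_points P" using xy opposite_apexes unfolding X_def Y_def by (intro midpoint_in) auto
    then have "(x,y) \<in> {(0,0),(1,0),(0,1),(-1,-1)}" using height height' unfolding lattice_points_eq by auto
    then show ?thesis using D xy by auto
  qed
  have "X = 0 \<and> Y = 0"
  proof (cases "3 dvd X")
    case True
    have b: "V1 \<Longrightarrow> Y = 2*X" "V2 \<Longrightarrow> X = 2*Y" "V3 \<Longrightarrow> X + Y = 0" using B1 B2 B3 True by blast+
    from two show ?thesis
    proof (elim disjE conjE)
      assume V1 V2
      then show ?thesis using b(1,2) by linarith
    next
      assume V1 V3
      then show ?thesis using b(1,3) by linarith
    next
      assume V2 V3
      then show ?thesis using b(2,3) by linarith
    qed
  next
    case False
    show ?thesis
    proof (rule ccontr)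
      assume "\<not> ?thesis"
      then have ne: "odd X \<or> odd Y" using ev by blast
      have b: "V1 \<Longrightarrow> Y = 2*X \<or> Y - X = 2 \<or> X = -2" "V2 \<Longrightarrow> X = 2*Y \<or> X - Y = 2 \<or> Y = -2"
        "V3 \<Longrightarrow> X + Y = 0 \<or> X = 2 \<or> Y = 2" using B1 B2 B3 by blast+
      from two show False
      proof (elim disjE conjE)
        assume V: V1 V2
        have "(X = -1 \<and> Y = -2) \<or> (X = -2 \<and> Y = -1)" by (rule odd_apex_sum_12[OF b(1)[OF V(1)] b(2)[OF V(2)] ne])
        moreover from this have "- X - Y < 4" by linarith
        from b(3)[OF W3[OF this]] calculation show False by linarith
      next
        assume V: V1 V3
        have "(X = -1 \<and> Y = 1) \<or> (X = 1 \<and> Y = 2)" by (rule odd_apex_sum_13[OF b(1)[OF V(1)] b(3)[OF V(2)] ne])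
        moreover from this have "2*Y - X < 4" by linarith
        from b(2)[OF W2[OF this]] calculation show False by linarith
      next
        assume V: V2 V3
        have "(X = 1 \<and> Y = -1) \<or> (X = 2 \<and> Y = 1)" by (rule odd_apex_sum_23[OF b(2)[OF V(1)] b(3)[OF V(2)] ne])
        moreover from this have "2*X - Y < 4" by linarith
        from b(1)[OF W1[OF this]] calculation show False by linarith
      qed
    qed
  qed
  then show "a' = - a" "b' = - b" unfolding X_def Y_def by auto
qed

lemma exceptional: "exceptional P"
proof -
  have L: "lattice_points P = {(0,0,0),(1,0,0),(0,1,0),(-1,-1,0),(a,b,k),(-a,-b,-k)}"
    using lattice_points_eq antipodal_apexes opposite_apexes by simp
  have "card (lattice_points P) = 6" unfolding L using height by (auto simp: card_insert_if)
  then have size: "lattice_size P = 6" unfolding lattice_size_eq .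
  \<comment> \<open>The sign selects the apex congruent to (1,2) modulo 3. The frame then shears the
    height axis so that (1,2,3) goes to this apex.\<close>
  define s where "s = (if 3 dvd a - 1 then 1 else -1 :: int)"
  have "3 dvd s*a - 1" "3 dvd s*b - 2" using apex_height(2,3) unfolding s_def by presburger+
  then obtain c1 c2 where c: "s*a = 1 + 3*c1" "s*b = 2 + 3*c2" by (metis dvdE diff_eq_eq add.commute)
  obtain c3 where c3: "s*k = 3*c3" "c3 = 1 \<or> c3 = -1"
    using height_three that[of s] that[of "-s"] unfolding s_def by auto
  have "(idet (1,0,0) (0,1,0) (c1,c2,c3))\<^sup>2 = 1" using c3(2) by auto
  then obtain t where t: "unimodular_map t" "\<And>p. t (ipt p) = ipt (frame (0,0,0) (1,0,0) (0,1,0) (c1,c2,c3) p)"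
    using frame_unimodular by metis
  interpret t: unimodular_map t by fact
  interpret i: unimodular_map "inv t" by (rule t.inverse)
  have "frame (0,0,0) (1,0,0) (0,1,0) (c1,c2,c3) ` exceptional_points
      = {(0,0,0),(1,0,0),(0,1,0),(-1,-1,0),(s*a,s*b,s*k),(-(s*a),-(s*b),-(s*k))}"
    unfolding exceptional_points_def c c3(1) by (simp add: mult.commute)
  also have "\<dots> = lattice_points P" unfolding L s_def by auto
  finally have "t ` ipt ` exceptional_points = ipt ` lattice_points P"
    using t(2) by (metis (no_types, lifting) image_cong image_image)
  then have "t ` exceptional_polytope = P"
    unfolding exceptional_polytope_eq convex_hull_affine_image[OF t.affine] using lattice_polytope_eq[OF polytope] by simp
  then have "inv t ` P = exceptional_polytope" using t.inj by (metis image_inv_f_f)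
  then show ?thesis unfolding exceptional_def using size i.unimodularly_equivalent_image[of P] by simp
qed

end

text \<open>The plane is made horizontal, a unimodular triangle in it is made standard, and a second
  change of plane coordinates moves the extra point from \<open>trichotomy\<close> to (-1,0) or
  (-1,-1).\<close>

proposition critical_exceptional:
  assumes "critical P v w"
  shows "exceptional P"
proof -
  obtain P1 v1 w1 where 1: "critical P1 v1 w1" "\<And>x y z. (x,y,z) \<in> lattice_points P1 - {v1} - {w1} \<Longrightarrow> z = 0"
    "exceptional P1 \<Longrightarrow> exceptional P"
    using critical_flat[OF assms] by metis
  obtain a' b' k' where v1: "v1 = (a',b',k')" by (metis prod_cases3)
  obtain a b k where w1: "w1 = (a,b,k)" by (metis prod_cases3)
  interpret p1: flat_pair P1 a b k a' b' k' using 1 unfolding v1 w1 by unfold_locales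
  obtain p1 p2 d1 d2 e1 e2 where "(p1,p2) \<in> plane_points P1" "(p1+d1,p2+d2) \<in> plane_points P1"
    "(p1+e1,p2+e2) \<in> plane_points P1" "d1*e2-d2*e1 \<noteq> 0" by (rule p1.noncollinear)
  then obtain p1 p2 d1 d2 e1 e2 where t: "(p1,p2) \<in> plane_points P1" "(p1+d1,p2+d2) \<in> plane_points P1"
    "(p1+e1,p2+e2) \<in> plane_points P1" "d1*e2-d2*e1 = 1" by (rule p1.unimodular_triangle)
  have "(d1*e2-d2*e1)\<^sup>2 = 1" using t(4) by simp
  then obtain P2 A B K A' B' K' where 2: "flat_pair P2 A B K A' B' K'"
    "\<And>x y. (x,y) \<in> plane_points P2 \<longleftrightarrow> (p1+d1*x+e1*y, p2+d2*x+e2*y) \<in> plane_points P1"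
    "exceptional P2 \<Longrightarrow> exceptional P1" by (rule p1.planar_change[of d1 e2 d2 e1 p1 p2]) blast
  interpret p2: flat_pair P2 A B K A' B' K' by (rule 2)
  interpret p2: standard_pair P2 A B K A' B' K' by unfold_locales (simp_all add: 2(2) t)
  obtain q1 q2 f1 f2 g1 g2 where s: "(f1*g2-f2*g1)\<^sup>2 = 1" "(q1,q2) \<in> plane_points P2" "(q1+f1,q2+f2) \<in> plane_points P2"
    "(q1+g1,q2+g2) \<in> plane_points P2" "(q1-f1,q2-f2) \<in> plane_points P2 \<or> (q1-f1-g1,q2-f2-g2) \<in> plane_points P2"
    using p2.trichotomy p2.not_triangle by blast
  obtain P3 a b k a' b' k' where 3: "flat_pair P3 a b k a' b' k'"
    "\<And>x y. (x,y) \<in> plane_points P3 \<longleftrightarrow> (q1+f1*x+g1*y, q2+f2*x+g2*y) \<in> plane_points P2"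
    "exceptional P3 \<Longrightarrow> exceptional P2" by (rule p2.planar_change[OF s(1), of q1 q2]) blast
  interpret p3: flat_pair P3 a b k a' b' k' by (rule 3)
  interpret p3: standard_pair P3 a b k a' b' k' by unfold_locales (simp_all add: 3(2) s)
  from s(5) have "exceptional P3"
  proof
    assume "(q1-f1,q2-f2) \<in> plane_points P2"
    then interpret p3: collinear_pair P3 a b k a' b' k' by unfold_locales (simp add: 3(2))
    show ?thesis using p3.impossible by blast
  next
    assume "(q1-f1-g1,q2-f2-g2) \<in> plane_points P2"
    then interpret p3: centered_pair P3 a b k a' b' k' by unfold_locales (simp add: 3(2))
    show ?thesis by (rule p3.exceptional)
  qed
  then show ?thesis using 1(3) 2(3) 3(3) by blast
qed

section \<open>The exceptional polytope\<close>

lemma exceptional_polytope_lattice: "lattice_polytope exceptional_polytope"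
  unfolding exceptional_polytope_eq by (rule hull_lattice_polytope) (simp add: exceptional_points_def)

lemma not_wideI:
  assumes "n \<noteq> (0,0,0)" "\<forall>p\<in>L. ev n p = c \<or> ev n p = c + 1"
  shows "\<not> wide L"
  using not_wide_if_two_values[OF _ assms(1)] assms(2) by blast

text \<open>Differences of triangle vertices bound \<open>n1 - n2\<close>, \<open>2*n1 + n2\<close>
  and \<open>n1 + 2*n2\<close> by one in absolute value, so a thin normal is vertical, and the
  height of the last point rules it out.\<close>

lemma wide_exceptional:
  assumes "{(0,0,0),(1,0,0),(0,1,0),(-1,-1,0),(x,y,z)} \<subseteq> L" "2 \<le> \<bar>z\<bar>"
  shows "wide L"
  unfolding wide_def
proof (intro allI impI, rule ccontr)
  fix n :: ipoint assume n: "n \<noteq> (0,0,0)" and "\<not> (\<exists>p\<in>L. \<exists>q\<in>L. 2 \<le> ev n p - ev n q)"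
  then have le: "ev n p - ev n q < 2" if "p \<in> L" "q \<in> L" for p q using that by (meson not_le)
  obtain n1 n2 n3 where n': "n = (n1,n2,n3)" by (metis prod_cases3)
  have i: "(0,0,0) \<in> L" "(1,0,0) \<in> L" "(0,1,0) \<in> L" "(-1,-1,0) \<in> L" "(x,y,z) \<in> L" using assms by auto
  have "n1 - n2 \<le> 1" "n2 - n1 \<le> 1" "2*n1 + n2 \<le> 1" "- 2*n1 - n2 \<le> 1" "n1 + 2*n2 \<le> 1" "- n1 - 2*n2 \<le> 1"
    using le[OF i(2,3)] le[OF i(3,2)] le[OF i(2,4)] le[OF i(4,2)] le[OF i(3,4)] le[OF i(4,3)] unfolding n' by simp_all
  then have n12: "n1 = 0" "n2 = 0" by linarith+
  have "n3 * z \<le> 1" "- (n3 * z) \<le> 1" using le[OF i(5,1)] le[OF i(1,5)] n12 unfolding n' by simp_all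
  then have "\<bar>n3 * z\<bar> \<le> 1" by linarith
  moreover have "\<bar>n3\<bar> * 2 \<le> \<bar>n3 * z\<bar>" unfolding abs_mult using assms(2) by (intro mult_left_mono) auto
  ultimately have "n3 = 0" by linarith
  then show False using n n12 unfolding n' by simp
qed

context
  assumes size: "lattice_size exceptional_polytope = 6"
begin

text \<open>The six generators lie in the polytope, so the size assumed in this context leaves room
  for no others. The assumption is at hand in case (3), whose size condition is invariant under
  unimodular maps.\<close>

lemma lattice_points_exceptional: "lattice_points exceptional_polytope = exceptional_points"
proof (rule card_subset_eq[symmetric])
  show "finite (lattice_points exceptional_polytope)"
    by (rule finite_lattice_points_polytope[OF exceptional_polytope_lattice])
  show "exceptional_points \<subseteq> lattice_points exceptional_polytope"
    unfolding lattice_points_def exceptional_polytope_eq by (auto intro: hull_inc)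
  show "card exceptional_points = card (lattice_points exceptional_polytope)"
    using size unfolding lattice_size_eq by (simp add: exceptional_points_def)
qed

lemma width_exceptional_iff: "width (delete_vertex exceptional_polytope (ipt v)) > 1 \<longleftrightarrow> wide (exceptional_points - {v})"
proof -
  have "finite (exceptional_points - {v})" "exceptional_points - {v} \<noteq> {}"
    by (auto simp: exceptional_points_def)
  then show ?thesis unfolding delete_vertex_eq lattice_points_exceptional by (rule width_gt_one_iff)
qed

lemma apex_vertices: "ipt (1,2,3) extreme_point_of exceptional_polytope" "ipt (-1,-2,-3) extreme_point_of exceptional_polytope"
proof -
  show "ipt (1,2,3) extreme_point_of exceptional_polytope"
    by (rule vertex_by_functional[OF exceptional_polytope_lattice, where n = "(0,0,1)"])
      (auto simp: lattice_points_exceptional exceptional_points_def)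
  show "ipt (-1,-2,-3) extreme_point_of exceptional_polytope"
    by (rule vertex_by_functional[OF exceptional_polytope_lattice, where n = "(0,0,-1)"])
      (auto simp: lattice_points_exceptional exceptional_points_def)
qed

lemma apex_wide: "wide (exceptional_points - {(1,2,3)})" "wide (exceptional_points - {(-1,-2,-3)})"
  using wide_exceptional[of "-1" "-2" "-3" "exceptional_points - {(1,2,3)}"]
    wide_exceptional[of 1 2 3 "exceptional_points - {(-1,-2,-3)}"] by (auto simp: exceptional_points_def)

lemma nonessential_apex:
  assumes E: "ipt p extreme_point_of exceptional_polytope" and W: "wide (exceptional_points - {p})"
  shows "p = (1,2,3) \<or> p = (-1,-2,-3)"
proof (rule ccontr)
  assume A: "\<not> ?thesis"
  have "p \<in> exceptional_points"
    using E extreme_point_of_iff[OF exceptional_polytope_lattice] lattice_points_exceptional by blast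
  moreover have "p \<noteq> (0,0,0)"
  proof
    assume "p = (0,0,0)"
    with E have E0: "ipt (0,0,0) extreme_point_of exceptional_polytope" by simp
    show False
      by (rule lattice_convex_combination_not_extreme[OF exceptional_polytope_lattice E0, of 1 0 0 0 1 0 "-1" "-1" 0 1 1 1])
        (simp_all add: lattice_points_exceptional exceptional_points_def)
  qed
  ultimately consider "p = (1,0,0)" | "p = (0,1,0)" | "p = (-1,-1,0)" using A by (auto simp: exceptional_points_def)
  \<comment> \<open>Each functional vanishes on the line through the apexes and the origin and
    equals one at the two remaining triangle vertices.\<close>
  then have "\<not> wide (exceptional_points - {p})"
  proof cases
    case 1
    show ?thesis by (rule not_wideI[of "(-2,1,0)" _ 0]) (auto simp: 1 exceptional_points_def)
  next
    case 2
    show ?thesis by (rule not_wideI[of "(1,-2,1)" _ 0]) (auto simp: 2 exceptional_points_def)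
  next
    case 3
    show ?thesis by (rule not_wideI[of "(1,1,-1)" _ 0]) (auto simp: 3 exceptional_points_def)
  qed
  with W show False by simp
qed

lemma exceptional_not_quasi_minimal: "\<not> quasi_minimal exceptional_polytope"
proof
  assume Q: "quasi_minimal exceptional_polytope"
  have "\<not> essential_vertex exceptional_polytope (ipt (1,2,3))" "\<not> essential_vertex exceptional_polytope (ipt (-1,-2,-3))"
    using apex_wide unfolding essential_vertex_def width_exceptional_iff[symmetric] by auto
  with Q apex_vertices have "ipt (1,2,3) = ipt (-1,-2,-3)" unfolding quasi_minimal_def by blast
  then show False by simp
qed

text \<open>Only the two apexes can form the required pair, and without them all points lie in one
  plane.\<close>

lemma exceptional_not_merged: "\<not> merged exceptional_polytope"
proof
  assume "merged exceptional_polytope"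
  then obtain v w where vw: "v \<noteq> w" "v extreme_point_of exceptional_polytope" "w extreme_point_of exceptional_polytope"
    "width (delete_vertex exceptional_polytope v) > 1" "width (delete_vertex exceptional_polytope w) > 1"
    and dim: "aff_dim (delete_vertex (delete_vertex exceptional_polytope v) w) = 3"
    unfolding merged_def by auto
  obtain p where p: "v = ipt p" using extreme_point_lattice[OF exceptional_polytope_lattice vw(2)] by blast
  obtain q where q: "w = ipt q" using extreme_point_lattice[OF exceptional_polytope_lattice vw(3)] by blast
  have "p = (1,2,3) \<or> p = (-1,-2,-3)" "q = (1,2,3) \<or> q = (-1,-2,-3)" "p \<noteq> q"
    using vw nonessential_apex unfolding p q width_exceptional_iff by auto
  then have rest: "exceptional_points - {p} - {q} \<subseteq> {(0,0,0),(1,0,0),(0,1,0),(-1,-1,0)}"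
    unfolding exceptional_points_def by auto
  have del: "delete_vertex (delete_vertex exceptional_polytope v) w = convex hull (ipt ` (exceptional_points - {p} - {q}))"
    using delete_two_vertices[OF exceptional_polytope_lattice, of p q] vw(2) unfolding p q lattice_points_exceptional by simp
  have "ipt ` (exceptional_points - {p} - {q}) \<subseteq> {x. axis 3 1 \<bullet> x = 0}"
    using rest by (fastforce simp: inner_axis' )
  then have "aff_dim (ipt ` (exceptional_points - {p} - {q})) \<le> aff_dim {x::real^3. axis 3 1 \<bullet> x = 0}"
    by (rule aff_dim_subset)
  also have "\<dots> = 2" by (subst aff_dim_hyperplane) (simp_all add: axis_eq_0_iff)
  finally show False using dim unfolding del by (simp add: aff_dim_convex_hull)
qed

end

lemma exceptional_exclusive:
  assumes "lattice_polytope P" "exceptional P"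
  shows "\<not> quasi_minimal P" "\<not> merged P"
proof -
  obtain t where t: "unimodular_map t" "t ` P = exceptional_polytope"
    using assms(2) unfolding exceptional_def by (auto elim: unimodularly_equivalentE)
  interpret t: unimodular_map t by fact
  have C: "convex P" by (rule lattice_polytope_convex[OF assms(1)])
  have "lattice_size exceptional_polytope = 6"
    using assms(2) t.lattice_size_image[of P] t(2) unfolding exceptional_def by simp
  then show "\<not> quasi_minimal P" "\<not> merged P"
    using exceptional_not_quasi_minimal exceptional_not_merged t.quasi_minimal_image[OF C] t.merged_image[OF C] t(2) by auto
qed

lemma merged_not_quasi_minimal: "merged P \<Longrightarrow> \<not> quasi_minimal P"
  unfolding merged_def quasi_minimal_def essential_vertex_def by (meson not_le)

lemma not_quasi_minimal_exceptional:
  assumes "lattice_polytope P" "aff_dim P = 3" "\<not> merged P" "\<not> quasi_minimal P"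
  shows "exceptional P"
proof -
  obtain v w where vw: "v extreme_point_of P" "w extreme_point_of P" "v \<noteq> w"
    "\<not> essential_vertex P v" "\<not> essential_vertex P w"
    using assms(4) unfolding quasi_minimal_def by blast
  obtain p where p: "v = ipt p" using extreme_point_lattice[OF assms(1) vw(1)] by blast
  obtain q where q: "w = ipt q" using extreme_point_lattice[OF assms(1) vw(2)] by blast
  have "critical P p q"
    using assms vw unfolding critical_def essential_vertex_def p q by auto
  then show ?thesis by (rule critical_exceptional)
qed

theorem theorem5:
  fixes P :: "(real ^ 3) set"
  assumes "lattice_polytope P"
    and "aff_dim P = 3"
    and "width P > 1"
  shows "(quasi_minimal P \<and> \<not> merged P \<and> \<not> (lattice_size P = 6 \<and> unimodularly_equivalent P exceptional_polytope)) \<or>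
         (\<not> quasi_minimal P \<and> merged P \<and> \<not> (lattice_size P = 6 \<and> unimodularly_equivalent P exceptional_polytope)) \<or>
         (\<not> quasi_minimal P \<and> \<not> merged P \<and> (lattice_size P = 6 \<and> unimodularly_equivalent P exceptional_polytope))"
  using exceptional_exclusive[OF assms(1)] merged_not_quasi_minimal[of P]
    not_quasi_minimal_exceptional[OF assms(1,2)] unfolding exceptional_def by blast

end
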